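(* Let $z_0\in(0,1)$, $0<\varepsilon<1$, $L>0$, $\varsigma\ge1$, $\beta=1+\alpha$ with $0<\alpha<1$, and let $(\epsilon_n^* )_{n\ge1}$ be a sequence of positive numbers with $\epsilon_n^*\to0$. Let $S^*_h$ be the sequential kernel estimator defined in the context, with bandwidth $h=n^{-1/(2\beta+1)}$. Then $$\limsup_{n\to\infty}\ \sup_{S\in\mathcal U_n^{(\beta)}(\varepsilon,L,\epsilon_n^* )}\ \gamma(S)^{-1/2}\,\varphi_n\,\mathcal R_n(S^*_h,S)\ \le\ \mathbf E|\eta|,$$ where $\varphi_n=n^{\beta/(2\beta+1)}$, $\gamma(S)=1-S^2(z_0)$, and $\eta$ is a Gaussian random variable with mean $0$ and variance $1/2$.
   Context: Model: for each $n$, one observes $y_1,\dots,y_n$ with $y_k=S(x_k)y_{k-1}+\xi_k$, $1\le k\le n$, $x_k=k/n$, where the initial value $y_0$ is a fixed (nonrandom) real number, $S:[0,1]\to\mathbb R$ is unknown, and the $\xi_k$ are i.i.d. with density $p$ belonging to the class $\mathcal P_\varsigma$ of probability densities $p\ge0$ on $\mathbb R$ such that $\int x\,p(x)\,dx=0$, $\int x^2p(x)\,dx=1$ and $\sup_{k\ge1}\frac{1}{\varsigma^k(2k-1)!!}\int|x|^{2k}p(x)\,dx\le1$. $\mathbf E_{S,p}$ denotes expectation under the law of the observations corresponding to $S$ and $p$. Stability set: $\Theta_{\varepsilon,L}=\{S\in C^1([0,1],\mathbb R):\ \sup_{0\le x\le 1}|S(x)|\le1-\varepsilon,\ \sup_{0\le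 x\le 1}|\dot S(x)|\le L\}$. Weak stable local Hölder class at $z_0$: $\mathcal U_n^{(\beta)}(\varepsilon,L,\epsilon_n^* )=\{S\in\Theta_{\varepsilon,L}:\ |\Omega_h(z_0,S)|\le\epsilon_n^*h^\beta\}$, where $\Omega_h(z_0,S)=\int_{-1}^1\big(S(z_0+uh)-S(z_0)\big)\,du$ and $h=h_n=n^{-1/(2\beta+1)}$. Robust risk: $\mathcal R_n(\tilde S_n,S)=\sup_{p\in\mathcal P_\varsigma}\mathbf E_{S,p}|\tilde S_n-S(z_0)|$. Sequential kernel estimator $S^*_h$ (with parameters $n,h,\alpha$; $n$ large). Let $Q=\mathbf 1_{[-1,1]}$, $u_j=(x_j-z_0)/h$, $[\cdot]$ the integer part, $A_{k,m}=\sum_{j=k+1}^mQ(u_j)y_{j-1}^2$, $k_*=[nz_0-nh]+1$, $\tilde\epsilon=h^\alpha/\ln n$, $\iota=[\tilde\epsilon nh]+1$, $\nu=k_*+\iota$. Preliminary estimator: $\hat S_\nu=A_{0,\nu}^{-1}\sum_{j=1}^\nu Q(u_j)y_{j-1}y_j$, with truncation $\tilde S_\nu=\min(\max(\hat S_\nu,-1+\varepsilon),1-\varepsilon)$. Threshold: $H=\phi nh$ with $\phi=2(1-\tilde\epsilon)/(1-\tilde S_\nu^2)$. Stopping time: $\tau_H=\inf\{k\ge\nu+1:\ A_{\nu,k}\ge H\}$, with $\tau_H=n$ if no such $k\le n$ exists. Correction coefficient: on $\{A_{\nu,\tau_H}\ge H\}$, $\varkappa_H$ is defined by $A_{\nu,\tau_H-1}+\varkappa_HQ(u_{\tau_H})y_{\tau_H-1}^2=H$;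 on $\{A_{\nu,\tau_H}<H\}$, $\varkappa_H=1$. Then $$S^*_h=\frac1H\Big(\sum_{j=\nu+1}^{\tau_H-1}Q(u_j)y_{j-1}y_j+\varkappa_HQ(u_{\tau_H})y_{\tau_H-1}y_{\tau_H}\Big)\mathbf 1_{\{A_{\nu,n}\ge H\}}.$$ *)

theory Defs
  imports "HOL-Probability.Probability"
begin

definition double_fact_odd :: "nat \<Rightarrow> real" where
  \<comment> \<open>(2k - 1)!!\<close>
  "double_fact_odd k = (\<Prod>i = 1..k. 2 * real i - 1)"

definition noise_densities :: "real \<Rightarrow> (real \<Rightarrow> real) set" where
  "noise_densities \<sigma> =
     {p. (\<forall>x. 0 \<le> p x) \<and>
         has_bochner_integral lborel p 1 \<and>
         has_bochner_integral lborel (\<lambda>x. x * p x) 0 \<and>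
         has_bochner_integral lborel (\<lambda>x. x\<^sup>2 * p x) 1 \<and>
         (SUP k\<in>{1..}. ennreal (1 / (\<sigma> ^ k * double_fact_odd k)) *
            (\<integral>\<^sup>+x. ennreal (\<bar>x\<bar> ^ (2 * k) * p x) \<partial>lborel)) \<le> 1}"

primrec ar_path :: "nat \<Rightarrow> real \<Rightarrow> (real \<Rightarrow> real) \<Rightarrow> (nat \<Rightarrow> real) \<Rightarrow> nat \<Rightarrow> real" where
  "ar_path n y0 S \<xi> 0 = y0"
| "ar_path n y0 S \<xi> (Suc k) = S (real (Suc k) / real n) * ar_path n y0 S \<xi> k + \<xi> (Suc k)"

text \<open>The law of \<open>(y\<^sub>0, \<dots>, y\<^sub>n)\<close>, where \<open>y\<^sub>0\<close> is deterministic and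
  \<open>\<xi>\<^sub>1, \<dots>, \<xi>\<^sub>n\<close> are i.i.d. with Lebesgue density \<open>p\<close>.\<close>

definition obs_law :: "nat \<Rightarrow> real \<Rightarrow> (real \<Rightarrow> real) \<Rightarrow> (real \<Rightarrow> real) \<Rightarrow> (nat \<Rightarrow> real) measure" where
  "obs_law n y0 S p =
     distr (\<Pi>\<^sub>M k\<in>{1..n}. density lborel (\<lambda>x. ennreal (p x))) (\<Pi>\<^sub>M k\<in>{0..n}. borel)
       (\<lambda>\<xi>. restrict (ar_path n y0 S \<xi>) {0..n})"

text \<open>Functions on \<open>[0,1]\<close> are represented by total functions whose values outside \<open>[0,1]\<close> are
  unconstrained; derivatives at the end points are one-sided.\<close>

definition stability_set :: "real \<Rightarrow> real \<Rightarrow> (real \<Rightarrow> real) set" where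
  "stability_set \<epsilon> L =
     {S. (\<forall>x\<in>{0..1}. \<bar>S x\<bar> \<le> 1 - \<epsilon>) \<and>
         (\<exists>S'. continuous_on {0..1} S' \<and>
            (\<forall>x\<in>{0..1}. (S has_real_derivative S' x) (at x within {0..1}) \<and> \<bar>S' x\<bar> \<le> L))}"

definition Omega :: "real \<Rightarrow> real \<Rightarrow> (real \<Rightarrow> real) \<Rightarrow> real" where
  "Omega h z0 S = (LBINT u:{-1..1}. S (z0 + u * h) - S z0)"

definition bandwidth :: "real \<Rightarrow> nat \<Rightarrow> real" where
  "bandwidth \<beta> n = real n powr (- 1 / (2 * \<beta> + 1))"

text \<open>For all sufficiently large \<open>n\<close> the window \<open>[z0 - h, z0 + h]\<close> lies inside \<open>[0,1]\<close>, so that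
  \<open>Omega h z0 S\<close> only depends on \<open>S\<close> restricted to \<open>[0,1]\<close>.\<close>

definition weak_stable_holder ::
    "nat \<Rightarrow> real \<Rightarrow> real \<Rightarrow> real \<Rightarrow> real \<Rightarrow> real \<Rightarrow> (real \<Rightarrow> real) set" where
  "weak_stable_holder n z0 \<beta> \<epsilon> L e =
     {S \<in> stability_set \<epsilon> L.
        \<bar>Omega (bandwidth \<beta> n) z0 S\<bar> \<le> e * bandwidth \<beta> n powr \<beta>}"

text \<open>The risk is \<open>ennreal\<close>-valued, so that no finiteness is presupposed.\<close>

definition robust_risk ::
    "nat \<Rightarrow> real \<Rightarrow> real \<Rightarrow> real \<Rightarrow> ((nat \<Rightarrow> real) \<Rightarrow> real) \<Rightarrow> (real \<Rightarrow> real) \<Rightarrow> ennreal" where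
  "robust_risk n y0 \<sigma> z0 T S =
     (SUP p\<in>noise_densities \<sigma>. \<integral>\<^sup>+y. ennreal \<bar>T y - S z0\<bar> \<partial>obs_law n y0 S p)"

text \<open>The sequential kernel estimator, as a function of the observations \<open>y 0, \<dots>, y n\<close>.  The
  construction is meant for large \<open>n\<close>, when \<open>n z0 - n h\<close> and \<open>H\<close> are positive and the indices
  involved are at most \<open>n\<close>.\<close>

definition kweight :: "nat \<Rightarrow> real \<Rightarrow> real \<Rightarrow> nat \<Rightarrow> real" where
  \<comment> \<open>\<open>Q(u\<^sub>j)\<close>\<close>
  "kweight n h z0 j = indicator {-1..1} ((real j / real n - z0) / h)"

definition Asum :: "nat \<Rightarrow> real \<Rightarrow> real \<Rightarrow> (nat \<Rightarrow> real) \<Rightarrow> nat \<Rightarrow> nat \<Rightarrow> real" where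
  "Asum n h z0 y k m = (\<Sum>j = k + 1..m. kweight n h z0 j * (y (j - 1))\<^sup>2)"

definition eps_tilde :: "nat \<Rightarrow> real \<Rightarrow> real \<Rightarrow> real" where
  "eps_tilde n h \<alpha> = h powr \<alpha> / ln (real n)"

definition nu_index :: "nat \<Rightarrow> real \<Rightarrow> real \<Rightarrow> real \<Rightarrow> nat" where
  \<comment> \<open>\<open>\<nu> = k\<^sub>* + \<iota>\<close>\<close>
  "nu_index n h \<alpha> z0 =
     (nat \<lfloor>real n * z0 - real n * h\<rfloor> + 1) + (nat \<lfloor>eps_tilde n h \<alpha> * real n * h\<rfloor> + 1)"

definition prelim_est :: "nat \<Rightarrow> real \<Rightarrow> real \<Rightarrow> real \<Rightarrow> (nat \<Rightarrow> real) \<Rightarrow> real" where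
  "prelim_est n h \<alpha> z0 y =
     (let \<nu> = nu_index n h \<alpha> z0 in
        (\<Sum>j = 1..\<nu>. kweight n h z0 j * y (j - 1) * y j) / Asum n h z0 y 0 \<nu>)"

definition trunc_est :: "nat \<Rightarrow> real \<Rightarrow> real \<Rightarrow> real \<Rightarrow> real \<Rightarrow> (nat \<Rightarrow> real) \<Rightarrow> real" where
  "trunc_est n h \<alpha> \<epsilon> z0 y = min (max (prelim_est n h \<alpha> z0 y) (- 1 + \<epsilon>)) (1 - \<epsilon>)"

definition threshold :: "nat \<Rightarrow> real \<Rightarrow> real \<Rightarrow> real \<Rightarrow> real \<Rightarrow> (nat \<Rightarrow> real) \<Rightarrow> real" where
  "threshold n h \<alpha> \<epsilon> z0 y =
     2 * (1 - eps_tilde n h \<alpha>) / (1 - (trunc_est n h \<alpha> \<epsilon> z0 y)\<^sup>2) * real n * h"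

definition stop_time :: "nat \<Rightarrow> real \<Rightarrow> real \<Rightarrow> real \<Rightarrow> real \<Rightarrow> (nat \<Rightarrow> real) \<Rightarrow> nat" where
  "stop_time n h \<alpha> \<epsilon> z0 y =
     (let \<nu> = nu_index n h \<alpha> z0;
          hit = (\<lambda>k. \<nu> + 1 \<le> k \<and> k \<le> n \<and> threshold n h \<alpha> \<epsilon> z0 y \<le> Asum n h z0 y \<nu> k)
      in if \<exists>k. hit k then LEAST k. hit k else n)"

definition corr_coeff :: "nat \<Rightarrow> real \<Rightarrow> real \<Rightarrow> real \<Rightarrow> real \<Rightarrow> (nat \<Rightarrow> real) \<Rightarrow> real" where
  "corr_coeff n h \<alpha> \<epsilon> z0 y =
     (let \<nu> = nu_index n h \<alpha> z0; H = threshold n h \<alpha> \<epsilon> z0 y; \<tau> = stop_time n h \<alpha> \<epsilon> z0 y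
      in if H \<le> Asum n h z0 y \<nu> \<tau>
         then THE \<kappa>. Asum n h z0 y \<nu> (\<tau> - 1) + \<kappa> * kweight n h z0 \<tau> * (y (\<tau> - 1))\<^sup>2 = H
         else 1)"

definition seq_kernel_est :: "nat \<Rightarrow> real \<Rightarrow> real \<Rightarrow> real \<Rightarrow> real \<Rightarrow> (nat \<Rightarrow> real) \<Rightarrow> real" where
  "seq_kernel_est n h \<alpha> \<epsilon> z0 y =
     (let \<nu> = nu_index n h \<alpha> z0; H = threshold n h \<alpha> \<epsilon> z0 y; \<tau> = stop_time n h \<alpha> \<epsilon> z0 y
      in 1 / H * ((\<Sum>j = \<nu> + 1..\<tau> - 1. kweight n h z0 j * y (j - 1) * y j)
                  + corr_coeff n h \<alpha> \<epsilon> z0 y * kweight n h z0 \<tau> * y (\<tau> - 1) * y \<tau>)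
         * of_bool (H \<le> Asum n h z0 y \<nu> n))"

end

(* The stopping rule makes the weights of the estimator predictable: with
   c_j = (min(A_j, H) - min(A_(j-1), H)) / y_(j-1) the estimator is (sum_j c_j y_j) / H as soon as
   A_n >= H, where sum_j c_j y_(j-1) = H and sum_j c_j^2 <= H.  Hence its error splits into the
   martingale (sum_j c_j xi_j) / H, a bias, and the event A_n < H.

   After rescaling, the squared predictable weights of the martingale sum up to at most a quantity r
   that is known at time nu and close to 1/2.  A Lindeberg replacement, started at the random time
   horizon r and using only that the weights do not exceed this budget, bounds the expected absolute
   value of the martingale by that of a normal variable with variance r, uniformly in the noise
   density; no central limit theorem for stopped sums is needed.

   Summation by parts of y_j^2 = s_j^2 y_(j-1)^2 + 1 + martingale difference replaces y_(j-1)^2 by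
   1 / (1 - S(z0)^2) in the bias, which reduces it to the Riemann sum of Omega_h.  The same identity
   controls the sums A.  The preliminary estimator errs by more than a multiple of eps_tilde with
   probability o(1/phi_n), by fourth moments of the linear martingale in its numerator and second
   moments of the quadratic one in its denominator.  All exceptional events are replaced by
   polynomial majorants of their indicators, so that only moments have to be estimated. *)

theory Submission
  imports Defs "HOL-Real_Asymp.Real_Asymp"
begin

text \<open>Write p = sqrt(n h) and E = eps_tilde n h. The bandwidth gives p = phi_n, h^\<beta> =
  1/p and h p = h^(-\<alpha>), so h p eps_tilde = 1 / ln n. This is what the preliminary block
  contributes to the scaled bias, and only the logarithm in eps_tilde makes it vanish. A failing
  preliminary estimate costs an error of order 1, hence p after scaling. Its numerator is a
  martingale over about E steps that must stay below a multiple of eps_tilde E. Second moments would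
  leave p / (eps_tilde^2 E), which is n^((2 \<alpha> - 1)/(2 \<beta> + 1)) up to logarithms and
  diverges for \<alpha> >= 1/2; fourth moments leave a multiple of (1 / (eps_tilde^2 p))^3, which
  vanishes for every \<alpha> < 1. The factor 1 - eps_tilde in the threshold is slack: A_n is about
  (2 n h - E) / gamma(S) and H about (2 n h - 2 E) / gamma(S), so A_n < H needs a fluctuation of
  order E. The budget r is n h / (gamma(S) H); as gamma(S) H is near 2 n h, it is near 1/2, the
  variance of the limit.\<close>

lemma abs3_le: "\<bar>t::real\<bar> ^ 3 \<le> 1 + t ^ 4"
proof (cases "\<bar>t\<bar> \<le> 1")
  case True
  then have "\<bar>t\<bar> ^ 3 \<le> 1" by (simp add: power_le_one)
  moreover have "0 \<le> t ^ 4" by simp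
  ultimately show ?thesis by linarith
next
  case False
  then have "\<bar>t\<bar> ^ 3 \<le> \<bar>t\<bar> ^ 4" by (intro power_increasing) auto
  then show ?thesis by simp
qed

section \<open>Centred noise with unit variance\<close>

locale centered_noise = prob_space D for D :: "real measure" +
  fixes m4 :: real
  assumes sets_D [measurable_cong, simp]: "sets D = sets borel"
    and mean0: "has_bochner_integral D (\<lambda>t. t) 0"
    and var1: "has_bochner_integral D (\<lambda>t. t\<^sup>2) 1"
    and int4: "integrable D (\<lambda>t. t ^ 4)"
    and le_m4: "(\<integral>t. t ^ 4 \<partial>D) \<le> m4"
begin

lemma space_D [simp]: "space D = UNIV"
  using sets_eq_imp_space_eq[OF sets_D] by simp

lemma prob_UNIV [simp]: "prob UNIV = 1"
  using prob_space by simp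

lemma int1: "integrable D (\<lambda>t. t)" "(\<integral>t. t \<partial>D) = 0"
  using mean0 by (auto simp: has_bochner_integral_iff)

lemma int2: "integrable D (\<lambda>t. t\<^sup>2)" "(\<integral>t. t\<^sup>2 \<partial>D) = 1"
  using var1 by (auto simp: has_bochner_integral_iff)

lemma int3: "integrable D (\<lambda>t. t ^ 3)" "integrable D (\<lambda>t. \<bar>t\<bar> ^ 3)"
proof -
  have i: "integrable D (\<lambda>t. 1 + t ^ 4)" using int4 by simp
  show "integrable D (\<lambda>t. t ^ 3)"
    by (rule Bochner_Integration.integrable_bound[OF i]) (use abs3_le in \<open>auto simp: power_abs abs_of_nonneg\<close>)
  show "integrable D (\<lambda>t. \<bar>t\<bar> ^ 3)"
    by (rule Bochner_Integration.integrable_bound[OF i]) (use abs3_le in \<open>auto simp: power_abs abs_of_nonneg\<close>)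
qed

lemma int_abs3_le: "(\<integral>t. \<bar>t\<bar> ^ 3 \<partial>D) \<le> 1 + m4"
proof -
  have "(\<integral>t. \<bar>t\<bar> ^ 3 \<partial>D) \<le> (\<integral>t. 1 + t ^ 4 \<partial>D)"
    by (intro integral_mono int3 Bochner_Integration.integrable_add int4) (auto simp: abs3_le)
  also have "\<dots> \<le> 1 + m4" using int4 le_m4 by (simp add: prob_space)
  finally show ?thesis .
qed

lemma one_le_m4: "1 \<le> m4"
proof -
  have "(\<integral>t. 2 * t\<^sup>2 - 1 \<partial>D) \<le> (\<integral>t. t ^ 4 \<partial>D)"
  proof (intro integral_mono int4)
    show "integrable D (\<lambda>t. 2 * t\<^sup>2 - 1)" using int2 by simp
    fix t :: real
    have "0 \<le> (t\<^sup>2 - 1)\<^sup>2" by simp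
    then show "2 * t\<^sup>2 - 1 \<le> t ^ 4" by (simp add: power2_eq_square algebra_simps power4_eq_xxxx)
  qed
  also have "(\<integral>t. 2 * t\<^sup>2 - 1 \<partial>D) = 1" using int2 by (simp add: prob_space)
  finally show ?thesis using le_m4 by simp
qed

lemma nn_int_fourth_affine:
  "(\<integral>\<^sup>+t. ennreal ((q * x + c * t) ^ 4) \<partial>D)
    = ennreal ((q * x) ^ 4 + 6 * (q * x)\<^sup>2 * c\<^sup>2 + 4 * (q * x) * c ^ 3 * (\<integral>t. t ^ 3 \<partial>D) + c ^ 4 * (\<integral>t. t ^ 4 \<partial>D))"
proof -
  have eq: "(q * x + c * t) ^ 4 = (q * x) ^ 4 + 4 * (q * x) ^ 3 * c * t + 6 * (q * x)\<^sup>2 * c\<^sup>2 * t\<^sup>2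
     + 4 * (q * x) * c ^ 3 * t ^ 3 + c ^ 4 * t ^ 4" for t
    by algebra
  have "has_bochner_integral D (\<lambda>t. (q * x + c * t) ^ 4)
     ((q * x) ^ 4 + 4 * (q * x) ^ 3 * c * 0 + 6 * (q * x)\<^sup>2 * c\<^sup>2 * 1
     + 4 * (q * x) * c ^ 3 * (\<integral>t. t ^ 3 \<partial>D) + c ^ 4 * (\<integral>t. t ^ 4 \<partial>D))"
    unfolding eq using int1 int2 int3 int4
    by (auto simp: has_bochner_integral_iff prob_space)
  then show ?thesis
    by (subst nn_integral_eq_integral) (auto simp: has_bochner_integral_iff)
qed

lemma nn_int_square_shift:
  assumes "has_bochner_integral D g 0" and "integrable D (\<lambda>t. (g t)\<^sup>2)" "(\<integral>t. (g t)\<^sup>2 \<partial>D) \<le> v"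
  shows "(\<integral>\<^sup>+t. ennreal ((x + g t)\<^sup>2) \<partial>D) \<le> ennreal (x\<^sup>2 + v)"
proof -
  have eq: "(x + g t)\<^sup>2 = x\<^sup>2 + 2 * x * g t + (g t)\<^sup>2" for t by algebra
  have "has_bochner_integral D (\<lambda>t. (x + g t)\<^sup>2) (x\<^sup>2 + 2 * x * 0 + (\<integral>t. (g t)\<^sup>2 \<partial>D))"
    unfolding eq using assms by (auto simp: has_bochner_integral_iff prob_space)
  then have "(\<integral>\<^sup>+t. ennreal ((x + g t)\<^sup>2) \<partial>D) = ennreal (x\<^sup>2 + (\<integral>t. (g t)\<^sup>2 \<partial>D))"
    by (subst nn_integral_eq_integral) (auto simp: has_bochner_integral_iff)
  also have "\<dots> \<le> ennreal (x\<^sup>2 + v)" using assms by (intro ennreal_leI) auto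
  finally show ?thesis .
qed

end

lemma centered_noise_std_normal: "centered_noise (density lborel std_normal_density) 3"
proof -
  interpret prob_space "density lborel std_normal_density" by (rule prob_space_normal_density) simp
  have a: "has_bochner_integral (density lborel std_normal_density) f v"
    if "has_bochner_integral lborel (\<lambda>x. std_normal_density x * f x) v" "f \<in> borel_measurable borel" for f v
    using that by (intro has_bochner_integral_density) (auto simp: )
  have 1: "has_bochner_integral (density lborel std_normal_density) (\<lambda>t. t) 0"
    using std_normal_moment_odd[of 0] by (intro a) auto
  have 2: "has_bochner_integral (density lborel std_normal_density) (\<lambda>t. t\<^sup>2) 1"
    using std_normal_moment_even[of 1] by (intro a) (auto simp: numeral_2_eq_2)
  have 4: "has_bochner_integral (density lborel std_normal_density) (\<lambda>t. t ^ 4) 3"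
    using std_normal_moment_even[of 2] by (intro a) (auto simp: fact_numeral)
  show ?thesis
    by unfold_locales (use 1 2 4 in \<open>auto simp: has_bochner_integral_iff\<close>)
qed

lemma double_fact_odd_2: "double_fact_odd 2 = 3"
  by (simp add: double_fact_odd_def numeral_2_eq_2)

text \<open>The term \<open>k = 2\<close> of the supremum, where (2k-1)!! = 3, yields the
  fourth-moment bound. Later constants involve the density only through
  \<open>3 * \<sigma>\<^sup>2\<close>, which makes all estimates uniform over the noise
  class.\<close>

lemma centered_noise_density:
  assumes p: "p \<in> noise_densities \<sigma>" and \<sigma>: "1 \<le> \<sigma>"
  shows "centered_noise (density lborel (\<lambda>x. ennreal (p x))) (3 * \<sigma>\<^sup>2)"
proof -
  let ?D = "density lborel (\<lambda>x. ennreal (p x))"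
  from p have pos: "\<And>x. 0 \<le> p x" and i0: "has_bochner_integral lborel p 1"
    and i1: "has_bochner_integral lborel (\<lambda>x. x * p x) 0"
    and i2: "has_bochner_integral lborel (\<lambda>x. x\<^sup>2 * p x) 1"
    and i4: "(SUP k\<in>{1..}. ennreal (1 / (\<sigma> ^ k * double_fact_odd k)) *
            (\<integral>\<^sup>+x. ennreal (\<bar>x\<bar> ^ (2 * k) * p x) \<partial>lborel)) \<le> 1"
    by (auto simp: noise_densities_def)
  have pm [measurable]: "p \<in> borel_measurable borel"
    using i0 by (auto simp: has_bochner_integral_iff dest: borel_measurable_integrable)
  have "emeasure ?D (space ?D) = (\<integral>\<^sup>+x. ennreal (p x) \<partial>lborel)"
    by (subst emeasure_density) auto
  also have "\<dots> = 1"
    using i0 pos by (subst nn_integral_eq_integral) (auto simp: has_bochner_integral_iff)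
  finally interpret prob_space ?D by (rule prob_spaceI)
  have a: "has_bochner_integral ?D f v"
    if "has_bochner_integral lborel (\<lambda>x. f x * p x) v" "f \<in> borel_measurable borel" for f :: "real \<Rightarrow> real" and v
    using that pos by (intro has_bochner_integral_density) (auto simp: mult.commute)
  have "ennreal (1 / (\<sigma> ^ 2 * double_fact_odd 2)) *
            (\<integral>\<^sup>+x. ennreal (\<bar>x\<bar> ^ (2 * 2) * p x) \<partial>lborel) \<le> 1"
    by (rule order_trans[OF _ i4]) (rule SUP_upper, simp)
  then have "ennreal (3 * \<sigma>\<^sup>2) * (ennreal (1 / (3 * \<sigma>\<^sup>2)) * (\<integral>\<^sup>+x. ennreal (x ^ 4 * p x) \<partial>lborel)) \<le> ennreal (3 * \<sigma>\<^sup>2) * 1"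
    by (intro mult_left_mono) (auto simp: double_fact_odd_2 mult.commute)
  then have le: "(\<integral>\<^sup>+x. ennreal (x ^ 4 * p x) \<partial>lborel) \<le> ennreal (3 * \<sigma>\<^sup>2)"
    using \<sigma> by (simp add: mult.assoc[symmetric] ennreal_mult''[symmetric])
  have eq: "(\<integral>\<^sup>+x. ennreal (x ^ 4) \<partial>?D) = (\<integral>\<^sup>+x. ennreal (x ^ 4 * p x) \<partial>lborel)"
    using pos by (subst nn_integral_density) (auto simp: ennreal_mult'' mult.commute)
  have int: "integrable ?D (\<lambda>x. x ^ 4)"
    by (rule integrableI_nonneg) (use le eq le_less_trans[OF le] in auto)
  have "ennreal (\<integral>x. x ^ 4 \<partial>?D) = (\<integral>\<^sup>+x. ennreal (x ^ 4) \<partial>?D)"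
    by (rule nn_integral_eq_integral[symmetric, OF int]) auto
  then have "ennreal (\<integral>x. x ^ 4 \<partial>?D) \<le> ennreal (3 * \<sigma>\<^sup>2)"
    using le eq by simp
  then have le': "(\<integral>x. x ^ 4 \<partial>?D) \<le> 3 * \<sigma>\<^sup>2"
    by (subst (asm) ennreal_le_iff) auto
  show ?thesis
  proof
    show "has_bochner_integral ?D (\<lambda>t. t) 0" using i1 by (rule a) simp
    show "has_bochner_integral ?D (\<lambda>t. t\<^sup>2) 1" using i2 by (rule a) simp
  qed (simp, fact int, fact le')
qed

section \<open>Independent noise variables and upper bounds for expectations\<close>

locale noise_sequence = centered_noise +
  fixes n :: nat
begin

definition P :: "(nat \<Rightarrow> real) measure" where "P = (\<Pi>\<^sub>M k\<in>{1..n}. D)"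

sublocale PS: product_sigma_finite "\<lambda>_::nat. D"
  by unfold_locales

sublocale PP: prob_space P
  unfolding P_def by (intro prob_space_PiM) unfold_locales

lemma sets_P [measurable_cong]: "sets P = sets (\<Pi>\<^sub>M k\<in>{1..n}. D)"
  by (simp add: P_def)

lemma measurable_coord: "k \<in> {1..n} \<Longrightarrow> (\<lambda>\<omega>. \<omega> k) \<in> borel_measurable P"
proof -
  assume k: "k \<in> {1..n}"
  have "(\<lambda>\<omega>. \<omega> k) \<in> measurable (\<Pi>\<^sub>M k\<in>{1..n}. D) D"
    using k by (rule measurable_component_singleton)
  then show ?thesis by (simp add: P_def cong: measurable_cong_sets)
qed

text \<open>Fubini in coordinate \<open>k\<close>: the average over that coordinate no longer
  depends on it, so averaging once more changes nothing. This stands in for the tower property, with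
  conditional expectations written as integrals over one coordinate.\<close>

lemma resample:
  assumes k: "k \<in> {1..n}" and [measurable]: "f \<in> borel_measurable P"
  shows "(\<integral>\<^sup>+\<omega>. f \<omega> \<partial>P) = (\<integral>\<^sup>+\<omega>. (\<integral>\<^sup>+t. f (fun_upd \<omega> k t) \<partial>D) \<partial>P)"
proof -
  let ?I = "{1..n} - {k}"
  have I: "insert k ?I = {1..n}" using k by auto
  have f: "f \<in> borel_measurable (\<Pi>\<^sub>M k\<in>insert k ?I. D)"
    unfolding I P_def[symmetric] by fact
  have fk: "(\<lambda>\<omega>. \<integral>\<^sup>+t. f (fun_upd \<omega> k t) \<partial>D) \<in> borel_measurable (\<Pi>\<^sub>M k\<in>insert k ?I. D)"
  proof -
    have *: "(\<lambda>(\<omega>, t). fun_upd \<omega> k t) \<in> measurable (Pi\<^sub>M {1..n} (\<lambda>_. D) \<Otimes>\<^sub>M D) (Pi\<^sub>M {1..n} (\<lambda>_. D))"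
    proof (rule measurable_PiM_single')
      fix i assume i: "i \<in> {1..n}"
      show "(\<lambda>\<omega>. (case \<omega> of (\<omega>, t) \<Rightarrow> fun_upd \<omega> k t) i) \<in> measurable (Pi\<^sub>M {1..n} (\<lambda>_. D) \<Otimes>\<^sub>M D) D"
        using i by (cases "i = k") (auto simp: case_prod_unfold)
    next
      show "(\<lambda>\<omega> i. (case \<omega> of (\<omega>, t) \<Rightarrow> fun_upd \<omega> k t) i) \<in> space (Pi\<^sub>M {1..n} (\<lambda>_. D) \<Otimes>\<^sub>M D) \<rightarrow> {1..n} \<rightarrow>\<^sub>E space D"
        using k by (auto simp: space_pair_measure space_PiM PiE_def extensional_def)
    qed
    have "(\<lambda>(\<omega>, t). f (fun_upd \<omega> k t)) \<in> borel_measurable (P \<Otimes>\<^sub>M D)"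
      using measurable_compose[OF *[folded P_def] assms(2)]
      by (simp only: case_prod_unfold)
    then have "(\<lambda>\<omega>. \<integral>\<^sup>+t. f (fun_upd \<omega> k t) \<partial>D) \<in> borel_measurable P"
      by (intro borel_measurable_nn_integral) (auto simp: case_prod_unfold)
    then show ?thesis unfolding I by (simp add: P_def)
  qed
  have "(\<integral>\<^sup>+\<omega>. (\<integral>\<^sup>+t. f (fun_upd \<omega> k t) \<partial>D) \<partial>P)
      = (\<integral>\<^sup>+\<omega>. (\<integral>\<^sup>+t. f (fun_upd \<omega> k t) \<partial>D) \<partial>Pi\<^sub>M (insert k ?I) (\<lambda>_. D))"
    unfolding I P_def ..
  also have "\<dots> = (\<integral>\<^sup>+\<omega>. (\<integral>\<^sup>+s. (\<integral>\<^sup>+t. f (fun_upd (fun_upd \<omega> k s) k t) \<partial>D) \<partial>D) \<partial>Pi\<^sub>M ?I (\<lambda>_. D))"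
    by (rule PS.product_nn_integral_insert) (use fk in auto)
  \<comment> \<open>The value \<open>s\<close> is overwritten by \<open>t\<close>, so the integral
    over \<open>s\<close> is that of a constant against a probability measure.\<close>
  also have "\<dots> = (\<integral>\<^sup>+\<omega>. (\<integral>\<^sup>+t. f (fun_upd \<omega> k t) \<partial>D) \<partial>Pi\<^sub>M ?I (\<lambda>_. D))"
    using emeasure_space_1 by simp
  also have "\<dots> = (\<integral>\<^sup>+\<omega>. f \<omega> \<partial>Pi\<^sub>M (insert k ?I) (\<lambda>_. D))"
    by (rule PS.product_nn_integral_insert[symmetric]) (use f in auto)
  finally show ?thesis unfolding I P_def by simp
qed

text \<open>Only the positive part of \<open>f\<close> matters here, so bounds of this kind add up and
  scale without any integrability condition.\<close>

definition EB :: "((nat \<Rightarrow> real) \<Rightarrow> real) \<Rightarrow> real \<Rightarrow> bool" where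
  "EB f c \<longleftrightarrow> f \<in> borel_measurable P \<and> 0 \<le> c \<and> (\<integral>\<^sup>+\<omega>. ennreal (f \<omega>) \<partial>P) \<le> ennreal c"

lemma EB_mono:
  assumes "EB g c" "f \<in> borel_measurable P" "\<And>\<omega>. f \<omega> \<le> g \<omega>" "c \<le> d"
  shows "EB f d"
proof -
  have "(\<integral>\<^sup>+\<omega>. ennreal (f \<omega>) \<partial>P) \<le> (\<integral>\<^sup>+\<omega>. ennreal (g \<omega>) \<partial>P)"
    using assms by (intro nn_integral_mono ennreal_leI) auto
  also have "\<dots> \<le> ennreal c" using assms by (simp add: EB_def)
  also have "\<dots> \<le> ennreal d" using assms by (intro ennreal_leI)
  finally show ?thesis using assms by (auto simp: EB_def)
qed

lemma EB_const: "0 \<le> c \<Longrightarrow> EB (\<lambda>_. c) c"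
  by (simp add: EB_def PP.emeasure_space_1)

lemma EB_add:
  assumes "EB f c" "EB g d"
  shows "EB (\<lambda>\<omega>. f \<omega> + g \<omega>) (c + d)"
proof -
  have [measurable]: "f \<in> borel_measurable P" "g \<in> borel_measurable P"
    using assms by (auto simp: EB_def)
  have "ennreal (a + b) \<le> ennreal a + ennreal b" for a b
  proof -
    have "ennreal (a + b) \<le> ennreal (max 0 a + max 0 b)" by (intro ennreal_leI) auto
    also have "\<dots> = ennreal (max 0 a) + ennreal (max 0 b)" by simp
    also have "\<dots> = ennreal a + ennreal b" by (simp add: max_def ennreal_neg)
    finally show ?thesis .
  qed
  then have "(\<integral>\<^sup>+\<omega>. ennreal (f \<omega> + g \<omega>) \<partial>P) \<le> (\<integral>\<^sup>+\<omega>. ennreal (f \<omega>) + ennreal (g \<omega>) \<partial>P)"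
    by (intro nn_integral_mono)
  also have "\<dots> = (\<integral>\<^sup>+\<omega>. ennreal (f \<omega>) \<partial>P) + (\<integral>\<^sup>+\<omega>. ennreal (g \<omega>) \<partial>P)"
    by (rule nn_integral_add) auto
  also have "\<dots> \<le> ennreal c + ennreal d" using assms by (intro add_mono) (auto simp: EB_def)
  also have "\<dots> = ennreal (c + d)" using assms by (simp add: EB_def)
  finally show ?thesis using assms by (auto simp: EB_def)
qed

lemma EB_cmult:
  assumes "EB f c" "0 \<le> a"
  shows "EB (\<lambda>\<omega>. a * f \<omega>) (a * c)"
proof -
  have [measurable]: "f \<in> borel_measurable P"
    using assms by (auto simp: EB_def)
  have "(\<integral>\<^sup>+\<omega>. ennreal (a * f \<omega>) \<partial>P) = ennreal a * (\<integral>\<^sup>+\<omega>. ennreal (f \<omega>) \<partial>P)"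
    using assms by (simp add: ennreal_mult' nn_integral_cmult)
  also have "\<dots> \<le> ennreal a * ennreal c" using assms by (intro mult_left_mono) (auto simp: EB_def)
  finally show ?thesis using assms by (auto simp: EB_def ennreal_mult)
qed

lemma EB_sum:
  assumes "finite I" "\<And>i. i \<in> I \<Longrightarrow> EB (f i) (c i)"
  shows "EB (\<lambda>\<omega>. \<Sum>i\<in>I. f i \<omega>) (\<Sum>i\<in>I. c i)"
  using assms
proof (induction I rule: finite_induct)
  case empty
  then show ?case using EB_const[of 0] by simp
next
  case (insert i I)
  then show ?case using EB_add[of "f i" "c i"] by simp
qed

text \<open>One-sided tower property. Every induction over time takes one such step, with
  \<open>g\<close> the bound that results from averaging out the newest noise variable.\<close>

lemma EB_resample:
  assumes k: "k \<in> {1..n}" and f: "f \<in> borel_measurable P" and g: "EB g c"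
    and le: "\<And>\<omega>. (\<integral>\<^sup>+t. ennreal (f (fun_upd \<omega> k t)) \<partial>D) \<le> ennreal (g \<omega>)"
  shows "EB f c"
proof -
  have "(\<integral>\<^sup>+\<omega>. ennreal (f \<omega>) \<partial>P) = (\<integral>\<^sup>+\<omega>. (\<integral>\<^sup>+t. ennreal (f (fun_upd \<omega> k t)) \<partial>D) \<partial>P)"
    by (rule resample[OF k]) (use f in simp)
  also have "\<dots> \<le> (\<integral>\<^sup>+\<omega>. ennreal (g \<omega>) \<partial>P)"
    by (intro nn_integral_mono le)
  also have "\<dots> \<le> ennreal c" using g by (simp add: EB_def)
  finally show ?thesis using f g by (auto simp: EB_def)
qed

text \<open>Predictability without sigma-algebras: invariance under any change of a noise variable
  with index at least \<open>k\<close>. In this form it rewrites directly under the integral of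
  \<open>EB_resample\<close>.\<close>

definition past :: "nat \<Rightarrow> ((nat \<Rightarrow> real) \<Rightarrow> 'c) \<Rightarrow> bool" where
  "past k f \<longleftrightarrow> (\<forall>\<omega> j t. k \<le> j \<longrightarrow> f (fun_upd \<omega> j t) = f \<omega>)"

lemma pastD: "past k f \<Longrightarrow> k \<le> j \<Longrightarrow> f (fun_upd \<omega> j t) = f \<omega>"
  by (simp add: past_def)

end

section \<open>Lindeberg replacement for budgeted martingales\<close>

abbreviation std_normal :: "real measure" where
  "std_normal \<equiv> density lborel std_normal_density"

text \<open>A smooth majorant of the absolute value that exceeds it by at most \<open>d\<close>. Its
  third derivative is of order 1 / d^2, so \<open>d\<close> stays fixed while n grows and is chosen
  small at the very end.\<close>

definition smooth_abs :: "real \<Rightarrow> real \<Rightarrow> real" where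
  "smooth_abs d x = sqrt (x\<^sup>2 + d\<^sup>2)"

lemma smooth_abs_nonneg [simp]: "0 \<le> smooth_abs d x"
  by (simp add: smooth_abs_def)

lemma abs_le_smooth_abs: "\<bar>x\<bar> \<le> smooth_abs d x"
  unfolding smooth_abs_def by (rule real_le_rsqrt) simp

lemma smooth_abs_le: "0 < d \<Longrightarrow> smooth_abs d x \<le> \<bar>x\<bar> + d"
  unfolding smooth_abs_def by (rule real_le_lsqrt) (auto simp: power2_sum)

lemma measurable_smooth_abs [measurable]: "smooth_abs d \<in> borel_measurable borel"
  unfolding smooth_abs_def by measurable

lemma smooth_abs_pos: "0 < d \<Longrightarrow> 0 < smooth_abs d x"
  by (simp add: smooth_abs_def sum_power2_gt_zero_iff)

lemma smooth_abs_sq: "(smooth_abs d x)\<^sup>2 = x\<^sup>2 + d\<^sup>2"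
  by (simp add: smooth_abs_def)

lemma DERIV_smooth_abs:
  assumes "0 < d"
  shows "(smooth_abs d has_real_derivative x / smooth_abs d x) (at x)"
proof -
  have "0 < x\<^sup>2 + d\<^sup>2" using assms by (simp add: sum_power2_gt_zero_iff)
  then show ?thesis
    unfolding smooth_abs_def by (auto intro!: derivative_eq_intros simp: field_simps)
qed

text \<open>The third derivative at x is -3 d^2 x / f^5 with f = \<open>smooth_abs d x\<close>;
  since f dominates both |x| and d, it is at most 3 / d^2 in absolute value, and division by 3!
  gives the constant.\<close>

lemma smooth_abs_taylor:
  assumes d: "0 < d"
  shows "\<bar>smooth_abs d (x + h) - smooth_abs d x - h * (x / smooth_abs d x) - h\<^sup>2 / 2 * (d\<^sup>2 / smooth_abs d x ^ 3)\<bar>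
    \<le> \<bar>h\<bar> ^ 3 / (2 * d\<^sup>2)"
proof -
  define f where "f = smooth_abs d"
  have fp: "0 < f t" for t using smooth_abs_pos[OF d] by (simp add: f_def)
  have fsq: "(f t)\<^sup>2 = t\<^sup>2 + d\<^sup>2" for t by (simp add: f_def smooth_abs_sq)
  have df: "(f has_real_derivative t / f t) (at t)" for t
    using DERIV_smooth_abs[OF d] by (simp add: f_def)
  define D where "D = (\<lambda>m t. if m = 0 then f (x + t) else if m = Suc 0 then (x + t) / f (x + t)
     else if m = 2 then d\<^sup>2 / f (x + t) ^ 3 else - 3 * d\<^sup>2 * (x + t) / f (x + t) ^ 5)"
  have df': "((\<lambda>t. f (x + t)) has_real_derivative (x + t) / f (x + t)) (at t)" for t
  proof -
    have "((\<lambda>t. x + t) has_real_derivative 1) (at t)" by (auto intro!: derivative_eq_intros)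
    from DERIV_chain2[OF df this] show ?thesis by simp
  qed
  have 1: "((\<lambda>t. (x + t) / f (x + t)) has_real_derivative d\<^sup>2 / f (x + t) ^ 3) (at t)" for t
  proof -
    let ?F = "f (x + t)"
    have ne: "?F \<noteq> 0" using fp[of "x + t"] by simp
    have "((\<lambda>t. (x + t) / f (x + t)) has_real_derivative (1 * ?F - (x + t) * ((x + t) / ?F)) / (?F * ?F)) (at t)"
      using ne by (intro DERIV_divide df') (auto intro!: derivative_eq_intros)
    also have "(1 * ?F - (x + t) * ((x + t) / ?F)) / (?F * ?F) = (?F\<^sup>2 - (x + t)\<^sup>2) / ?F ^ 3"
      using ne by (simp add: field_simps power2_eq_square power3_eq_cube)
    also have "?F\<^sup>2 - (x + t)\<^sup>2 = d\<^sup>2" by (simp add: fsq)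
    finally show ?thesis .
  qed
  have 2: "((\<lambda>t. d\<^sup>2 / f (x + t) ^ 3) has_real_derivative - 3 * d\<^sup>2 * (x + t) / f (x + t) ^ 5) (at t)" for t
  proof -
    let ?F = "f (x + t)"
    have ne: "?F \<noteq> 0" using fp[of "x + t"] by simp
    have "((\<lambda>t. d\<^sup>2 / f (x + t) ^ 3) has_real_derivative
       (0 * ?F ^ 3 - d\<^sup>2 * (of_nat 3 * (((x + t) / ?F) * ?F ^ (3 - Suc 0)))) / (?F ^ 3 * ?F ^ 3)) (at t)"
      using ne by (intro DERIV_divide DERIV_power df') (auto intro!: derivative_eq_intros)
    moreover have "(0 * ?F ^ 3 - d\<^sup>2 * (of_nat 3 * (((x + t) / ?F) * ?F ^ (3 - Suc 0)))) / (?F ^ 3 * ?F ^ 3)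
       = - 3 * d\<^sup>2 * (x + t) / ?F ^ 5"
      using ne by (simp add: field_simps eval_nat_numeral)
    ultimately show ?thesis by simp
  qed
  have "\<exists>t. \<bar>t\<bar> \<le> \<bar>h\<bar> \<and> f (x + h) = (\<Sum>m<3. D m 0 / fact m * h ^ m) + D 3 t / fact 3 * h ^ 3"
  proof (rule Maclaurin_bi_le)
    show "D 0 = (\<lambda>t. f (x + t))" by (simp add: D_def fun_eq_iff)
    show "\<forall>m t. m < 3 \<and> \<bar>t\<bar> \<le> \<bar>h\<bar> \<longrightarrow> (D m has_real_derivative D (Suc m) t) (at t)"
    proof (intro allI impI)
      fix m :: nat and t :: real assume "m < 3 \<and> \<bar>t\<bar> \<le> \<bar>h\<bar>"
      then consider "m = 0" | "m = 1" | "m = 2" by linarith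
      then show "(D m has_real_derivative D (Suc m) t) (at t)"
        by cases (use df'[of t] 1[of t] 2[of t] in \<open>simp_all add: D_def\<close>)
    qed
  qed
  then obtain t where t: "f (x + h) = (\<Sum>m<3. D m 0 / fact m * h ^ m) + D 3 t / fact 3 * h ^ 3" by blast
  have sum: "(\<Sum>m<3. D m 0 / fact m * h ^ m) = f x + h * (x / f x) + h\<^sup>2 / 2 * (d\<^sup>2 / f x ^ 3)"
    by (simp add: D_def eval_nat_numeral mult_ac)
  have "\<bar>D 3 t\<bar> \<le> 3 / d\<^sup>2"
  proof -
    let ?F = "f (x + t)"
    have ax: "\<bar>x + t\<bar> \<le> ?F" using abs_le_smooth_abs by (simp add: f_def)
    have dF: "d\<^sup>2 \<le> ?F\<^sup>2" by (simp add: fsq)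
    have "\<bar>D 3 t\<bar> = 3 * d\<^sup>2 * \<bar>x + t\<bar> / ?F ^ 5" using fp[of "x + t"] by (simp add: D_def abs_mult)
    also have "\<dots> \<le> 3 * d\<^sup>2 * ?F / ?F ^ 5"
      using ax fp[of "x + t"] by (intro divide_right_mono mult_left_mono) auto
    also have "\<dots> = 3 * d\<^sup>2 / (?F\<^sup>2)\<^sup>2" using fp[of "x + t"] by (simp add: field_simps eval_nat_numeral)
    also have "\<dots> \<le> 3 * d\<^sup>2 / (d\<^sup>2)\<^sup>2"
      using dF d fp[of "x + t"] by (intro divide_left_mono power_mono mult_pos_pos) (auto)
    also have "\<dots> = 3 / d\<^sup>2" using d by (simp add: power2_eq_square)
    finally show ?thesis .
  qed
  then have "\<bar>D 3 t / fact 3 * h ^ 3\<bar> \<le> 3 / d\<^sup>2 / 6 * \<bar>h\<bar> ^ 3"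
    using mult_right_mono[of "\<bar>D 3 t\<bar>" "3 / d\<^sup>2" "\<bar>h\<bar> ^ 3"] by (simp add: abs_mult power_abs fact_numeral)
  also have "\<dots> = \<bar>h\<bar> ^ 3 / (2 * d\<^sup>2)" by simp
  finally show ?thesis unfolding f_def[symmetric] using t sum by simp
qed

context centered_noise
begin

lemma integrable_smooth_abs:
  assumes "0 < d" shows "integrable D (\<lambda>t. smooth_abs d (w + a * t))"
proof (rule Bochner_Integration.integrable_bound)
  show "integrable D (\<lambda>t. \<bar>w\<bar> + \<bar>a\<bar> * \<bar>t\<bar> + d)" using int1 by simp
  have "smooth_abs d (w + a * t) \<le> \<bar>w\<bar> + \<bar>a\<bar> * \<bar>t\<bar> + d" for t
    using smooth_abs_le[OF assms, of "w + a * t"] abs_triangle_ineq[of w "a * t"] by (simp add: abs_mult)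
  then show "AE t in D. norm (smooth_abs d (w + a * t)) \<le> norm (\<bar>w\<bar> + \<bar>a\<bar> * \<bar>t\<bar> + d)"
    using assms by (auto intro: order_trans)
qed auto

text \<open>Mean zero and unit variance determine the Taylor terms of order one and two, so two laws
  with these moments give the same value up to third order. The bound 1 + m4 on the third absolute
  moment comes from \<open>abs3_le\<close>.\<close>

lemma expectation_smooth_abs:
  assumes d: "0 < d"
  shows "\<bar>(\<integral>t. smooth_abs d (w + a * t) \<partial>D) - (smooth_abs d w + a\<^sup>2 / 2 * (d\<^sup>2 / smooth_abs d w ^ 3))\<bar>
     \<le> \<bar>a\<bar> ^ 3 * (1 + m4) / (2 * d\<^sup>2)"
proof -
  define c where "c = w / smooth_abs d w"
  define b where "b = d\<^sup>2 / smooth_abs d w ^ 3"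
  let ?g = "\<lambda>t. smooth_abs d (w + a * t) - smooth_abs d w - a * c * t - a\<^sup>2 / 2 * b * t\<^sup>2"
  have g: "has_bochner_integral D ?g ((\<integral>t. smooth_abs d (w + a * t) \<partial>D) - smooth_abs d w - a * c * 0 - a\<^sup>2 / 2 * b * 1)"
    using integrable_smooth_abs[OF d] int1 int2
    by (intro has_bochner_integral_diff has_bochner_integral_mult_right mean0 var1)
       (auto simp: has_bochner_integral_iff)
  have le: "\<bar>?g t\<bar> \<le> \<bar>a\<bar> ^ 3 / (2 * d\<^sup>2) * \<bar>t\<bar> ^ 3" for t
    using smooth_abs_taylor[OF d, of w "a * t"]
    by (simp add: c_def b_def algebra_simps abs_mult power_mult_distrib)
  have "\<bar>\<integral>t. ?g t \<partial>D\<bar> \<le> (\<integral>t. \<bar>?g t\<bar> \<partial>D)" by (rule integral_abs_bound)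
  also have "\<dots> \<le> (\<integral>t. \<bar>a\<bar> ^ 3 / (2 * d\<^sup>2) * \<bar>t\<bar> ^ 3 \<partial>D)"
    by (intro integral_mono le) (use g int3 in \<open>auto simp only: has_bochner_integral_iff intro!: integrable_abs integrable_mult_right\<close>)
  also have "\<dots> = \<bar>a\<bar> ^ 3 / (2 * d\<^sup>2) * (\<integral>t. \<bar>t\<bar> ^ 3 \<partial>D)" by simp
  also have "\<dots> \<le> \<bar>a\<bar> ^ 3 / (2 * d\<^sup>2) * (1 + m4)"
    by (intro mult_left_mono int_abs3_le) auto
  finally have le2: "\<bar>\<integral>t. ?g t \<partial>D\<bar> \<le> \<bar>a\<bar> ^ 3 / (2 * d\<^sup>2) * (1 + m4)" .
  have "(\<integral>t. ?g t \<partial>D) = (\<integral>t. smooth_abs d (w + a * t) \<partial>D) - smooth_abs d w - a * c * 0 - a\<^sup>2 / 2 * b * 1"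
    using g by (simp only: has_bochner_integral_iff)
  then show ?thesis using le2 by (simp add: b_def algebra_simps)
qed

end

lemma nn_integral_std_normal_scale:
  assumes [measurable]: "g \<in> borel_measurable borel" and a: "a \<noteq> 0"
  shows "(\<integral>\<^sup>+z. g (x + a * z) \<partial>std_normal) = (\<integral>\<^sup>+y. ennreal (normal_density x \<bar>a\<bar> y) * g y \<partial>lborel)"
proof -
  interpret prob_space std_normal by (rule prob_space_normal_density) simp
  have "distributed std_normal lborel (\<lambda>z. z) (\<lambda>z. ennreal (std_normal_density z))"
    unfolding distributed_def by (auto simp: distr_id2)
  from normal_density_affine[OF this _ a, of x]
  have "distributed std_normal lborel (\<lambda>z. x + a * z) (\<lambda>z. ennreal (normal_density x \<bar>a\<bar> z))" by simp
  from distributed_nn_integral[OF this, of g] show ?thesis by simp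
qed

text \<open>Independent normal variables with variances T and a^2 add up to one with variance T +
  a^2: the semigroup law of the heat flow. The cases with a vanishing variance are split off because
  there the summand has no density.\<close>

lemma std_normal_convolution:
  assumes g [measurable]: "g \<in> borel_measurable borel" and T: "0 \<le> T"
  shows "(\<integral>\<^sup>+z. (\<integral>\<^sup>+s. g (x + sqrt T * z + a * s) \<partial>std_normal) \<partial>std_normal)
    = (\<integral>\<^sup>+z. g (x + sqrt (T + a\<^sup>2) * z) \<partial>std_normal)"
proof -
  interpret N: prob_space std_normal by (rule prob_space_normal_density) simp
  note E = N.emeasure_space_1[simplified]
  consider "T = 0" "a = 0" | "T = 0" "a \<noteq> 0" | "T > 0" "a = 0" | "T > 0" "a \<noteq> 0" using T by linarith
  then show ?thesis
  proof cases
    case 1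
    then show ?thesis by (simp add: E)
  next
    case 2
    then show ?thesis
      using nn_integral_std_normal_scale[of g a x] nn_integral_std_normal_scale[of g "\<bar>a\<bar>" x] by (simp add: E)
  next
    case 3
    then show ?thesis by (simp add: E)
  next
    case 4
    interpret NN: pair_prob_space std_normal std_normal ..
    let ?M = "std_normal \<Otimes>\<^sub>M std_normal"
    have d1: "distributed ?M lborel fst (\<lambda>z. ennreal (std_normal_density z))"
      unfolding distributed_def using N.distr_pair_fst[of std_normal]
      by (simp cong: distr_cong)
    have d2: "distributed ?M lborel snd (\<lambda>z. ennreal (std_normal_density z))"
    proof -
      have "distr ?M std_normal snd = std_normal"
      proof (rule measure_eqI)
        fix A assume "A \<in> sets (distr ?M std_normal snd)"
        then have A: "A \<in> sets std_normal" by simp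
        have eq: "snd -` A \<inter> space ?M = UNIV \<times> A" by (auto simp: space_pair_measure)
        have "emeasure ?M (UNIV \<times> A) = emeasure std_normal UNIV * emeasure std_normal A"
          using A by (intro N.emeasure_pair_measure_Times) auto
        then show "emeasure (distr ?M std_normal snd) A = emeasure std_normal A"
          using A by (subst emeasure_distr) (auto simp: eq E)
      qed simp
      then show ?thesis unfolding distributed_def by (simp cong: distr_cong)
    qed
    have ind: "NN.indep_var borel fst borel snd"
      unfolding NN.indep_var_distribution_eq
    proof (intro conjI)
      have "distr ?M borel fst = std_normal" "distr ?M borel snd = std_normal"
        using d1 d2 by (auto simp: distributed_def cong: distr_cong)
      moreover have "distr ?M (borel \<Otimes>\<^sub>M borel) (\<lambda>x. (fst x, snd x)) = ?M"
        by (simp, rule distr_id2) (simp cong: sets_pair_measure_cong)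
      ultimately show "distr ?M borel fst \<Otimes>\<^sub>M distr ?M borel snd = distr ?M (borel \<Otimes>\<^sub>M borel) (\<lambda>x. (fst x, snd x))"
        by simp
    qed auto
    have 1: "distributed ?M lborel (\<lambda>\<omega>. x + sqrt T * fst \<omega>) (\<lambda>z. ennreal (normal_density x (sqrt T) z))"
      using NN.normal_density_affine[OF d1, of "sqrt T" x] 4 by simp
    have 2: "distributed ?M lborel (\<lambda>\<omega>. 0 + a * snd \<omega>) (\<lambda>z. ennreal (normal_density 0 \<bar>a\<bar> z))"
      using NN.normal_density_affine[OF d2, of a 0] 4 by simp
    have ind2: "NN.indep_var borel (\<lambda>\<omega>. x + sqrt T * fst \<omega>) borel (\<lambda>\<omega>. 0 + a * snd \<omega>)"
      using NN.indep_var_compose[OF ind, of "\<lambda>u. x + sqrt T * u" borel "\<lambda>u. 0 + a * u" borel] by (simp add: comp_def)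
    have 3: "distributed ?M lborel (\<lambda>\<omega>. (x + sqrt T * fst \<omega>) + (0 + a * snd \<omega>))
        (\<lambda>z. ennreal (normal_density x (sqrt (T + a\<^sup>2)) z))"
      using NN.add_indep_normal[OF ind2 _ _ 1 2] 4 by simp
    have "(\<integral>\<^sup>+z. (\<integral>\<^sup>+s. g (x + sqrt T * z + a * s) \<partial>std_normal) \<partial>std_normal)
      = (\<integral>\<^sup>+\<omega>. g ((x + sqrt T * fst \<omega>) + (0 + a * snd \<omega>)) \<partial>?M)"
      by (subst N.nn_integral_fst[symmetric]) auto
    also have "\<dots> = (\<integral>\<^sup>+y. ennreal (normal_density x (sqrt (T + a\<^sup>2)) y) * g y \<partial>lborel)"
      using distributed_nn_integral[OF 3, of g] by simp
    also have "\<dots> = (\<integral>\<^sup>+z. g (x + sqrt (T + a\<^sup>2) * z) \<partial>std_normal)"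
    proof -
      have "sqrt (T + a\<^sup>2) \<noteq> 0" using 4 by (simp add: add_nonneg_eq_0_iff)
      moreover have "0 \<le> T + a\<^sup>2" using T by simp
      ultimately show ?thesis
        using nn_integral_std_normal_scale[OF g, of "sqrt (T + a\<^sup>2)" x]
        by (simp only: abs_of_nonneg[OF real_sqrt_ge_zero] not_False_eq_True)
    qed
    finally show ?thesis .
  qed
qed

text \<open>The heat semigroup, with time measured as variance, applied to
  \<open>smooth_abs d\<close>.\<close>

definition heat :: "real \<Rightarrow> real \<Rightarrow> real \<Rightarrow> real" where
  "heat d T x = (\<integral>z. smooth_abs d (x + sqrt T * z) \<partial>std_normal)"

lemma nn_heat:
  assumes "0 < d"
  shows "(\<integral>\<^sup>+z. ennreal (smooth_abs d (x + sqrt T * z)) \<partial>std_normal) = ennreal (heat d T x)"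
proof -
  interpret N: centered_noise std_normal 3 by (rule centered_noise_std_normal)
  show ?thesis unfolding heat_def
    by (rule nn_integral_eq_integral) (use N.integrable_smooth_abs[OF assms] in auto)
qed

lemma heat_measurable [measurable]: "(\<lambda>(T, x). heat d T x) \<in> borel_measurable (borel \<Otimes>\<^sub>M borel)"
proof -
  interpret N: centered_noise std_normal 3 by (rule centered_noise_std_normal)
  show ?thesis unfolding heat_def case_prod_unfold
    by (rule N.borel_measurable_lebesgue_integral) simp
qed

text \<open>Jensen's inequality: x is the mean of x + sqrt(T) Z. Through this, budget left over at
  the end of the replacement can be discarded.\<close>

lemma abs_le_heat:
  assumes "0 < d" shows "\<bar>x\<bar> \<le> heat d T x"
proof -
  interpret N: centered_noise std_normal 3 by (rule centered_noise_std_normal)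
  have "(\<integral>z. x + sqrt T * z \<partial>std_normal) = x" using N.int1 by simp
  then have "\<bar>x\<bar> \<le> (\<integral>z. \<bar>x + sqrt T * z\<bar> \<partial>std_normal)"
    using integral_abs_bound[of std_normal "\<lambda>z. x + sqrt T * z"] by simp
  also have "\<dots> \<le> heat d T x" unfolding heat_def
    by (intro integral_mono N.integrable_smooth_abs[OF assms] abs_le_smooth_abs) (use N.int1 in auto)
  finally show ?thesis .
qed

lemma heat_zero_le:
  assumes "0 < d" "0 \<le> T"
  shows "heat d T 0 \<le> sqrt T * (\<integral>z. \<bar>z\<bar> \<partial>std_normal) + d"
proof -
  interpret N: centered_noise std_normal 3 by (rule centered_noise_std_normal)
  have "heat d T 0 \<le> (\<integral>z. sqrt T * \<bar>z\<bar> + d \<partial>std_normal)" unfolding heat_def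
  proof (intro integral_mono N.integrable_smooth_abs[OF assms(1)])
    show "integrable std_normal (\<lambda>z. sqrt T * \<bar>z\<bar> + d)" using N.int1 by simp
    show "smooth_abs d (0 + sqrt T * z) \<le> sqrt T * \<bar>z\<bar> + d" for z
      using smooth_abs_le[OF assms(1), of "sqrt T * z"] assms by (simp add: abs_mult)
  qed
  also have "\<dots> = sqrt T * (\<integral>z. \<bar>z\<bar> \<partial>std_normal) + d" using N.int1 by simp
  finally show ?thesis .
qed

lemma heat_nonneg: "0 < d \<Longrightarrow> 0 \<le> heat d T x"
  using abs_le_heat[of d x T] by linarith

text \<open>Fubini moves the noise step inside the Gaussian average, where it is exchanged for a
  Gaussian step of the same variance at a third-order cost; the convolution law then merges the two
  Gaussian steps. The constant is (1 + m4) + (1 + 3), where 3 is the fourth moment of the standard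
  normal law.\<close>

lemma (in centered_noise) heat_step:
  assumes d: "0 < d" and T: "0 \<le> T"
  shows "(\<integral>\<^sup>+t. ennreal (heat d T (x + a * t)) \<partial>D)
    \<le> ennreal (heat d (T + a\<^sup>2) x + (5 + m4) / (2 * d\<^sup>2) * \<bar>a\<bar> ^ 3)"
proof -
  interpret N: centered_noise std_normal 3 by (rule centered_noise_std_normal)
  interpret pair_sigma_finite D std_normal ..
  let ?C = "(5 + m4) / (2 * d\<^sup>2) * \<bar>a\<bar> ^ 3"
  have C: "0 \<le> ?C" using one_le_m4 by simp
  have "(\<integral>\<^sup>+t. ennreal (heat d T (x + a * t)) \<partial>D)
     = (\<integral>\<^sup>+t. (\<integral>\<^sup>+z. ennreal (smooth_abs d ((x + a * t) + sqrt T * z)) \<partial>std_normal) \<partial>D)"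
    by (simp add: nn_heat[OF d])
  also have "\<dots> = (\<integral>\<^sup>+z. (\<integral>\<^sup>+t. ennreal (smooth_abs d ((x + a * t) + sqrt T * z)) \<partial>D) \<partial>std_normal)"
    by (rule Fubini'[symmetric]) simp
  also have "\<dots> \<le> (\<integral>\<^sup>+z. (\<integral>\<^sup>+s. ennreal (smooth_abs d (x + sqrt T * z + a * s)) \<partial>std_normal) + ennreal ?C \<partial>std_normal)"
  proof (rule nn_integral_mono)
    fix z :: real
    let ?w = "x + sqrt T * z"
    have "(\<integral>\<^sup>+t. ennreal (smooth_abs d ((x + a * t) + sqrt T * z)) \<partial>D) = (\<integral>\<^sup>+t. ennreal (smooth_abs d (?w + a * t)) \<partial>D)"
      by (simp add: algebra_simps)
    also have "\<dots> = ennreal (\<integral>t. smooth_abs d (?w + a * t) \<partial>D)"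
      by (rule nn_integral_eq_integral) (use integrable_smooth_abs[OF d] in auto)
    also have "\<dots> \<le> ennreal ((\<integral>s. smooth_abs d (?w + a * s) \<partial>std_normal) + ?C)"
    proof (rule ennreal_leI)
      have eq: "?C = \<bar>a\<bar> ^ 3 * (1 + m4) / (2 * d\<^sup>2) + \<bar>a\<bar> ^ 3 * (1 + 3) / (2 * d\<^sup>2)"
      proof -
        have "?C = (\<bar>a\<bar> ^ 3 * (1 + m4) + \<bar>a\<bar> ^ 3 * (1 + 3)) / (2 * d\<^sup>2)" by (simp add: algebra_simps)
        then show ?thesis by (simp only: add_divide_distrib)
      qed
      show "(\<integral>t. smooth_abs d (?w + a * t) \<partial>D) \<le> (\<integral>s. smooth_abs d (?w + a * s) \<partial>std_normal) + ?C"
        unfolding eq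
        using expectation_smooth_abs[OF d, of ?w a] N.expectation_smooth_abs[OF d, of ?w a] by linarith
    qed
    also have "\<dots> = ennreal (\<integral>s. smooth_abs d (?w + a * s) \<partial>std_normal) + ennreal ?C"
      using C by (intro ennreal_plus) auto
    also have "ennreal (\<integral>s. smooth_abs d (?w + a * s) \<partial>std_normal) = (\<integral>\<^sup>+s. ennreal (smooth_abs d (?w + a * s)) \<partial>std_normal)"
      by (rule nn_integral_eq_integral[symmetric]) (use N.integrable_smooth_abs[OF d] in auto)
    finally show "(\<integral>\<^sup>+t. ennreal (smooth_abs d ((x + a * t) + sqrt T * z)) \<partial>D)
      \<le> (\<integral>\<^sup>+s. ennreal (smooth_abs d (?w + a * s)) \<partial>std_normal) + ennreal ?C" .
  qed
  also have "\<dots> = (\<integral>\<^sup>+z. (\<integral>\<^sup>+s. ennreal (smooth_abs d (x + sqrt T * z + a * s)) \<partial>std_normal) \<partial>std_normal) + ennreal ?C"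
    using N.emeasure_space_1 by (subst nn_integral_add) auto
  also have "(\<integral>\<^sup>+z. (\<integral>\<^sup>+s. ennreal (smooth_abs d (x + sqrt T * z + a * s)) \<partial>std_normal) \<partial>std_normal)
     = ennreal (heat d (T + a\<^sup>2) x)"
    by (subst std_normal_convolution[OF _ T]) (auto simp: nn_heat[OF d])
  also have "ennreal (heat d (T + a\<^sup>2) x) + ennreal ?C = ennreal (heat d (T + a\<^sup>2) x + ?C)"
    using C heat_nonneg[OF d] by (intro ennreal_plus[symmetric]) auto
  finally show ?thesis .
qed

context noise_sequence
begin

text \<open>The replacement is run on the heat semigroup evaluated at the remaining budget
  \<open>r - V\<close>: a step of weight \<open>a\<close> uses up the time \<open>a\<^sup>2\<close>, so the second-order terms
  cancel, and unused budget only helps because \<open>\<bar>x\<bar> \<le> heat d T x\<close>.\<close>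

lemma EB_martingale_abs:
  assumes d: "0 < d" and m: "m0 \<le> n"
    and a [measurable]: "\<And>k. k \<in> {m0+1..n} \<Longrightarrow> a k \<in> borel_measurable P"
    and ap: "\<And>k. k \<in> {m0+1..n} \<Longrightarrow> past k (a k)"
    and r [measurable]: "r \<in> borel_measurable P" and rp: "past (m0 + 1) r"
    and le: "\<And>\<omega>. (\<Sum>k=m0+1..n. (a k \<omega>)\<^sup>2) \<le> r \<omega>"
    and c0: "EB (\<lambda>\<omega>. heat d (r \<omega>) 0) c0"
    and b: "\<And>k. k \<in> {m0+1..n} \<Longrightarrow> EB (\<lambda>\<omega>. \<bar>a k \<omega>\<bar> ^ 3) (b k)"
  shows "EB (\<lambda>\<omega>. \<bar>\<Sum>k=m0+1..n. a k \<omega> * \<omega> k\<bar>) (c0 + (5 + m4) / (2 * d\<^sup>2) * (\<Sum>k=m0+1..n. b k))"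
proof -
  let ?C = "(5 + m4) / (2 * d\<^sup>2)"
  have C: "0 \<le> ?C" using one_le_m4 by simp
  define V where "V = (\<lambda>m \<omega>. \<Sum>k=m0+1..m. (a k \<omega>)\<^sup>2)"
  define X where "X = (\<lambda>m \<omega>. \<Sum>k=m0+1..m. a k \<omega> * \<omega> k)"
  have Vm: "V m \<in> borel_measurable P" if "m \<le> n" for m
    unfolding V_def using that by (intro borel_measurable_sum borel_measurable_power a) auto
  have Xm: "X m \<in> borel_measurable P" if "m \<le> n" for m
    unfolding X_def using that by (intro borel_measurable_sum borel_measurable_times a measurable_coord) auto
  have hm: "(\<lambda>\<omega>. heat d (r \<omega> - V m \<omega>) (X m \<omega>)) \<in> borel_measurable P" if "m \<le> n" for m
  proof -
    have "(\<lambda>\<omega>. (r \<omega> - V m \<omega>, X m \<omega>)) \<in> measurable P (borel \<Otimes>\<^sub>M borel)"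
      using Vm[OF that] Xm[OF that] r by simp
    from measurable_compose[OF this heat_measurable[of d]] show ?thesis by simp
  qed
  have main: "EB (\<lambda>\<omega>. heat d (r \<omega> - V m \<omega>) (X m \<omega>)) (c0 + ?C * (\<Sum>k=m0+1..m. b k))" if "m0 \<le> m" "m \<le> n" for m
    using that
  proof (induction m rule: dec_induct)
    case base
    then show ?case using c0 by (simp add: V_def X_def)
  next
    case (step m)
    let ?k = "Suc m"
    have k: "?k \<in> {m0+1..n}" using step by auto
    have Vk: "V ?k \<omega> = V m \<omega> + (a ?k \<omega>)\<^sup>2" for \<omega> using step by (simp add: V_def)
    have Xk: "X ?k \<omega> = X m \<omega> + a ?k \<omega> * \<omega> ?k" for \<omega> using step by (simp add: X_def)
    \<comment> \<open>The budget left after this step is nonnegative, as the time argument of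
      \<open>heat_step\<close> requires.\<close>
    have Vle: "V ?k \<omega> \<le> r \<omega>" for \<omega>
    proof -
      have "V ?k \<omega> \<le> (\<Sum>k=m0+1..n. (a k \<omega>)\<^sup>2)" unfolding V_def
        using step by (intro sum_mono2) auto
      then show ?thesis using le[of \<omega>] by simp
    qed
    have inv_a: "a j (fun_upd \<omega> ?k t) = a j \<omega>" if "j \<in> {m0+1..?k}" for j \<omega> t
      using that step by (intro pastD[OF ap]) auto
    have inv_r: "r (fun_upd \<omega> ?k t) = r \<omega>" for \<omega> t
      using step by (intro pastD[OF rp]) auto
    have inv_V: "V ?k (fun_upd \<omega> ?k t) = V ?k \<omega>" for \<omega> t
      unfolding V_def by (intro sum.cong refl) (simp add: inv_a)
    have inv_X: "X m (fun_upd \<omega> ?k t) = X m \<omega>" for \<omega> t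
      unfolding X_def by (intro sum.cong refl) (simp add: inv_a)
    have IH: "EB (\<lambda>\<omega>. heat d (r \<omega> - V m \<omega>) (X m \<omega>)) (c0 + ?C * (\<Sum>k=m0+1..m. b k))"
      using step by simp
    have "EB (\<lambda>\<omega>. heat d (r \<omega> - V m \<omega>) (X m \<omega>) + ?C * \<bar>a ?k \<omega>\<bar> ^ 3) (c0 + ?C * (\<Sum>k=m0+1..m. b k) + ?C * b ?k)"
      by (intro EB_add EB_cmult IH b k C)
    \<comment> \<open>Budget, weights and the earlier sum all ignore coordinate \<open>?k\<close>,
      so resampling it moves only the last increment, and \<open>heat_step\<close> applies for each
      fixed \<omega>.\<close>
    then have "EB (\<lambda>\<omega>. heat d (r \<omega> - V ?k \<omega>) (X ?k \<omega>)) (c0 + ?C * (\<Sum>k=m0+1..m. b k) + ?C * b ?k)"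
    proof (rule EB_resample[rotated 2])
      show "?k \<in> {1..n}" using k by auto
      show "(\<lambda>\<omega>. heat d (r \<omega> - V ?k \<omega>) (X ?k \<omega>)) \<in> borel_measurable P" using k by (intro hm) auto
      fix \<omega>
      have "(\<integral>\<^sup>+t. ennreal (heat d (r (fun_upd \<omega> ?k t) - V ?k (fun_upd \<omega> ?k t)) (X ?k (fun_upd \<omega> ?k t))) \<partial>D)
        = (\<integral>\<^sup>+t. ennreal (heat d (r \<omega> - V ?k \<omega>) (X m \<omega> + a ?k \<omega> * t)) \<partial>D)"
        using k by (simp only: inv_r inv_V) (simp add: Xk inv_X inv_a)
      also have "\<dots> \<le> ennreal (heat d (r \<omega> - V ?k \<omega> + (a ?k \<omega>)\<^sup>2) (X m \<omega>) + ?C * \<bar>a ?k \<omega>\<bar> ^ 3)"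
        using Vle[of \<omega>] by (intro heat_step[OF d]) simp
      finally show "(\<integral>\<^sup>+t. ennreal (heat d (r (fun_upd \<omega> ?k t) - V ?k (fun_upd \<omega> ?k t)) (X ?k (fun_upd \<omega> ?k t))) \<partial>D)
         \<le> ennreal (heat d (r \<omega> - V m \<omega>) (X m \<omega>) + ?C * \<bar>a ?k \<omega>\<bar> ^ 3)"
        by (simp add: Vk)
    qed
    then show ?case using step by (simp add: distrib_left add.assoc)
  qed
  have "(\<lambda>\<omega>. \<bar>X n \<omega>\<bar>) \<in> borel_measurable P" using Xm[of n] by simp
  from EB_mono[OF main[OF m order_refl] this abs_le_heat[OF d] order_refl]
  show ?thesis by (simp add: X_def)
qed

end

section \<open>Moments of the autoregression\<close>

text \<open>The argument is dominated by the convex combination of |y| and |t| / \<epsilon> with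
  weights 1 - \<epsilon> and \<epsilon>. Convexity of the square, used twice, gives the contraction
  factor 1 - \<epsilon>.\<close>

lemma power4_convex:
  fixes s y t \<epsilon> :: real
  assumes "0 < \<epsilon>" "\<epsilon> < 1" "\<bar>s\<bar> \<le> 1 - \<epsilon>"
  shows "(s * y + t) ^ 4 \<le> (1 - \<epsilon>) * y ^ 4 + t ^ 4 / \<epsilon> ^ 3"
proof -
  have sq: "((1 - \<epsilon>) * u + \<epsilon> * v)\<^sup>2 \<le> (1 - \<epsilon>) * u\<^sup>2 + \<epsilon> * v\<^sup>2" for u v :: real
  proof -
    have "(1 - \<epsilon>) * u\<^sup>2 + \<epsilon> * v\<^sup>2 - ((1 - \<epsilon>) * u + \<epsilon> * v)\<^sup>2 = \<epsilon> * (1 - \<epsilon>) * (u - v)\<^sup>2"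
      by (simp add: power2_eq_square algebra_simps)
    moreover have "0 \<le> \<epsilon> * (1 - \<epsilon>) * (u - v)\<^sup>2" using assms by simp
    ultimately show ?thesis by linarith
  qed
  let ?u = "\<bar>y\<bar>" and ?v = "\<bar>t\<bar> / \<epsilon>"
  have "\<bar>s * y + t\<bar> \<le> \<bar>s\<bar> * \<bar>y\<bar> + \<bar>t\<bar>" by (metis abs_mult abs_triangle_ineq)
  also have "\<dots> \<le> (1 - \<epsilon>) * ?u + \<epsilon> * ?v" using assms by (simp add: mult_right_mono)
  finally have "\<bar>s * y + t\<bar> ^ 4 \<le> ((1 - \<epsilon>) * ?u + \<epsilon> * ?v) ^ 4" by (intro power_mono) auto
  also have "\<dots> = (((1 - \<epsilon>) * ?u + \<epsilon> * ?v)\<^sup>2)\<^sup>2" by simp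
  also have "\<dots> \<le> ((1 - \<epsilon>) * ?u\<^sup>2 + \<epsilon> * ?v\<^sup>2)\<^sup>2" by (intro power_mono sq) auto
  also have "\<dots> \<le> (1 - \<epsilon>) * (?u\<^sup>2)\<^sup>2 + \<epsilon> * (?v\<^sup>2)\<^sup>2" by (rule sq)
  also have "\<dots> = (1 - \<epsilon>) * y ^ 4 + t ^ 4 / \<epsilon> ^ 3"
    using assms by (simp add: power_divide power_abs eval_nat_numeral field_simps)
  finally show ?thesis by simp
qed

lemma sq_le_one_plus_pow4: "(y::real)\<^sup>2 \<le> 1 + y ^ 4"
proof -
  have "0 \<le> (y\<^sup>2 - 1/2)\<^sup>2" by simp
  then show ?thesis by (simp add: power2_eq_square power4_eq_xxxx algebra_simps)
qed

locale ar_noise = noise_sequence +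
  fixes y0 :: real and S :: "real \<Rightarrow> real" and \<epsilon> :: real
  assumes eps: "0 < \<epsilon>" "\<epsilon> < 1"
    and S_le: "\<And>j. j \<in> {1..n} \<Longrightarrow> \<bar>S (real j / real n)\<bar> \<le> 1 - \<epsilon>"
begin

definition s :: "nat \<Rightarrow> real" where "s j = S (real j / real n)"

text \<open>The restriction makes \<open>y\<close> the very map whose image measure is
  \<open>obs_law\<close>; the recursion is therefore available only up to index
  \<open>n\<close>.\<close>

definition y :: "(nat \<Rightarrow> real) \<Rightarrow> nat \<Rightarrow> real" where
  "y \<omega> = restrict (ar_path n y0 S \<omega>) {0..n}"

lemma y_0 [simp]: "y \<omega> 0 = y0"
  by (simp add: y_def)

lemma y_Suc: "j < n \<Longrightarrow> y \<omega> (Suc j) = s (Suc j) * y \<omega> j + \<omega> (Suc j)"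
  by (simp add: y_def s_def)

lemma y_rec: "j \<in> {1..n} \<Longrightarrow> y \<omega> j = s j * y \<omega> (j - 1) + \<omega> j"
  using y_Suc[of "j - 1" \<omega>] by auto

lemma past_y: "j < k \<Longrightarrow> past k (\<lambda>\<omega>. y \<omega> j)"
proof -
  have "past k (\<lambda>\<omega>. ar_path n y0 S \<omega> j)" if "j < k" for j
    using that by (induction j) (auto simp: past_def)
  then show ?thesis if "j < k"
    using that by (auto simp: past_def y_def restrict_def)
qed

lemma y_upd [simp]: "j < k \<Longrightarrow> y (fun_upd \<omega> k t) j = y \<omega> j"
  by (rule pastD[OF past_y]) auto

lemma y_measurable [measurable]: "(\<lambda>\<omega>. y \<omega> j) \<in> borel_measurable P"
proof (cases "j \<le> n")
  case True
  then show ?thesis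
  proof (induction j)
    case (Suc j)
    then have "(\<lambda>\<omega>. y \<omega> j) \<in> borel_measurable P" "(\<lambda>\<omega>. \<omega> (Suc j)) \<in> borel_measurable P"
      by (auto intro: measurable_coord)
    moreover have "(\<lambda>\<omega>. y \<omega> (Suc j)) = (\<lambda>\<omega>. s (Suc j) * y \<omega> j + \<omega> (Suc j))"
      using Suc by (auto simp: y_Suc)
    ultimately show ?case by simp
  qed simp
qed (simp add: y_def)

text \<open>The summand 1 lets the same constant bound the second and third absolute moments, by t^2
  \<le> 1 + t^4 and |t|^3 \<le> 1 + t^4.\<close>

definition C4 :: real where "C4 = 1 + y0 ^ 4 + m4 / \<epsilon> ^ 4"

lemma C4_ge1: "1 \<le> C4"
  using one_le_m4 eps by (simp add: C4_def)

text \<open>m4 / \<epsilon>^4 is the fixed point of the moment recursion x -> (1 - \<epsilon>) x +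
  m4 / \<epsilon>^3 given by \<open>power4_convex\<close>, and the initial contribution only
  shrinks.\<close>

lemma EB_y4': "j \<le> n \<Longrightarrow> EB (\<lambda>\<omega>. (y \<omega> j) ^ 4) (y0 ^ 4 + m4 / \<epsilon> ^ 4)"
proof (induction j)
  case 0
  have "EB (\<lambda>\<omega>. y0 ^ 4) (y0 ^ 4)" by (rule EB_const) simp
  then have "EB (\<lambda>\<omega>. (y \<omega> 0) ^ 4) (y0 ^ 4)" by simp
  then show ?case by (rule EB_mono) (use one_le_m4 eps in auto)
next
  case (Suc j)
  have c: "0 \<le> m4 / \<epsilon> ^ 3" using one_le_m4 eps by simp
  have "EB (\<lambda>\<omega>. (1 - \<epsilon>) * (y \<omega> j) ^ 4 + m4 / \<epsilon> ^ 3) ((1 - \<epsilon>) * (y0 ^ 4 + m4 / \<epsilon> ^ 4) + m4 / \<epsilon> ^ 3)"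
    using Suc eps by (intro EB_add EB_cmult EB_const c) auto
  then have "EB (\<lambda>\<omega>. (y \<omega> (Suc j)) ^ 4) ((1 - \<epsilon>) * (y0 ^ 4 + m4 / \<epsilon> ^ 4) + m4 / \<epsilon> ^ 3)"
  proof (rule EB_resample[rotated 2])
    show "Suc j \<in> {1..n}" using Suc by auto
    fix \<omega>
    have "(\<integral>\<^sup>+t. ennreal ((y (fun_upd \<omega> (Suc j) t) (Suc j)) ^ 4) \<partial>D) = (\<integral>\<^sup>+t. ennreal ((s (Suc j) * y \<omega> j + t) ^ 4) \<partial>D)"
      using Suc by (simp add: y_Suc)
    also have "\<dots> \<le> (\<integral>\<^sup>+t. ennreal ((1 - \<epsilon>) * (y \<omega> j) ^ 4 + t ^ 4 / \<epsilon> ^ 3) \<partial>D)"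
      using eps S_le[of "Suc j"] Suc by (intro nn_integral_mono ennreal_leI power4_convex) (auto simp: s_def)
    also have "\<dots> = ennreal (\<integral>t. (1 - \<epsilon>) * (y \<omega> j) ^ 4 + t ^ 4 / \<epsilon> ^ 3 \<partial>D)"
      using eps int4 by (intro nn_integral_eq_integral) auto
    also have "(\<integral>t. (1 - \<epsilon>) * (y \<omega> j) ^ 4 + t ^ 4 / \<epsilon> ^ 3 \<partial>D) = (1 - \<epsilon>) * (y \<omega> j) ^ 4 + (\<integral>t. t ^ 4 \<partial>D) / \<epsilon> ^ 3"
      using int4 by simp
    also have "ennreal \<dots> \<le> ennreal ((1 - \<epsilon>) * (y \<omega> j) ^ 4 + m4 / \<epsilon> ^ 3)"
      using le_m4 eps by (intro ennreal_leI add_mono divide_right_mono) auto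
    finally show "(\<integral>\<^sup>+t. ennreal ((y (fun_upd \<omega> (Suc j) t) (Suc j)) ^ 4) \<partial>D) \<le> ennreal ((1 - \<epsilon>) * (y \<omega> j) ^ 4 + m4 / \<epsilon> ^ 3)" .
  qed simp
  then show ?case
  proof (rule EB_mono)
    have "(1 - \<epsilon>) * (y0 ^ 4 + m4 / \<epsilon> ^ 4) + m4 / \<epsilon> ^ 3 = (1 - \<epsilon>) * y0 ^ 4 + m4 / \<epsilon> ^ 4"
      using eps by (simp add: field_simps eval_nat_numeral)
    also have "\<dots> \<le> y0 ^ 4 + m4 / \<epsilon> ^ 4" using eps by (simp add: mult_left_le_one_le)
    finally show "(1 - \<epsilon>) * (y0 ^ 4 + m4 / \<epsilon> ^ 4) + m4 / \<epsilon> ^ 3 \<le> y0 ^ 4 + m4 / \<epsilon> ^ 4" .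
  qed auto
qed

lemma EB_y4: "j \<le> n \<Longrightarrow> EB (\<lambda>\<omega>. (y \<omega> j) ^ 4) C4"
  by (rule EB_mono[OF EB_y4']) (auto simp: C4_def)

lemma EB_one_plus_y4: "j \<le> n \<Longrightarrow> EB (\<lambda>\<omega>. 1 + (y \<omega> j) ^ 4) C4"
  using EB_add[OF EB_const[of 1] EB_y4'[of j]] by (simp add: C4_def add.assoc)

lemma EB_y2: "j \<le> n \<Longrightarrow> EB (\<lambda>\<omega>. (y \<omega> j)\<^sup>2) C4"
  by (rule EB_mono[OF EB_one_plus_y4]) (auto simp: sq_le_one_plus_pow4)

lemma EB_y3: "j \<le> n \<Longrightarrow> EB (\<lambda>\<omega>. \<bar>y \<omega> j\<bar> ^ 3) C4"
  by (rule EB_mono[OF EB_one_plus_y4]) (auto simp: abs3_le)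

text \<open>The deviation of y_j^2 from its conditional mean given the past.\<close>

definition mdiff :: "(nat \<Rightarrow> real) \<Rightarrow> nat \<Rightarrow> real" where
  "mdiff \<omega> j = 2 * s j * y \<omega> (j - 1) * \<omega> j + (\<omega> j)\<^sup>2 - 1"

lemma y_square_rec:
  "j \<in> {1..n} \<Longrightarrow> (y \<omega> j)\<^sup>2 = (s j)\<^sup>2 * (y \<omega> (j - 1))\<^sup>2 + 1 + mdiff \<omega> j"
  using y_rec[of j \<omega>] by (simp add: mdiff_def power2_eq_square algebra_simps)

lemma mdiff_measurable: "j \<in> {1..n} \<Longrightarrow> (\<lambda>\<omega>. mdiff \<omega> j) \<in> borel_measurable P"
  unfolding mdiff_def using measurable_coord[of j] by measurable

text \<open>Martingale increments are orthogonal, so their second moments add up; the increment at j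
  has conditional second moment at most W^2 (8 y_(j-1)^2 + 2 m4). Deterministic weights let one
  statement cover the plain sums and the sum weighted by s_j - S(z0).\<close>

lemma EB_quadratic_martingale:
  assumes a: "1 \<le> a" "b \<le> n" and W: "\<And>j. j \<in> {a..b} \<Longrightarrow> \<bar>w j\<bar> \<le> W"
  shows "EB (\<lambda>\<omega>. (\<Sum>j=a..b. w j * mdiff \<omega> j)\<^sup>2) (real (b + 1 - a) * (W\<^sup>2 * (8 * C4 + 2 * m4)))"
proof (cases "a \<le> b + 1")
  case False
  then show ?thesis using EB_const[of 0] by simp
next
  case True
  let ?K = "W\<^sup>2 * (8 * C4 + 2 * m4)"
  define X where "X = (\<lambda>m \<omega>. \<Sum>j=a..<m. w j * mdiff \<omega> j)"
  have Xm: "X m \<in> borel_measurable P" if "m \<le> b + 1" for m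
    unfolding X_def using that a by (intro borel_measurable_sum borel_measurable_times mdiff_measurable) auto
  have "EB (\<lambda>\<omega>. (X m \<omega>)\<^sup>2) (real (m - a) * ?K)" if "a \<le> m" "m \<le> b + 1" for m
    using that
  proof (induction m rule: dec_induct)
    case base
    then show ?case using EB_const[of 0] by (simp add: X_def)
  next
    case (step m)
    have m: "m \<in> {1..n}" "m \<in> {a..b}" using step a by auto
    have ss: "(s m)\<^sup>2 \<le> 1"
      using S_le[OF m(1)] eps by (simp add: s_def abs_square_le_1)
    have ww: "(w m)\<^sup>2 \<le> W\<^sup>2" using W[OF m(2)] by (meson abs_ge_zero abs_le_square_iff order_trans abs_ge_self)
    have K1: "EB (\<lambda>\<omega>. (X m \<omega>)\<^sup>2 + W\<^sup>2 * (8 * (y \<omega> (m - 1))\<^sup>2 + 2 * m4)) (real (m - a) * ?K + ?K)"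
      using step m one_le_m4 by (intro EB_add EB_cmult EB_const EB_y2) auto
    have inv: "X m (fun_upd \<omega> m t) = X m \<omega>" for \<omega> t
    proof -
      have "j - 1 < m \<and> j \<noteq> m" if "j \<in> {a..<m}" for j using that a by auto
      then show ?thesis unfolding X_def by (intro sum.cong refl) (simp add: mdiff_def del: One_nat_def)
    qed
    from K1 have "EB (\<lambda>\<omega>. (X (Suc m) \<omega>)\<^sup>2) (real (m - a) * ?K + ?K)"
    proof (rule EB_resample[OF m(1), rotated 1])
      show "(\<lambda>\<omega>. (X (Suc m) \<omega>)\<^sup>2) \<in> borel_measurable P" using Xm[of "Suc m"] step by simp
      fix \<omega>
      let ?c = "2 * s m * y \<omega> (m - 1)"
      define g where "g = (\<lambda>t. w m * (?c * t + (t\<^sup>2 - 1)))"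
      have g0: "has_bochner_integral D g 0"
        unfolding g_def using int1 int2 by (auto simp: has_bochner_integral_iff)
      have eq: "(g t)\<^sup>2 = (w m)\<^sup>2 * (?c\<^sup>2 * t\<^sup>2 + 2 * ?c * t ^ 3 - 2 * ?c * t + t ^ 4 - 2 * t\<^sup>2 + 1)" for t
        unfolding g_def by algebra
      have g2: "integrable D (\<lambda>t. (g t)\<^sup>2)"
        unfolding eq using int1 int2 int3 int4 by auto
      have gle: "(g t)\<^sup>2 \<le> (w m)\<^sup>2 * (2 * ?c\<^sup>2 * t\<^sup>2 + 2 * (t ^ 4 - 2 * t\<^sup>2 + 1))" for t
      proof -
        have "(?c * t + (t\<^sup>2 - 1))\<^sup>2 \<le> 2 * (?c * t)\<^sup>2 + 2 * (t\<^sup>2 - 1)\<^sup>2"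
        proof -
          have "0 \<le> (?c * t - (t\<^sup>2 - 1))\<^sup>2" by simp
          then show ?thesis by (simp add: power2_eq_square algebra_simps)
        qed
        also have "\<dots> = 2 * ?c\<^sup>2 * t\<^sup>2 + 2 * (t ^ 4 - 2 * t\<^sup>2 + 1)" by algebra
        finally show ?thesis unfolding g_def power_mult_distrib by (rule mult_left_mono) simp
      qed
      have "(\<integral>t. (g t)\<^sup>2 \<partial>D) \<le> (\<integral>t. (w m)\<^sup>2 * (2 * ?c\<^sup>2 * t\<^sup>2 + 2 * (t ^ 4 - 2 * t\<^sup>2 + 1)) \<partial>D)"
        by (intro integral_mono gle g2) (use int2 int4 in auto)
      also have "\<dots> = (w m)\<^sup>2 * (2 * ?c\<^sup>2 + 2 * ((\<integral>t. t ^ 4 \<partial>D) - 1))"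
        using int2 int4 by simp
      also have "\<dots> \<le> W\<^sup>2 * (8 * (y \<omega> (m - 1))\<^sup>2 + 2 * m4)"
      proof (rule mult_mono[OF ww])
        have "?c\<^sup>2 = (s m)\<^sup>2 * (4 * (y \<omega> (m - 1))\<^sup>2)" by (simp add: power_mult_distrib)
        also have "\<dots> \<le> 1 * (4 * (y \<omega> (m - 1))\<^sup>2)" by (intro mult_right_mono ss) simp
        finally show "2 * ?c\<^sup>2 + 2 * ((\<integral>t. t ^ 4 \<partial>D) - 1) \<le> 8 * (y \<omega> (m - 1))\<^sup>2 + 2 * m4"
          using le_m4 by simp
        \<comment> \<open>\<open>one_le_m4\<close> bounds the parameter of the locale; interpreting
          the locale with the exact fourth moment as parameter turns it into a bound on that moment
          itself.\<close>
        have "1 \<le> (\<integral>t. t ^ 4 \<partial>D)"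
        proof -
          interpret T: centered_noise D "\<integral>t. t ^ 4 \<partial>D"
            by unfold_locales (use mean0 var1 int4 in auto)
          show ?thesis by (rule T.one_le_m4)
        qed
        then show "0 \<le> 2 * ?c\<^sup>2 + 2 * ((\<integral>t. t ^ 4 \<partial>D) - 1)" by simp
      qed simp
      finally have gv: "(\<integral>t. (g t)\<^sup>2 \<partial>D) \<le> W\<^sup>2 * (8 * (y \<omega> (m - 1))\<^sup>2 + 2 * m4)" .
      have "X (Suc m) (fun_upd \<omega> m t) = X m \<omega> + g t" for t
      proof -
        have "X (Suc m) (fun_upd \<omega> m t) = X m (fun_upd \<omega> m t) + w m * mdiff (fun_upd \<omega> m t) m"
          using step by (simp add: X_def)
        then show ?thesis using m by (simp add: inv mdiff_def g_def)
      qed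
      then show "(\<integral>\<^sup>+t. ennreal ((X (Suc m) (fun_upd \<omega> m t))\<^sup>2) \<partial>D)
         \<le> ennreal ((X m \<omega>)\<^sup>2 + W\<^sup>2 * (8 * (y \<omega> (m - 1))\<^sup>2 + 2 * m4))"
        using nn_int_square_shift[OF g0 g2 gv, of "X m \<omega>"] by simp
    qed
    moreover have "real (m - a) * ?K + ?K = real (Suc m - a) * ?K"
      using step by (simp add: Suc_diff_le distrib_right)
    ultimately show ?case by simp
  qed
  from this[of "b + 1"] True show ?thesis
    by (simp add: X_def atLeastLessThanSuc_atLeastAtMost)
qed

text \<open>The cross term \<open>6 X\<^sup>2 y\<^sup>2\<close> is split as \<open>X\<^sup>4 / N + N y\<^sup>4\<close>, so the recursion grows by a
  factor \<open>1 + 8 / N\<close> per step, hence boundedly over \<open>N\<close> steps.\<close>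

lemma EB_linear_martingale:
  assumes a: "1 \<le> a" "a \<le> b" "b \<le> n"
  defines "N \<equiv> real (b + 1 - a)"
  shows "EB (\<lambda>\<omega>. (\<Sum>j=a..b. y \<omega> (j - 1) * \<omega> j) ^ 4) (exp 8 * (16 * m4 * C4) * N\<^sup>2)"
proof -
  have N: "1 \<le> N" using a by (simp add: N_def)
  let ?q = "8 / N" and ?B = "16 * m4 * C4 * N"
  have B: "0 \<le> ?B" using N one_le_m4 C4_ge1 by simp
  define X where "X = (\<lambda>m \<omega>. \<Sum>j=a..<m. y \<omega> (j - 1) * \<omega> j)"
  have Xm: "X m \<in> borel_measurable P" if "m \<le> b + 1" for m
    unfolding X_def using that a by (intro borel_measurable_sum borel_measurable_times measurable_coord) auto
  \<comment> \<open>The exact solution of x -> (1 + q) x + B started at 0. With q = 8 / N, the power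
    after N steps is at most exp 8.\<close>
  have "EB (\<lambda>\<omega>. (X m \<omega>) ^ 4) (?B / ?q * ((1 + ?q) ^ (m - a) - 1))" if "a \<le> m" "m \<le> b + 1" for m
    using that
  proof (induction m rule: dec_induct)
    case base
    then show ?case using EB_const[of 0] by (simp add: X_def)
  next
    case (step m)
    have m: "m \<in> {1..n}" using step a by auto
    let ?c = "?B / ?q * ((1 + ?q) ^ (m - a) - 1)"
    have K1: "EB (\<lambda>\<omega>. (1 + ?q) * (X m \<omega>) ^ 4 + 16 * m4 * N * (y \<omega> (m - 1)) ^ 4) ((1 + ?q) * ?c + 16 * m4 * N * C4)"
      using step m N one_le_m4 by (intro EB_add EB_cmult EB_const EB_y4) auto
    have inv: "X m (fun_upd \<omega> m t) = X m \<omega>" for \<omega> t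
    proof -
      have "j - 1 < m \<and> j \<noteq> m" if "j \<in> {a..<m}" for j using that a by auto
      then show ?thesis unfolding X_def by (intro sum.cong refl) (simp del: One_nat_def)
    qed
    from K1 have "EB (\<lambda>\<omega>. (X (Suc m) \<omega>) ^ 4) ((1 + ?q) * ?c + 16 * m4 * N * C4)"
    proof (rule EB_resample[OF m(1), rotated 1])
      show "(\<lambda>\<omega>. (X (Suc m) \<omega>) ^ 4) \<in> borel_measurable P" using Xm[of "Suc m"] step by simp
      fix \<omega>
      let ?x = "X m \<omega>" and ?y = "y \<omega> (m - 1)"
      have "X (Suc m) (fun_upd \<omega> m t) = X m \<omega> + y \<omega> (m - 1) * t" for t
      proof -
        have "X (Suc m) (fun_upd \<omega> m t) = X m (fun_upd \<omega> m t) + y (fun_upd \<omega> m t) (m - 1) * t"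
          using step by (simp add: X_def)
        then show ?thesis using m by (simp add: inv)
      qed
      then have "(\<integral>\<^sup>+t. ennreal ((X (Suc m) (fun_upd \<omega> m t)) ^ 4) \<partial>D) = (\<integral>\<^sup>+t. ennreal ((1 * ?x + ?y * t) ^ 4) \<partial>D)"
        by simp
      also have "\<dots> = ennreal (?x ^ 4 + 6 * ?x\<^sup>2 * ?y\<^sup>2 + 4 * ?x * ?y ^ 3 * (\<integral>t. t ^ 3 \<partial>D) + ?y ^ 4 * (\<integral>t. t ^ 4 \<partial>D))"
        by (subst nn_int_fourth_affine) simp
      also have "\<dots> \<le> ennreal ((1 + ?q) * ?x ^ 4 + 16 * m4 * N * ?y ^ 4)"
      proof (rule ennreal_leI)
        let ?m3 = "\<integral>t. t ^ 3 \<partial>D"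
        define A where "A = ?x\<^sup>2" define Bq where "Bq = ?y\<^sup>2"
        have AB: "0 \<le> A" "0 \<le> Bq" by (auto simp: A_def Bq_def)
        \<comment> \<open>Cauchy-Schwarz for t and t^2, obtained from the square of their difference
          with the optimal multiplier.\<close>
        have m3: "?m3\<^sup>2 \<le> m4"
        proof -
          have "0 \<le> (\<integral>t. (?m3 * t - t\<^sup>2)\<^sup>2 \<partial>D)" by simp
          also have "(\<lambda>t. (?m3 * t - t\<^sup>2)\<^sup>2) = (\<lambda>t. ?m3\<^sup>2 * t\<^sup>2 - 2 * ?m3 * t ^ 3 + t ^ 4)"
            by (rule ext) algebra
          also have "(\<integral>t. ?m3\<^sup>2 * t\<^sup>2 - 2 * ?m3 * t ^ 3 + t ^ 4 \<partial>D) = ?m3\<^sup>2 * 1 - 2 * ?m3 * ?m3 + (\<integral>t. t ^ 4 \<partial>D)"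
            using int2 int3 int4 by simp
          finally show ?thesis using le_m4 by (simp add: power2_eq_square)
        qed
        have c3: "4 * ?x * ?y ^ 3 * ?m3 \<le> 2 * A * Bq + 2 * m4 * Bq\<^sup>2"
        proof -
          have "0 \<le> 2 * ?y\<^sup>2 * (?x - ?y * ?m3)\<^sup>2" by simp
          also have "\<dots> = 2 * A * Bq + 2 * Bq\<^sup>2 * ?m3\<^sup>2 - 4 * ?x * ?y ^ 3 * ?m3"
            unfolding A_def Bq_def by algebra
          also have "2 * Bq\<^sup>2 * ?m3\<^sup>2 \<le> 2 * Bq\<^sup>2 * m4" using m3 by (intro mult_left_mono) auto
          finally show ?thesis by (simp add: mult_ac)
        qed
        have ABN: "A * Bq \<le> A\<^sup>2 / N + N * Bq\<^sup>2"
        proof -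
          have "0 \<le> (A - N * Bq)\<^sup>2 / N" using N by simp
          also have "\<dots> = A\<^sup>2 / N + N * Bq\<^sup>2 - 2 * (A * Bq)" using N by (simp add: field_simps power2_eq_square)
          finally have "2 * (A * Bq) \<le> A\<^sup>2 / N + N * Bq\<^sup>2" by simp
          moreover have "0 \<le> A * Bq" using AB by simp
          ultimately show ?thesis by linarith
        qed
        have x4: "?x ^ 4 = A\<^sup>2" "?y ^ 4 = Bq\<^sup>2" by (auto simp: A_def Bq_def)
        have "Bq\<^sup>2 * (\<integral>t. t ^ 4 \<partial>D) \<le> Bq\<^sup>2 * m4" using le_m4 by (intro mult_left_mono) auto
        then have "?x ^ 4 + 6 * ?x\<^sup>2 * ?y\<^sup>2 + 4 * ?x * ?y ^ 3 * ?m3 + ?y ^ 4 * (\<integral>t. t ^ 4 \<partial>D)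
           \<le> A\<^sup>2 + 8 * (A * Bq) + 3 * (m4 * Bq\<^sup>2)"
          using c3 unfolding x4 A_def[symmetric] Bq_def[symmetric] by (simp add: mult_ac)
        also have "\<dots> \<le> A\<^sup>2 + 8 * (A\<^sup>2 / N + N * Bq\<^sup>2) + 3 * (m4 * Bq\<^sup>2)" using ABN by simp
        also have "\<dots> \<le> A\<^sup>2 + 8 * (A\<^sup>2 / N) + 16 * (m4 * N * Bq\<^sup>2)"
        proof -
          have "1 * (N * Bq\<^sup>2) \<le> m4 * (N * Bq\<^sup>2)" using one_le_m4 N by (intro mult_right_mono) auto
          moreover have "m4 * (1 * Bq\<^sup>2) \<le> m4 * (N * Bq\<^sup>2)" using one_le_m4 N by (intro mult_left_mono mult_right_mono) auto
          moreover have "0 \<le> m4 * (N * Bq\<^sup>2)" using one_le_m4 N by simp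
          ultimately show ?thesis unfolding distrib_left mult.assoc by linarith
        qed
        also have "\<dots> = (1 + ?q) * ?x ^ 4 + 16 * m4 * N * ?y ^ 4"
          unfolding x4 by (simp add: algebra_simps)
        finally show "?x ^ 4 + 6 * ?x\<^sup>2 * ?y\<^sup>2 + 4 * ?x * ?y ^ 3 * ?m3 + ?y ^ 4 * (\<integral>t. t ^ 4 \<partial>D)
           \<le> (1 + ?q) * ?x ^ 4 + 16 * m4 * N * ?y ^ 4" .
      qed
      finally show "(\<integral>\<^sup>+t. ennreal ((X (Suc m) (fun_upd \<omega> m t)) ^ 4) \<partial>D) \<le> ennreal ((1 + ?q) * ?x ^ 4 + 16 * m4 * N * ?y ^ 4)" .
    qed
    moreover have "(1 + ?q) * ?c + 16 * m4 * N * C4 = ?B / ?q * ((1 + ?q) ^ (Suc m - a) - 1)"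
    proof -
      have "16 * m4 * N * C4 = ?B / ?q * ?q" using N by simp
      then have "(1 + ?q) * ?c + 16 * m4 * N * C4 = ?B / ?q * ((1 + ?q) * ((1 + ?q) ^ (m - a) - 1) + ?q)"
        by (simp only: distrib_left) (simp add: mult_ac)
      also have "(1 + ?q) * ((1 + ?q) ^ (m - a) - 1) + ?q = (1 + ?q) ^ (Suc m - a) - 1"
        using step by (simp add: Suc_diff_le algebra_simps)
      finally show ?thesis .
    qed
    ultimately show ?case by simp
  qed
  from this[of "b + 1"] have "EB (\<lambda>\<omega>. (X (b + 1) \<omega>) ^ 4) (?B / ?q * ((1 + ?q) ^ (b + 1 - a) - 1))"
    using a by simp
  then have "EB (\<lambda>\<omega>. (X (b + 1) \<omega>) ^ 4) (exp 8 * (16 * m4 * C4) * N\<^sup>2)"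
  proof (rule EB_mono)
    show "(\<lambda>\<omega>. (X (b + 1) \<omega>) ^ 4) \<in> borel_measurable P" using Xm[of "b+1"] by simp
    have "(1 + ?q) ^ (b + 1 - a) \<le> exp ?q ^ (b + 1 - a)"
      using N by (intro power_mono) auto
    also have "\<dots> = exp (real (b + 1 - a) * ?q)" by (rule exp_of_nat_mult[symmetric])
    also have "real (b + 1 - a) * ?q = 8" unfolding N_def[symmetric] using N by simp
    finally have "(1 + ?q) ^ (b + 1 - a) - 1 \<le> exp 8" by simp
    then have "?B / ?q * ((1 + ?q) ^ (b + 1 - a) - 1) \<le> ?B / ?q * exp 8"
      using B N by (intro mult_left_mono) auto
    also have "\<dots> = exp 8 * (16 * m4 * C4) * N\<^sup>2 / 8" using N by (simp add: field_simps power2_eq_square)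
    also have "\<dots> \<le> exp 8 * (16 * m4 * C4) * N\<^sup>2" using one_le_m4 C4_ge1 by simp
    finally show "?B / ?q * ((1 + ?q) ^ (b + 1 - a) - 1) \<le> exp 8 * (16 * m4 * C4) * N\<^sup>2" .
  qed auto
  then show ?thesis by (simp add: X_def atLeastLessThanSuc_atLeastAtMost)
qed

end

section \<open>The estimator as a predictably weighted sum\<close>

text \<open>Where \<open>y (j - 1) = 0\<close> the numerator vanishes too, and division gives the weight \<open>0\<close>.\<close>

definition capped_weight :: "nat \<Rightarrow> real \<Rightarrow> real \<Rightarrow> nat \<Rightarrow> real \<Rightarrow> (nat \<Rightarrow> real) \<Rightarrow> nat \<Rightarrow> real" where
  "capped_weight n h z0 \<nu> H y j =
     (min (Asum n h z0 y \<nu> j) H - min (Asum n h z0 y \<nu> (j - 1)) H) / y (j - 1)"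

lemma kweight_cases: "kweight n h z0 j = 0 \<or> kweight n h z0 j = 1"
  by (auto simp: kweight_def indicator_def)

lemma kweight_nonneg [simp]: "0 \<le> kweight n h z0 j"
  using kweight_cases[of n h z0 j] by auto

lemma kweight_le_1 [simp]: "kweight n h z0 j \<le> 1"
  using kweight_cases[of n h z0 j] by auto

lemma Asum_refl [simp]: "Asum n h z0 y k k = 0"
  by (simp add: Asum_def)

lemma Asum_step: "k < j \<Longrightarrow> Asum n h z0 y k j = Asum n h z0 y k (j - 1) + kweight n h z0 j * (y (j - 1))\<^sup>2"
  by (cases j) (auto simp: Asum_def)

lemma Asum_mono: "m \<le> m' \<Longrightarrow> Asum n h z0 y k m \<le> Asum n h z0 y k m'"
  unfolding Asum_def by (intro sum_mono2) auto

lemma Asum_nonneg: "0 \<le> Asum n h z0 y k m"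
  unfolding Asum_def by (intro sum_nonneg) auto

text \<open>c x is the increment of the capped sum, which lies between 0 and the uncapped increment
  q x^2; where x = 0 both increments vanish, consistently with the value 0 of the division. Hence
  |c| \<le> |x|, which turns c^2 into at most c x and so bounds the sum of squared weights by the
  telescoping total.\<close>

lemma capped_weight:
  fixes n h z0 y \<nu> j H
  assumes j: "\<nu> < j" and H: "0 \<le> H"
  defines "c \<equiv> capped_weight n h z0 \<nu> H y j" and "x \<equiv> y (j - 1)" and "q \<equiv> kweight n h z0 j"
  shows "c * x = min (Asum n h z0 y \<nu> j) H - min (Asum n h z0 y \<nu> (j - 1)) H" (is ?A)
    and "0 \<le> c * x" (is ?B) and "c * x \<le> q * x\<^sup>2" (is ?C) and "c\<^sup>2 \<le> c * x" (is ?D) and "\<bar>c\<bar> \<le> q * \<bar>x\<bar>" (is ?E)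
proof -
  let ?d = "min (Asum n h z0 y \<nu> j) H - min (Asum n h z0 y \<nu> (j - 1)) H"
  have st: "Asum n h z0 y \<nu> j = Asum n h z0 y \<nu> (j - 1) + q * x\<^sup>2"
    using Asum_step[OF j] by (simp add: q_def x_def)
  have q: "0 \<le> q" "q \<le> 1" by (auto simp: q_def)
  have qx: "0 \<le> q * x\<^sup>2" using q by simp
  have d: "0 \<le> ?d" "?d \<le> q * x\<^sup>2" using st qx by (auto simp: min_def)
  show A: ?A
  proof (cases "x = 0")
    case True
    then show ?thesis using st by simp
  next
    case False
    then show ?thesis by (simp add: c_def capped_weight_def x_def)
  qed
  show ?B ?C using A d by auto
  show ?E
  proof (cases "x = 0")
    case True
    then show ?thesis using st by (simp add: c_def capped_weight_def x_def)
  next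
    case False
    have "\<bar>c\<bar> * \<bar>x\<bar> \<le> q * \<bar>x\<bar> * \<bar>x\<bar>" using A d by (simp add: abs_mult[symmetric] power2_eq_square abs_mult_self_eq mult.assoc)
    then show ?thesis using False by (simp add: mult_le_cancel_right)
  qed
  have "c\<^sup>2 = \<bar>c\<bar> * \<bar>c\<bar>" by (simp add: power2_eq_square abs_mult_self_eq)
  also have "\<dots> \<le> \<bar>c\<bar> * \<bar>x\<bar>"
    using \<open>?E\<close> q by (intro mult_left_mono) (auto intro: order_trans[OF _ mult_left_le_one_le[of "\<bar>x\<bar>" q]])
  also have "\<dots> = c * x" using A d(1) by (simp add: abs_mult[symmetric])
  finally show ?D .
qed

lemma sum_capped_weight:
  assumes "\<nu> \<le> n" "0 \<le> H"
  shows "(\<Sum>j=\<nu>+1..n. capped_weight n h z0 \<nu> H y j * y (j - 1)) = min (Asum n h z0 y \<nu> n) H"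
proof -
  have "(\<Sum>j=\<nu>+1..m. capped_weight n h z0 \<nu> H y j * y (j - 1)) = min (Asum n h z0 y \<nu> m) H" if "\<nu> \<le> m" for m
    using that
  proof (induction m rule: dec_induct)
    case base
    then show ?case using assms by simp
  next
    case (step m)
    then show ?case using capped_weight(1)[of \<nu> "Suc m" H n h z0 y] assms by simp
  qed
  then show ?thesis using assms by simp
qed

text \<open>Before the stopping time the cap is inactive and the weight is the kernel weight times
  y_(j-1); at the stopping time it is the part still missing to reach H, which is what the
  correction coefficient encodes; afterwards it is 0.\<close>

lemma seq_kernel_est_eq_capped:
  fixes n h \<alpha> \<epsilon> z0 y
  defines "\<nu> \<equiv> nu_index n h \<alpha> z0" and "H \<equiv> threshold n h \<alpha> \<epsilon> z0 y"
  assumes H: "0 < H" "H \<le> Asum n h z0 y \<nu> n"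
  shows "seq_kernel_est n h \<alpha> \<epsilon> z0 y = (\<Sum>j=\<nu>+1..n. capped_weight n h z0 \<nu> H y j * y j) / H"
proof -
  let ?A = "Asum n h z0 y \<nu>" and ?c = "capped_weight n h z0 \<nu> H y" and ?q = "kweight n h z0"
  \<comment> \<open>Otherwise the sum is empty and cannot reach the positive threshold.\<close>
  have \<nu>: "\<nu> + 1 \<le> n"
  proof (rule ccontr)
    assume "\<not> \<nu> + 1 \<le> n"
    then have "?A n = 0" by (simp add: Asum_def)
    then show False using H by simp
  qed
  define hit where "hit = (\<lambda>k. \<nu> + 1 \<le> k \<and> k \<le> n \<and> H \<le> ?A k)"
  define \<tau> where "\<tau> = (LEAST k. hit k)"
  have hn: "hit n" using \<nu> H by (simp add: hit_def)
  then have st: "stop_time n h \<alpha> \<epsilon> z0 y = \<tau>"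
    unfolding stop_time_def \<tau>_def Let_def hit_def \<nu>_def[symmetric] H_def[symmetric] by auto
  have h\<tau>: "hit \<tau>" unfolding \<tau>_def using hn by (rule LeastI)
  have before: "?A k < H" if "\<nu> \<le> k" "k < \<tau>" for k
  proof (cases "k = \<nu>")
    case True
    then show ?thesis using H by simp
  next
    case False
    have "\<not> hit k" using that(2) unfolding \<tau>_def by (rule not_less_Least)
    then show ?thesis using False that h\<tau> by (auto simp: hit_def)
  qed
  have after: "H \<le> ?A k" if "\<tau> \<le> k" for k
    using Asum_mono[OF that, of n h z0 y \<nu>] h\<tau> by (auto simp: hit_def)
  have \<tau>: "\<nu> < \<tau>" "\<tau> \<le> n" "H \<le> ?A \<tau>" "?A (\<tau> - 1) < H" using h\<tau> before[of "\<tau> - 1"] by (auto simp: hit_def)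
  have c1: "?c j = ?q j * y (j - 1)" if "j \<in> {\<nu>+1..\<tau>-1}" for j
  proof -
    have "?A j < H" "?A (j - 1) < H" using that by (auto intro!: before)
    then show ?thesis using Asum_step[of \<nu> j n h z0 y] that
      by (simp add: capped_weight_def power2_eq_square)
  qed
  have c3: "?c j = 0" if "j \<in> {\<tau>+1..n}" for j
  proof -
    have "H \<le> ?A j" "H \<le> ?A (j - 1)" using that by (auto intro!: after)
    then show ?thesis by (simp add: capped_weight_def min_def)
  qed
  let ?\<kappa> = "corr_coeff n h \<alpha> \<epsilon> z0 y"
  \<comment> \<open>The sum jumps from below H to at least H at \<tau>, so this summand is positive;
    this makes the equation defining the correction coefficient uniquely solvable.\<close>
  have pos: "0 < ?q \<tau> * (y (\<tau> - 1))\<^sup>2" using Asum_step[OF \<tau>(1), of n h z0 y] \<tau> by linarith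
  have c2: "?c \<tau> = ?\<kappa> * ?q \<tau> * y (\<tau> - 1)"
  proof -
    have "?\<kappa> = (THE \<kappa>. ?A (\<tau> - 1) + \<kappa> * ?q \<tau> * (y (\<tau> - 1))\<^sup>2 = H)"
      unfolding corr_coeff_def Let_def st \<nu>_def[symmetric] H_def[symmetric] using \<tau> by simp
    also have "\<dots> = (H - ?A (\<tau> - 1)) / (?q \<tau> * (y (\<tau> - 1))\<^sup>2)"
    proof (rule the_equality)
      show "?A (\<tau> - 1) + (H - ?A (\<tau> - 1)) / (?q \<tau> * (y (\<tau> - 1))\<^sup>2) * ?q \<tau> * (y (\<tau> - 1))\<^sup>2 = H"
      proof -
        have "?q \<tau> \<noteq> 0" "y (\<tau> - 1) \<noteq> 0" using pos by auto
        then show ?thesis unfolding mult.assoc by simp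
      qed
      show "\<kappa> = (H - ?A (\<tau> - 1)) / (?q \<tau> * (y (\<tau> - 1))\<^sup>2)"
        if "?A (\<tau> - 1) + \<kappa> * ?q \<tau> * (y (\<tau> - 1))\<^sup>2 = H" for \<kappa>
      proof -
        have "\<kappa> * (?q \<tau> * (y (\<tau> - 1))\<^sup>2) = H - ?A (\<tau> - 1)" using that unfolding mult.assoc by linarith
        then show ?thesis using pos by (metis less_irrefl nonzero_eq_divide_eq)
      qed
    qed
    finally have "?\<kappa> * ?q \<tau> * y (\<tau> - 1) = (H - ?A (\<tau> - 1)) / y (\<tau> - 1)"
    proof -
      have "?q \<tau> = 1" "y (\<tau> - 1) \<noteq> 0" using pos kweight_cases[of n h z0 \<tau>] by auto
      moreover assume "?\<kappa> = (H - ?A (\<tau> - 1)) / (?q \<tau> * (y (\<tau> - 1))\<^sup>2)"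
      ultimately show ?thesis by (simp add: power2_eq_square)
    qed
    moreover have "?c \<tau> = (H - ?A (\<tau> - 1)) / y (\<tau> - 1)"
      using \<tau> by (simp add: capped_weight_def)
    ultimately show ?thesis by simp
  qed
  have "{\<nu>+1..n} = {\<nu>+1..\<tau>-1} \<union> ({\<tau>} \<union> {\<tau>+1..n})" using \<tau> by auto
  then have "(\<Sum>j=\<nu>+1..n. ?c j * y j) = (\<Sum>j=\<nu>+1..\<tau>-1. ?c j * y j) + (?c \<tau> * y \<tau> + (\<Sum>j=\<tau>+1..n. ?c j * y j))"
    using \<tau> by (simp only:) (subst sum.union_disjoint, auto)
  also have "(\<Sum>j=\<tau>+1..n. ?c j * y j) = 0" by (intro sum.neutral) (use c3 in auto)
  also have "(\<Sum>j=\<nu>+1..\<tau>-1. ?c j * y j) = (\<Sum>j=\<nu>+1..\<tau>-1. ?q j * y (j - 1) * y j)"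
    by (intro sum.cong refl) (use c1 in auto)
  finally show ?thesis
    unfolding seq_kernel_est_def Let_def st \<nu>_def[symmetric] H_def[symmetric]
    using H(2) c2 by (simp add: field_simps)
qed

text \<open>The bias is written over the whole window instead of up to the stopping time, because
  summation by parts needs deterministic weights. The difference of the two sums is bounded by W
  times the overshoot A_n - H. If the threshold is not reached, the estimator is 0 and the error is
  |S0|.\<close>

lemma seq_kernel_est_error:
  fixes n h \<alpha> \<epsilon> z0 y
  defines "\<nu> \<equiv> nu_index n h \<alpha> z0" and "H \<equiv> threshold n h \<alpha> \<epsilon> z0 y"
  assumes H: "0 < H" and \<nu>: "\<nu> \<le> n"
    and rec: "\<And>j. j \<in> {\<nu>+1..n} \<Longrightarrow> y j = s j * y (j - 1) + \<xi> j"
    and w: "\<And>j. j \<in> {\<nu>+1..n} \<Longrightarrow> kweight n h z0 j \<noteq> 0 \<Longrightarrow> \<bar>s j - S0\<bar> \<le> W" and W: "0 \<le> W"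
  shows "\<bar>seq_kernel_est n h \<alpha> \<epsilon> z0 y - S0\<bar> \<le>
      \<bar>\<Sum>j=\<nu>+1..n. capped_weight n h z0 \<nu> H y j * \<xi> j\<bar> / H
    + \<bar>\<Sum>j=\<nu>+1..n. kweight n h z0 j * (s j - S0) * (y (j - 1))\<^sup>2\<bar> / H
    + W * max 0 (Asum n h z0 y \<nu> n - H) / H
    + (if Asum n h z0 y \<nu> n < H then \<bar>S0\<bar> else 0)"
proof (cases "H \<le> Asum n h z0 y \<nu> n")
  case False
  then have "seq_kernel_est n h \<alpha> \<epsilon> z0 y = 0"
    unfolding seq_kernel_est_def Let_def \<nu>_def[symmetric] H_def[symmetric] by simp
  moreover have "0 \<le> \<bar>\<Sum>j=\<nu>+1..n. capped_weight n h z0 \<nu> H y j * \<xi> j\<bar> / H"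
    "0 \<le> \<bar>\<Sum>j=\<nu>+1..n. kweight n h z0 j * (s j - S0) * (y (j - 1))\<^sup>2\<bar> / H"
    "0 \<le> W * max 0 (Asum n h z0 y \<nu> n - H) / H"
    using H W by auto
  ultimately show ?thesis using False by simp
next
  case True
  let ?A = "Asum n h z0 y \<nu>" and ?c = "capped_weight n h z0 \<nu> H y" and ?q = "kweight n h z0"
  let ?X = "\<Sum>j=\<nu>+1..n. ?c j * \<xi> j" and ?B = "\<Sum>j=\<nu>+1..n. ?q j * (s j - S0) * (y (j - 1))\<^sup>2"
  let ?R = "\<Sum>j=\<nu>+1..n. (s j - S0) * (?q j * (y (j - 1))\<^sup>2 - ?c j * y (j - 1))"
  have est: "seq_kernel_est n h \<alpha> \<epsilon> z0 y * H = (\<Sum>j=\<nu>+1..n. ?c j * y j)"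
    using seq_kernel_est_eq_capped[of n h \<alpha> \<epsilon> z0 y] H True unfolding \<nu>_def H_def by simp
  have sc: "(\<Sum>j=\<nu>+1..n. ?c j * y (j - 1)) = H" using sum_capped_weight[OF \<nu>, of H h z0 y] H True by simp
  have "(\<Sum>j=\<nu>+1..n. ?c j * y j) - S0 * (\<Sum>j=\<nu>+1..n. ?c j * y (j - 1))
      = (\<Sum>j=\<nu>+1..n. ?c j * y j - S0 * (?c j * y (j - 1)))"
    by (simp add: sum_subtractf sum_distrib_left)
  also have "\<dots> = (\<Sum>j=\<nu>+1..n. ?c j * \<xi> j + ?q j * (s j - S0) * (y (j - 1))\<^sup>2
       - (s j - S0) * (?q j * (y (j - 1))\<^sup>2 - ?c j * y (j - 1)))"
  proof (rule sum.cong[OF refl])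
    fix j assume j: "j \<in> {\<nu>+1..n}"
    show "?c j * y j - S0 * (?c j * y (j - 1)) = ?c j * \<xi> j + ?q j * (s j - S0) * (y (j - 1))\<^sup>2
       - (s j - S0) * (?q j * (y (j - 1))\<^sup>2 - ?c j * y (j - 1))"
      unfolding rec[OF j] by (simp add: algebra_simps)
  qed
  also have "\<dots> = ?X + ?B - ?R" by (simp add: sum.distrib sum_subtractf)
  finally have eq: "(seq_kernel_est n h \<alpha> \<epsilon> z0 y - S0) * H = ?X + ?B - ?R"
    using est sc by (simp add: left_diff_distrib)
  have "\<bar>?R\<bar> \<le> (\<Sum>j=\<nu>+1..n. W * (?q j * (y (j - 1))\<^sup>2 - ?c j * y (j - 1)))"
  proof (rule order_trans[OF sum_abs sum_mono])
    fix j assume j: "j \<in> {\<nu>+1..n}"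
    have d: "0 \<le> ?q j * (y (j - 1))\<^sup>2 - ?c j * y (j - 1)" "0 \<le> ?c j * y (j - 1)"
      using capped_weight(2,3)[of \<nu> j H n h z0 y] j H by auto
    show "\<bar>(s j - S0) * (?q j * (y (j - 1))\<^sup>2 - ?c j * y (j - 1))\<bar> \<le> W * (?q j * (y (j - 1))\<^sup>2 - ?c j * y (j - 1))"
    proof (cases "?q j = 0")
      case True
      then have "?q j * (y (j - 1))\<^sup>2 - ?c j * y (j - 1) = 0" using d by simp
      then show ?thesis by simp
    next
      case False
      then show ?thesis using w[OF j False] d by (simp add: abs_mult mult_right_mono)
    qed
  qed
  also have "\<dots> = W * (?A n - H)"
    using sc by (simp add: sum_distrib_left[symmetric] sum_subtractf Asum_def)
  finally have R: "\<bar>?R\<bar> \<le> W * max 0 (?A n - H)" using True by simp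
  have "\<bar>seq_kernel_est n h \<alpha> \<epsilon> z0 y - S0\<bar> * H = \<bar>?X + ?B - ?R\<bar>"
    by (simp only: eq[symmetric] abs_mult abs_of_pos[OF H])
  also have "\<dots> \<le> \<bar>?X\<bar> + \<bar>?B\<bar> + W * max 0 (?A n - H)" using R by linarith
  finally have "\<bar>seq_kernel_est n h \<alpha> \<epsilon> z0 y - S0\<bar> \<le> (\<bar>?X\<bar> + \<bar>?B\<bar> + W * max 0 (?A n - H)) / H"
    using H by (simp only: pos_le_divide_eq)
  then show ?thesis unfolding add_divide_distrib using True by simp
qed

section \<open>Design points inside the kernel window\<close>

locale kernel_window =
  fixes n :: nat and h \<alpha> z0 :: real
  assumes h: "0 < h" "h < z0" "z0 + h < 1" and n1: "1 \<le> n"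
begin

definition e :: real where "e = eps_tilde n h \<alpha>"
definition \<nu> :: nat where "\<nu> = nu_index n h \<alpha> z0"
text \<open>First design index in the closed window. When n z0 - n h is an integer, it lies one
  below the starting index in \<open>nu_index\<close>; the extra term is absorbed by the rounding
  constants.\<close>

definition lo :: nat where "lo = nat \<lceil>real n * z0 - real n * h\<rceil>"
definition hi :: nat where "hi = nat \<lfloor>real n * z0 + real n * h\<rfloor>"

lemma n_pos: "0 < real n" using n1 by simp

lemma ends_pos: "0 < real n * z0 - real n * h" "real n * z0 + real n * h < real n"
proof -
  have "real n * h < real n * z0" using h n_pos by (intro mult_strict_left_mono)
  then show "0 < real n * z0 - real n * h" by simp
  have "real n * (z0 + h) < real n * 1" using h n_pos by (intro mult_strict_left_mono)
  then show "real n * z0 + real n * h < real n" by (simp add: distrib_left)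
qed

lemma kweight_eq: "kweight n h z0 j = of_bool (lo \<le> j \<and> j \<le> hi)"
proof -
  have "(real j / real n - z0) / h \<in> {-1..1} \<longleftrightarrow> real n * z0 - real n * h \<le> real j \<and> real j \<le> real n * z0 + real n * h"
    using h n_pos by (auto simp: field_simps)
  also have "\<dots> \<longleftrightarrow> lo \<le> j \<and> j \<le> hi"
  proof -
    have "0 \<le> \<lfloor>real n * z0 + real n * h\<rfloor>" using h n_pos by simp
    then show ?thesis unfolding lo_def hi_def by (simp add: le_nat_iff nat_le_iff ceiling_le_iff le_floor_iff)
  qed
  finally show ?thesis by (auto simp: kweight_def indicator_def)
qed

lemma hi_le: "hi \<le> n" and hi_bounds: "real n * z0 + real n * h - 1 < real hi" "real hi \<le> real n * z0 + real n * h"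
proof -
  have 0: "0 \<le> \<lfloor>real n * z0 + real n * h\<rfloor>" using h n_pos by simp
  then have "real hi = of_int \<lfloor>real n * z0 + real n * h\<rfloor>" by (simp add: hi_def)
  then show 1: "real n * z0 + real n * h - 1 < real hi" "real hi \<le> real n * z0 + real n * h" by linarith+
  then have "real hi < real n" using ends_pos by linarith
  then show "hi \<le> n" by simp
qed

lemma lo_bounds: "1 \<le> lo" "real n * z0 - real n * h \<le> real lo" "real lo < real n * z0 - real n * h + 1"
proof -
  have 0: "0 < \<lceil>real n * z0 - real n * h\<rceil>" using ends_pos by simp
  then show "1 \<le> lo" unfolding lo_def by linarith
  have "real lo = of_int \<lceil>real n * z0 - real n * h\<rceil>" using 0 by (simp add: lo_def)
  then show "real n * z0 - real n * h \<le> real lo" "real lo < real n * z0 - real n * h + 1" by linarith+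
qed

lemma nu_bounds:
  assumes "0 \<le> e"
  shows "real n * z0 - real n * h + e * real n * h < real \<nu>" "real \<nu> \<le> real n * z0 - real n * h + e * real n * h + 2" "lo \<le> \<nu>"
proof -
  have a: "real (nat \<lfloor>real n * z0 - real n * h\<rfloor>) = of_int \<lfloor>real n * z0 - real n * h\<rfloor>"
    using ends_pos by simp
  have b: "real (nat \<lfloor>e * real n * h\<rfloor>) = of_int \<lfloor>e * real n * h\<rfloor>"
    using assms h by simp
  have c: "real \<nu> = real (nat \<lfloor>real n * z0 - real n * h\<rfloor>) + 1 + (real (nat \<lfloor>e * real n * h\<rfloor>) + 1)"
    by (simp add: \<nu>_def nu_index_def e_def)
  show 1: "real n * z0 - real n * h + e * real n * h < real \<nu>" "real \<nu> \<le> real n * z0 - real n * h + e * real n * h + 2"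
    unfolding c a b by linarith+
  have "\<lceil>real n * z0 - real n * h\<rceil> \<le> \<lfloor>real n * z0 - real n * h\<rfloor> + 1" by linarith
  then have "lo \<le> nat \<lfloor>real n * z0 - real n * h\<rfloor> + 1" unfolding lo_def by linarith
  then show "lo \<le> \<nu>" by (simp add: \<nu>_def nu_index_def)
qed

end

section \<open>The window and the exceptional events\<close>

lemma Asum_cong: "(\<And>i. i < m \<Longrightarrow> y i = y' i) \<Longrightarrow> Asum n h z0 y k m = Asum n h z0 y' k m"
  unfolding Asum_def by (intro sum.cong refl) auto

text \<open>H is known at time \<nu>. This makes the weights after \<nu> predictable and fixes the
  variance budget before the replacement starts.\<close>

lemma threshold_cong:
  assumes "\<And>i. i \<le> nu_index n h \<alpha> z0 \<Longrightarrow> y i = y' i"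
  shows "threshold n h \<alpha> \<epsilon> z0 y = threshold n h \<alpha> \<epsilon> z0 y'"
proof -
  let ?\<nu> = "nu_index n h \<alpha> z0"
  have "Asum n h z0 y 0 ?\<nu> = Asum n h z0 y' 0 ?\<nu>"
    using assms by (intro Asum_cong) auto
  moreover have "(\<Sum>j = 1..?\<nu>. kweight n h z0 j * y (j - 1) * y j) = (\<Sum>j = 1..?\<nu>. kweight n h z0 j * y' (j - 1) * y' j)"
    using assms by (intro sum.cong refl) auto
  ultimately show ?thesis
    by (simp add: threshold_def trunc_est_def prelim_est_def Let_def)
qed

lemma capped_weight_cong:
  assumes "\<And>i. i < j \<Longrightarrow> y i = y' i" "0 < j"
  shows "capped_weight n h z0 \<nu> H y j = capped_weight n h z0 \<nu> H y' j"
proof -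
  have "Asum n h z0 y \<nu> j = Asum n h z0 y' \<nu> j" "Asum n h z0 y \<nu> (j - 1) = Asum n h z0 y' \<nu> (j - 1)"
    using assms by (auto intro!: Asum_cong)
  then show ?thesis using assms by (simp add: capped_weight_def)
qed

lemma sum_by_parts:
  fixes w v :: "nat \<Rightarrow> real"
  assumes "1 \<le> a" "a \<le> b"
  shows "(\<Sum>j=a..b. w j * v j) - (\<Sum>j=a..b. w j * v (j - 1))
     = w b * v b - w a * v (a - 1) + (\<Sum>j=a..<b. (w j - w (j + 1)) * v j)"
  using assms(2)
proof (induction b rule: dec_induct)
  case base
  then show ?case by simp
next
  case (step b)
  then show ?case by (simp add: algebra_simps)
qed

text \<open>By \<open>y_square_rec\<close>, (1 - s_j^2) y_(j-1)^2 is 1 plus a martingale difference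
  minus the increment of y_j^2, and summation by parts handles the increments. Constant weights
  serve the sums A, the weights s_j - S(z0) the bias.\<close>

lemma (in ar_noise) weighted_square_sum:
  assumes "1 \<le> a" "a \<le> b" "b \<le> n"
  shows "(\<Sum>j=a..b. w j * (1 - (s j)\<^sup>2) * (y \<omega> (j - 1))\<^sup>2)
     = (\<Sum>j=a..b. w j) + (\<Sum>j=a..b. w j * mdiff \<omega> j)
       - (w b * (y \<omega> b)\<^sup>2 - w a * (y \<omega> (a - 1))\<^sup>2 + (\<Sum>j=a..<b. (w j - w (j + 1)) * (y \<omega> j)\<^sup>2))"
proof -
  have "(\<Sum>j=a..b. w j * (1 - (s j)\<^sup>2) * (y \<omega> (j - 1))\<^sup>2)
      = (\<Sum>j=a..b. w j + w j * mdiff \<omega> j - (w j * (y \<omega> j)\<^sup>2 - w j * (y \<omega> (j - 1))\<^sup>2))"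
  proof (rule sum.cong[OF refl])
    fix j assume "j \<in> {a..b}"
    then have "j \<in> {1..n}" using assms by auto
    then show "w j * (1 - (s j)\<^sup>2) * (y \<omega> (j - 1))\<^sup>2 = w j + w j * mdiff \<omega> j - (w j * (y \<omega> j)\<^sup>2 - w j * (y \<omega> (j - 1))\<^sup>2)"
      by (subst y_square_rec) (auto simp: algebra_simps)
  qed
  also have "\<dots> = (\<Sum>j=a..b. w j) + (\<Sum>j=a..b. w j * mdiff \<omega> j)
      - ((\<Sum>j=a..b. w j * (y \<omega> j)\<^sup>2) - (\<Sum>j=a..b. w j * (y \<omega> (j - 1))\<^sup>2))"
    by (simp add: sum.distrib sum_subtractf)
  finally show ?thesis unfolding sum_by_parts[OF assms(1,2), of w "\<lambda>j. (y \<omega> j)\<^sup>2"] .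
qed

lemma clip_dist_le:
  fixes x c a b :: real
  assumes "a \<le> c" "c \<le> b"
  shows "\<bar>min (max x a) b - c\<bar> \<le> \<bar>x - c\<bar>"
  using assms by (auto simp: min_def max_def)

text \<open>The two numerical assumptions hold for all large n, because h / eps_tilde tends to 0 and
  eps_tilde n h to infinity. The first keeps the drift of S over the window below the precision
  asked of the preliminary estimate, the second absorbs rounding terms.\<close>

locale seq_model = ar_noise D m4 n y0 S \<epsilon> + kernel_window n h \<alpha> z0
  for D m4 n y0 S \<epsilon> h \<alpha> z0 +
  fixes L :: real
  assumes lip: "x \<in> {0..1} \<Longrightarrow> x' \<in> {0..1} \<Longrightarrow> \<bar>S x - S x'\<bar> \<le> L * \<bar>x - x'\<bar>"
    and S0: "\<bar>S z0\<bar> \<le> 1 - \<epsilon>" and L: "0 < L"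
    and e_pos: "0 < e" and e_le: "e \<le> 1 / 2"
    and small: "L * h \<le> \<epsilon> * e / 32" and large: "40 \<le> \<epsilon> * (e * (real n * h))"
begin

definition NH :: real where "NH = real n * h"
definition E :: real where "E = e * NH"
definition p :: real where "p = sqrt NH"
definition \<gamma> :: real where "\<gamma> = 1 - (S z0)\<^sup>2"
text \<open>\<open>c * e\<close> is the precision demanded of the preliminary estimate. It moves 1 -
  S(z0)^2 by at most \<epsilon> e / 8, well below the relative slack e built into the
  threshold.\<close>

definition c :: real where "c = \<epsilon> / 16"

lemma E_alt: "e * real n * h = E" "e * (real n * h) = E" by (auto simp: E_def NH_def)

lemma NH_pos: "0 < NH" using h n_pos by (simp add: NH_def)

lemma p_pos: "0 < p" and p_sq: "p * p = NH" "p\<^sup>2 = NH"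
  using NH_pos by (auto simp: p_def)

lemma E_ge: "40 \<le> \<epsilon> * E" "40 \<le> E"
proof -
  show 1: "40 \<le> \<epsilon> * E" using large by (simp add: E_def NH_def)
  have "0 \<le> E" using e_pos NH_pos by (simp add: E_def)
  then have "\<epsilon> * E \<le> E" using eps by (intro mult_left_le_one_le) auto
  then show "40 \<le> E" using 1 by simp
qed

lemma E_le: "E \<le> NH / 2"
proof -
  have "e * NH \<le> 1 / 2 * NH" using e_le NH_pos by (intro mult_right_mono) auto
  then show ?thesis by (simp add: E_def)
qed

lemma gamma: "\<epsilon> \<le> \<gamma>" "\<gamma> \<le> 1" "0 < \<gamma>"
proof -
  have "(S z0)\<^sup>2 \<le> (1 - \<epsilon>)\<^sup>2" using S0 eps by (metis abs_ge_zero power2_abs power_mono)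
  also have "\<dots> \<le> 1 - \<epsilon>" using eps by (simp add: power2_eq_square mult_left_le)
  finally show 1: "\<epsilon> \<le> \<gamma>" by (simp add: \<gamma>_def)
  show "\<gamma> \<le> 1" by (simp add: \<gamma>_def)
  show "0 < \<gamma>" using 1 eps by simp
qed

text \<open>Up to rounding, the preliminary block has E indices and the estimation block 2 n h - E.
  The bound 4 E hides the rounding terms, as E is at least 40.\<close>

lemma window:
  "lo \<le> \<nu>" "1 \<le> lo" "\<nu> < hi" "hi \<le> n"
  "E < real (\<nu> + 1 - lo)" "real (\<nu> + 1 - lo) \<le> 4 * E"
  "2 * NH - E - 3 \<le> real (hi - \<nu>)" "real (hi - \<nu>) \<le> 2 * NH"
proof -
  note a = nu_bounds[OF less_imp_le[OF e_pos], unfolded E_alt]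
  show 1: "lo \<le> \<nu>" "1 \<le> lo" "hi \<le> n" using a lo_bounds hi_le by auto
  have "real \<nu> < real hi" using a(2) hi_bounds E_le E_ge unfolding NH_def by linarith
  then show 2: "\<nu> < hi" by simp
  have r: "real (\<nu> + 1 - lo) = real \<nu> + 1 - real lo" using 1 by (simp add: of_nat_diff)
  show "E < real (\<nu> + 1 - lo)" "real (\<nu> + 1 - lo) \<le> 4 * E"
    unfolding r using a lo_bounds E_ge by linarith+
  have r: "real (hi - \<nu>) = real hi - real \<nu>" using 2 by (simp add: of_nat_diff)
  show "2 * NH - E - 3 \<le> real (hi - \<nu>)" "real (hi - \<nu>) \<le> 2 * NH"
    unfolding r using a hi_bounds E_ge unfolding NH_def by linarith+
qed

lemma s_close: "j \<in> {lo..hi} \<Longrightarrow> \<bar>s j - S z0\<bar> \<le> L * h"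
proof -
  assume j: "j \<in> {lo..hi}"
  have u: "real j / real n \<in> {0..1}" using j hi_le n_pos by (auto simp: field_simps)
  have "real n * z0 - real n * h \<le> real j" "real j \<le> real n * z0 + real n * h"
    using j lo_bounds(2) hi_bounds(2) of_nat_mono[of lo j, where 'a=real] of_nat_mono[of j hi, where 'a=real] by auto
  then have "\<bar>real j / real n - z0\<bar> \<le> h"
    using n_pos by (auto simp: abs_le_iff field_simps)
  then have "L * \<bar>real j / real n - z0\<bar> \<le> L * h" using L by (intro mult_left_mono) auto
  moreover have "z0 \<in> {0..1}" using h by auto
  ultimately show ?thesis using lip[OF u, of z0] by (simp add: s_def)
qed

lemma s_le_1: "j \<in> {1..n} \<Longrightarrow> (s j)\<^sup>2 \<le> 1"
  using S_le[of j] eps by (simp add: s_def abs_square_le_1)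

lemma sq_close: "j \<in> {lo..hi} \<Longrightarrow> \<bar>(s j)\<^sup>2 - (S z0)\<^sup>2\<bar> \<le> 2 * L * h"
proof -
  assume j: "j \<in> {lo..hi}"
  then have "j \<in> {1..n}" using lo_bounds hi_le by auto
  then have "\<bar>s j + S z0\<bar> \<le> 2" using S_le[of j] S0 eps by (simp add: s_def)
  then have "\<bar>s j + S z0\<bar> * \<bar>s j - S z0\<bar> \<le> 2 * (L * h)" using s_close[OF j] by (intro mult_mono) auto
  then show ?thesis by (simp add: power2_eq_square abs_mult[symmetric] algebra_simps)
qed

abbreviation A1 where "A1 \<omega> \<equiv> Asum n h z0 (y \<omega>) 0 \<nu>"
abbreviation A2 where "A2 \<omega> \<equiv> Asum n h z0 (y \<omega>) \<nu> n"
definition M1 where "M1 \<omega> = (\<Sum>j=lo..\<nu>. mdiff \<omega> j)"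
definition M2 where "M2 \<omega> = (\<Sum>j=\<nu>+1..hi. mdiff \<omega> j)"
definition X1 where "X1 \<omega> = (\<Sum>j=lo..\<nu>. y \<omega> (j - 1) * \<omega> j)"
abbreviation St where "St \<omega> \<equiv> trunc_est n h \<alpha> \<epsilon> z0 (y \<omega>)"
abbreviation H where "H \<omega> \<equiv> threshold n h \<alpha> \<epsilon> z0 (y \<omega>)"

lemma sum_window1: "(\<Sum>j=1..\<nu>. kweight n h z0 j * f j) = (\<Sum>j=lo..\<nu>. f j)"
proof -
  have "(\<Sum>j=1..\<nu>. kweight n h z0 j * f j) = (\<Sum>j=1..\<nu>. if j \<in> {lo..\<nu>} then f j else 0)"
    using window by (intro sum.cong refl) (auto simp: kweight_eq)
  also have "\<dots> = (\<Sum>j\<in>{1..\<nu>} \<inter> {lo..\<nu>}. f j)" by (rule sum.inter_restrict[symmetric]) simp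
  also have "{1..\<nu>} \<inter> {lo..\<nu>} = {lo..\<nu>}" using window by auto
  finally show ?thesis .
qed

lemma sum_window2: "(\<Sum>j=\<nu>+1..n. kweight n h z0 j * f j) = (\<Sum>j=\<nu>+1..hi. f j)"
proof -
  have "(\<Sum>j=\<nu>+1..n. kweight n h z0 j * f j) = (\<Sum>j=\<nu>+1..n. if j \<in> {\<nu>+1..hi} then f j else 0)"
    using window by (intro sum.cong refl) (auto simp: kweight_eq)
  also have "\<dots> = (\<Sum>j\<in>{\<nu>+1..n} \<inter> {\<nu>+1..hi}. f j)" by (rule sum.inter_restrict[symmetric]) simp
  also have "{\<nu>+1..n} \<inter> {\<nu>+1..hi} = {\<nu>+1..hi}" using window by auto
  finally show ?thesis .
qed

lemma A1_eq: "A1 \<omega> = (\<Sum>j=lo..\<nu>. (y \<omega> (j - 1))\<^sup>2)"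
  unfolding Asum_def using sum_window1 by simp

lemma A2_eq: "A2 \<omega> = (\<Sum>j=\<nu>+1..hi. (y \<omega> (j - 1))\<^sup>2)"
  unfolding Asum_def using sum_window2 by simp

text \<open>Inserting the factors 1 - s_j^2 \<le> 1 only lowers the sum and makes
  \<open>weighted_square_sum\<close> applicable; the boundary square at \<open>lo - 1\<close> enters
  with a favourable sign.\<close>

lemma A1_lower: "E - \<bar>M1 \<omega>\<bar> - (y \<omega> \<nu>)\<^sup>2 \<le> A1 \<omega>"
proof -
  have "(\<Sum>j=lo..\<nu>. 1 * (1 - (s j)\<^sup>2) * (y \<omega> (j - 1))\<^sup>2) \<le> (\<Sum>j=lo..\<nu>. (y \<omega> (j - 1))\<^sup>2)"
    using window by (intro sum_mono) (auto intro!: mult_left_le_one_le s_le_1)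
  moreover have "(\<Sum>j=lo..\<nu>. 1 * (1 - (s j)\<^sup>2) * (y \<omega> (j - 1))\<^sup>2) = real (\<nu> + 1 - lo) + M1 \<omega> - ((y \<omega> \<nu>)\<^sup>2 - (y \<omega> (lo - 1))\<^sup>2)"
    using window by (subst weighted_square_sum) (auto simp: M1_def)
  moreover have "0 \<le> (y \<omega> (lo - 1))\<^sup>2" by simp
  ultimately show ?thesis unfolding A1_eq using window(5) by linarith
qed

lemma A2_identity_bounds:
  "\<bar>\<gamma> * A2 \<omega> - (real (hi - \<nu>) + M2 \<omega> - (y \<omega> hi)\<^sup>2 + (y \<omega> \<nu>)\<^sup>2)\<bar> \<le> 2 * L * h * A2 \<omega>"
proof -
  have eq: "(\<Sum>j=\<nu>+1..hi. 1 * (1 - (s j)\<^sup>2) * (y \<omega> (j - 1))\<^sup>2) = real (hi - \<nu>) + M2 \<omega> - (y \<omega> hi)\<^sup>2 + (y \<omega> \<nu>)\<^sup>2"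
    using window by (subst weighted_square_sum) (auto simp: M2_def)
  have "\<gamma> * A2 \<omega> - (\<Sum>j=\<nu>+1..hi. 1 * (1 - (s j)\<^sup>2) * (y \<omega> (j - 1))\<^sup>2)
     = (\<Sum>j=\<nu>+1..hi. ((s j)\<^sup>2 - (S z0)\<^sup>2) * (y \<omega> (j - 1))\<^sup>2)"
    unfolding A2_eq \<gamma>_def sum_distrib_left by (simp add: sum_subtractf[symmetric] algebra_simps)
  moreover have "\<bar>\<Sum>j=\<nu>+1..hi. ((s j)\<^sup>2 - (S z0)\<^sup>2) * (y \<omega> (j - 1))\<^sup>2\<bar> \<le> (\<Sum>j=\<nu>+1..hi. 2 * L * h * (y \<omega> (j - 1))\<^sup>2)"
    using window by (intro order_trans[OF sum_abs sum_mono]) (auto simp: abs_mult intro!: mult_right_mono sq_close)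
  ultimately show ?thesis unfolding eq A2_eq sum_distrib_left by simp
qed

lemma St_bounds: "\<bar>St \<omega>\<bar> \<le> 1 - \<epsilon>" "\<epsilon> \<le> 1 - (St \<omega>)\<^sup>2" "1 - (St \<omega>)\<^sup>2 \<le> 1"
proof -
  show 1: "\<bar>St \<omega>\<bar> \<le> 1 - \<epsilon>" using eps by (auto simp: trunc_est_def)
  have "(St \<omega>)\<^sup>2 \<le> (1 - \<epsilon>)\<^sup>2" using 1 by (metis abs_ge_zero power2_abs power_mono)
  also have "\<dots> \<le> 1 - \<epsilon>" using eps by (simp add: power2_eq_square mult_left_le)
  finally show "\<epsilon> \<le> 1 - (St \<omega>)\<^sup>2" by simp
qed simp

lemma H_eq: "H \<omega> = 2 * (1 - e) / (1 - (St \<omega>)\<^sup>2) * NH"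
  by (simp add: threshold_def e_def NH_def)

lemma H_mult: "H \<omega> * (1 - (St \<omega>)\<^sup>2) = 2 * (1 - e) * NH"
  unfolding H_eq using St_bounds(2)[of \<omega>] eps by simp

lemma H_ge: "NH \<le> H \<omega>"
proof -
  have "H \<omega> * (1 - (St \<omega>)\<^sup>2) \<le> H \<omega>"
  proof -
    have "0 \<le> H \<omega>" unfolding H_eq using St_bounds(2)[of \<omega>] eps e_le NH_pos by simp
    then show ?thesis using St_bounds[of \<omega>] eps by (intro mult_left_le) auto
  qed
  moreover have "1 * NH \<le> 2 * (1 - e) * NH" using e_le NH_pos by (intro mult_right_mono) auto
  ultimately show ?thesis using H_mult[of \<omega>] by simp
qed

lemma H_pos: "0 < H \<omega>" using H_ge[of \<omega>] NH_pos by linarith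

text \<open>A moment-friendly majorant of the indicator of a bad preliminary estimate.\<close>

definition \<Psi> where "\<Psi> \<omega> = 8 / E\<^sup>2 * ((M1 \<omega>)\<^sup>2 + (y \<omega> \<nu>) ^ 4) + 256 / (c * e * E) ^ 4 * (X1 \<omega>) ^ 4"

lemma Psi_nonneg: "0 \<le> \<Psi> \<omega>"
  by (simp add: \<Psi>_def)

text \<open>Chebyshev's argument done pathwise: if the denominator is at least E / 2 and the noise
  part of the numerator at most c e E / 4, the ratio is precise enough. Otherwise a square or a
  fourth power is large, which gives the factors 8 and 256 = 4^4 in the majorant. Truncation to an
  interval containing S(z0) cannot increase the error.\<close>

lemma prelim_good: "\<bar>St \<omega> - S z0\<bar> \<le> c * e \<or> 1 \<le> \<Psi> \<omega>"
proof (cases "\<bar>M1 \<omega>\<bar> + (y \<omega> \<nu>)\<^sup>2 \<le> E / 2 \<and> \<bar>X1 \<omega>\<bar> \<le> c * e / 2 * (E / 2)")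
  case True
  have A1: "E / 2 \<le> A1 \<omega>" using A1_lower[of \<omega>] True by linarith
  then have A1p: "0 < A1 \<omega>" using E_ge by linarith
  have num: "(\<Sum>j = 1..\<nu>. kweight n h z0 j * y \<omega> (j - 1) * y \<omega> j) = (\<Sum>j=lo..\<nu>. y \<omega> (j - 1) * y \<omega> j)"
    using sum_window1[of "\<lambda>j. y \<omega> (j - 1) * y \<omega> j"] by (simp add: mult.assoc)
  have "(\<Sum>j=lo..\<nu>. y \<omega> (j - 1) * y \<omega> j) - S z0 * A1 \<omega> = (\<Sum>j=lo..\<nu>. (s j - S z0) * (y \<omega> (j - 1))\<^sup>2) + X1 \<omega>"
    unfolding A1_eq X1_def sum_distrib_left sum_subtractf[symmetric] sum.distrib[symmetric]
  proof (rule sum.cong[OF refl])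
    fix j assume "j \<in> {lo..\<nu>}"
    then have "j \<in> {1..n}" using window by auto
    then show "y \<omega> (j - 1) * y \<omega> j - S z0 * (y \<omega> (j - 1))\<^sup>2 = (s j - S z0) * (y \<omega> (j - 1))\<^sup>2 + y \<omega> (j - 1) * \<omega> j"
      by (subst (2) y_rec) (auto simp: algebra_simps power2_eq_square)
  qed
  moreover have "\<bar>\<Sum>j=lo..\<nu>. (s j - S z0) * (y \<omega> (j - 1))\<^sup>2\<bar> \<le> (\<Sum>j=lo..\<nu>. L * h * (y \<omega> (j - 1))\<^sup>2)"
    using window by (intro order_trans[OF sum_abs sum_mono]) (auto simp: abs_mult intro!: mult_right_mono s_close)
  moreover have "(\<Sum>j=lo..\<nu>. L * h * (y \<omega> (j - 1))\<^sup>2) = L * h * A1 \<omega>" by (simp add: A1_eq sum_distrib_left)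
  ultimately have "\<bar>(\<Sum>j=lo..\<nu>. y \<omega> (j - 1) * y \<omega> j) - S z0 * A1 \<omega>\<bar> \<le> L * h * A1 \<omega> + \<bar>X1 \<omega>\<bar>" by linarith
  also have "\<dots> \<le> c * e / 2 * A1 \<omega> + c * e / 2 * A1 \<omega>"
  proof (intro add_mono)
    \<comment> \<open>The constant 32 in \<open>small\<close> is chosen for this: \<epsilon> e / 32
      is half of c e.\<close>
    show "L * h * A1 \<omega> \<le> c * e / 2 * A1 \<omega>" using small A1p by (intro mult_right_mono) (auto simp: c_def)
    have "c * e / 2 * (E / 2) \<le> c * e / 2 * A1 \<omega>" using A1 eps e_pos by (intro mult_left_mono) (auto simp: c_def)
    then show "\<bar>X1 \<omega>\<bar> \<le> c * e / 2 * A1 \<omega>" using True by linarith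
  qed
  also have "\<dots> = c * e * A1 \<omega>" by simp
  finally have le: "\<bar>(\<Sum>j=lo..\<nu>. y \<omega> (j - 1) * y \<omega> j) - S z0 * A1 \<omega>\<bar> \<le> c * e * A1 \<omega>" .
  have pe: "prelim_est n h \<alpha> z0 (y \<omega>) = (\<Sum>j=lo..\<nu>. y \<omega> (j - 1) * y \<omega> j) / A1 \<omega>"
    unfolding prelim_est_def Let_def \<nu>_def[symmetric] num ..
  have "prelim_est n h \<alpha> z0 (y \<omega>) - S z0 = ((\<Sum>j=lo..\<nu>. y \<omega> (j - 1) * y \<omega> j) - S z0 * A1 \<omega>) / A1 \<omega>"
    unfolding pe using A1p by (simp add: diff_divide_distrib)
  then have "\<bar>prelim_est n h \<alpha> z0 (y \<omega>) - S z0\<bar> \<le> c * e"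
    using le A1p by (simp add: pos_divide_le_eq)
  moreover have "\<bar>St \<omega> - S z0\<bar> \<le> \<bar>prelim_est n h \<alpha> z0 (y \<omega>) - S z0\<bar>"
    unfolding trunc_est_def using S0 by (intro clip_dist_le) auto
  ultimately show ?thesis by linarith
next
  case False
  have Ep: "0 < E" using E_ge by simp
  have cE: "0 < c * e * E" using Ep eps e_pos by (simp add: c_def)
  have nn: "0 \<le> 8 / E\<^sup>2 * ((M1 \<omega>)\<^sup>2 + (y \<omega> \<nu>) ^ 4)" "0 \<le> 256 / (c * e * E) ^ 4 * (X1 \<omega>) ^ 4" by auto
  from False consider "E / 2 < \<bar>M1 \<omega>\<bar> + (y \<omega> \<nu>)\<^sup>2" | "c * e / 2 * (E / 2) < \<bar>X1 \<omega>\<bar>" by linarith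
  then show ?thesis
  proof cases
    case 1
    have "(E / 2)\<^sup>2 \<le> (\<bar>M1 \<omega>\<bar> + (y \<omega> \<nu>)\<^sup>2)\<^sup>2" using 1 Ep by (intro power_mono) auto
    also have "\<dots> \<le> 2 * \<bar>M1 \<omega>\<bar>\<^sup>2 + 2 * ((y \<omega> \<nu>)\<^sup>2)\<^sup>2"
      using sum_squares_bound[of "\<bar>M1 \<omega>\<bar>" "(y \<omega> \<nu>)\<^sup>2"] by (simp add: power2_sum)
    finally have "E\<^sup>2 \<le> 8 * ((M1 \<omega>)\<^sup>2 + (y \<omega> \<nu>) ^ 4)" by (simp add: power_divide)
    then have "1 \<le> 8 / E\<^sup>2 * ((M1 \<omega>)\<^sup>2 + (y \<omega> \<nu>) ^ 4)" using Ep by (simp add: pos_le_divide_eq)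
    then show ?thesis using nn unfolding \<Psi>_def by linarith
  next
    case 2
    have "(c * e * E / 4) ^ 4 \<le> \<bar>X1 \<omega>\<bar> ^ 4" using 2 cE by (intro power_mono) auto
    then have "(c * e * E) ^ 4 \<le> 256 * (X1 \<omega>) ^ 4" by (simp add: power_divide)
    then have "1 \<le> 256 / (c * e * E) ^ 4 * (X1 \<omega>) ^ 4"
      using zero_less_power[OF cE, of 4] by (simp only: times_divide_eq_left pos_le_divide_eq mult_1)
    then show ?thesis using nn unfolding \<Psi>_def by linarith
  qed
qed

lemma good_gamma:
  assumes "\<bar>St \<omega> - S z0\<bar> \<le> c * e"
  shows "\<bar>(1 - (St \<omega>)\<^sup>2) - \<gamma>\<bar> \<le> 2 * c * e"
proof -
  have "\<bar>St \<omega> + S z0\<bar> \<le> 2" using St_bounds(1)[of \<omega>] S0 eps by linarith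
  then have "\<bar>St \<omega> + S z0\<bar> * \<bar>St \<omega> - S z0\<bar> \<le> 2 * (c * e)" using assms by (intro mult_mono) auto
  then show ?thesis unfolding \<gamma>_def by (simp add: power2_eq_square abs_mult[symmetric] algebra_simps abs_minus_commute)
qed

text \<open>With a precise preliminary estimate, missing the threshold means that the slack of order
  E between A_n and H has been used up by the fluctuation |M2| + y_hi^2.\<close>

lemma hit_good:
  assumes "A2 \<omega> < H \<omega>"
  shows "1 \<le> \<Psi> \<omega> + 18 / (\<epsilon> * E)\<^sup>2 * ((M2 \<omega>)\<^sup>2 + (y \<omega> hi) ^ 4)"
proof -
  have nn: "0 \<le> 18 / (\<epsilon> * E)\<^sup>2 * ((M2 \<omega>)\<^sup>2 + (y \<omega> hi) ^ 4)" by simp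
  have eE: "0 < \<epsilon> * E" using E_ge by simp
  show ?thesis
  proof (cases "1 \<le> \<Psi> \<omega>")
    case True
    then show ?thesis using nn by linarith
  next
    case False
    let ?g = "1 - (St \<omega>)\<^sup>2" and ?Dv = "\<bar>M2 \<omega>\<bar> + (y \<omega> hi)\<^sup>2"
    have g: "\<bar>?g - \<gamma>\<bar> \<le> 2 * c * e" using prelim_good[of \<omega>] False good_gamma by auto
    have gp: "0 < ?g" using St_bounds(2)[of \<omega>] eps by simp
    have ph: "0 < \<gamma> + 2 * L * h" using gamma L h by (intro add_pos_pos) auto
    have "(\<gamma> + 2 * L * h) * A2 \<omega> \<ge> 2 * NH - E - 3 - ?Dv"
      using A2_identity_bounds[of \<omega>] window(7) zero_le_power2[of "y \<omega> \<nu>"] unfolding distrib_right by linarith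
    moreover have "(\<gamma> + 2 * L * h) * A2 \<omega> < (\<gamma> + 2 * L * h) * H \<omega>" using assms ph by (intro mult_strict_left_mono)
    ultimately have "2 * NH - E - 3 - ?Dv < (\<gamma> + 2 * L * h) * H \<omega>" by linarith
    then have "(2 * NH - E - 3 - ?Dv) * ?g < (\<gamma> + 2 * L * h) * H \<omega> * ?g" using gp by (intro mult_strict_right_mono)
    also have "\<dots> = (\<gamma> + 2 * L * h) * (2 * (1 - e) * NH)" using H_mult[of \<omega>] by (simp add: mult.assoc)
    finally have k: "(2 * NH - E - 3 - ?Dv) * ?g < (\<gamma> + 2 * L * h) * (2 * (1 - e) * NH)" .
    have k1: "2 * NH * (\<gamma> - 2 * c * e) \<le> 2 * NH * ?g" using g NH_pos by (intro mult_left_mono) auto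
    have k3: "(3 + ?Dv) * ?g \<le> 3 + ?Dv" using gp by (intro mult_left_le) auto
    have k2: "E * ?g \<le> E * (\<gamma> + 2 * c * e)" using g E_ge by (intro mult_left_mono) auto
    have k4: "(\<gamma> + 2 * L * h) * (2 * (1 - e) * NH) \<le> 2 * \<gamma> * NH - 2 * \<gamma> * E + 4 * (L * h * NH)"
    proof -
      have "(\<gamma> + 2 * L * h) * (2 * (1 - e) * NH) = 2 * \<gamma> * NH - 2 * \<gamma> * E + 4 * (L * h * NH) - 4 * (L * h * (e * NH))"
        by (simp add: E_def algebra_simps)
      moreover have "0 \<le> L * h * (e * NH)" using L h e_pos NH_pos by simp
      ultimately show ?thesis by linarith
    qed
    have LhN: "L * h * NH \<le> \<epsilon> * E / 32" using mult_right_mono[OF small less_imp_le[OF NH_pos]] by (simp add: E_def)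
    have ce: "2 * c * e * (2 * NH) = \<epsilon> * E / 4" by (simp add: c_def E_def)
    have cE: "2 * c * e * E \<le> \<epsilon> * E / 16"
    proof -
      have "e * (\<epsilon> * E) \<le> 1/2 * (\<epsilon> * E)" using e_le eE by (intro mult_right_mono) auto
      then show ?thesis by (simp add: c_def algebra_simps)
    qed
    have gE: "\<epsilon> * E \<le> \<gamma> * E" using gamma E_ge by (intro mult_right_mono) auto
    have ex1: "(2 * NH - E - 3 - ?Dv) * ?g = 2 * NH * ?g - E * ?g - (3 + ?Dv) * ?g" by (simp add: algebra_simps)
    have ex2: "2 * NH * (\<gamma> - 2 * c * e) = 2 * \<gamma> * NH - 2 * c * e * (2 * NH)" by (simp add: algebra_simps)
    have ex3: "E * (\<gamma> + 2 * c * e) = \<gamma> * E + 2 * c * e * E" by (simp add: algebra_simps)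
    \<comment> \<open>Of the slack \<epsilon> E, the errors of the preliminary estimate take 1/4 +
      1/16, the drift of S takes 1/8, and the rounding constant 3 at most 3/40; more than a third
      remains.\<close>
    have "\<epsilon> * E / 3 < ?Dv"
      using k k1 k2 k3 k4 LhN ce cE gE E_ge(1) unfolding ex1 ex2 ex3 by linarith
    then have "(\<epsilon> * E / 3)\<^sup>2 \<le> ?Dv\<^sup>2" using eE by (intro power_mono) auto
    also have "\<dots> \<le> 2 * \<bar>M2 \<omega>\<bar>\<^sup>2 + 2 * ((y \<omega> hi)\<^sup>2)\<^sup>2"
      using sum_squares_bound[of "\<bar>M2 \<omega>\<bar>" "(y \<omega> hi)\<^sup>2"] by (simp add: power2_sum)
    finally have "(\<epsilon> * E)\<^sup>2 \<le> 18 * ((M2 \<omega>)\<^sup>2 + (y \<omega> hi) ^ 4)"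
      using zero_le_power2[of "M2 \<omega>"] zero_le_even_power[of 4 "y \<omega> hi"] by (simp add: power_divide)
    then have "1 \<le> 18 / (\<epsilon> * E)\<^sup>2 * ((M2 \<omega>)\<^sup>2 + (y \<omega> hi) ^ 4)"
      using zero_less_power[OF eE, of 2] by (simp only: times_divide_eq_left pos_le_divide_eq mult_1)
    then show ?thesis using Psi_nonneg[of \<omega>] by linarith
  qed
qed

text \<open>The overshoot is multiplied by L h / p in the error, so its slack part may be as large
  as E. A bad preliminary estimate is covered by 2 n h \<Psi>, since the left side never exceeds
  \<gamma> A_n.\<close>

lemma excess_le:
  "\<gamma> * max 0 (A2 \<omega> - H \<omega>) \<le> \<bar>M2 \<omega>\<bar> + (y \<omega> \<nu>)\<^sup>2 + 2 * L * h * A2 \<omega> + 4 * E + 2 * NH * \<Psi> \<omega>"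
proof -
  have A2: "0 \<le> A2 \<omega>" by (rule Asum_nonneg)
  have nn: "0 \<le> \<bar>M2 \<omega>\<bar> + (y \<omega> \<nu>)\<^sup>2 + 2 * L * h * A2 \<omega> + 4 * E + 2 * NH * \<Psi> \<omega>"
    using A2 L h E_ge NH_pos Psi_nonneg[of \<omega>] by simp
  have g0: "0 \<le> 2 * NH * \<Psi> \<omega>" using NH_pos Psi_nonneg[of \<omega>] by simp
  have up: "\<gamma> * A2 \<omega> \<le> 2 * NH + \<bar>M2 \<omega>\<bar> + (y \<omega> \<nu>)\<^sup>2 + 2 * L * h * A2 \<omega>"
    using A2_identity_bounds[of \<omega>] window(8) zero_le_power2[of "y \<omega> hi"] by linarith
  have "2 * NH \<le> \<gamma> * H \<omega> + 4 * E + 2 * NH * \<Psi> \<omega>"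
  proof (cases "1 \<le> \<Psi> \<omega>")
    case True
    have "2 * NH * 1 \<le> 2 * NH * \<Psi> \<omega>" using True NH_pos by (intro mult_left_mono) auto
    moreover have "0 \<le> \<gamma> * H \<omega>" using gamma H_pos[of \<omega>] by simp
    ultimately show ?thesis using E_ge by linarith
  next
    case False
    let ?g = "1 - (St \<omega>)\<^sup>2"
    have g: "\<bar>?g - \<gamma>\<bar> \<le> 2 * c * e" using prelim_good[of \<omega>] False good_gamma by auto
    have gp: "0 < ?g" using St_bounds(2)[of \<omega>] eps by simp
    have ge: "2 * c * e \<le> \<gamma> * e"
    proof -
      have "2 * c * e \<le> \<epsilon> * e" using eps e_pos by (simp add: c_def)
      also have "\<dots> \<le> \<gamma> * e" using gamma e_pos by (intro mult_right_mono) auto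
      finally show ?thesis .
    qed
    have "?g \<le> \<gamma> * (1 + e)" using g ge by (simp add: distrib_left)
    then have "?g * H \<omega> \<le> \<gamma> * (1 + e) * H \<omega>" using H_pos[of \<omega>] by (intro mult_right_mono) auto
    then have 1: "2 * (1 - e) * NH \<le> (1 + e) * (\<gamma> * H \<omega>)" using H_mult[of \<omega>] by (simp add: mult_ac)
    have "(1 + e) * (2 * NH - 4 * E) \<le> 2 * (1 - e) * NH"
    proof -
      have "(1 + e) * (2 * NH - 4 * E) = 2 * (1 - e) * NH - 4 * (e * E)" by (simp add: E_def algebra_simps)
      moreover have "0 \<le> e * E" using e_pos E_ge by simp
      ultimately show ?thesis by linarith
    qed
    then have "(1 + e) * (2 * NH - 4 * E) \<le> (1 + e) * (\<gamma> * H \<omega>)" using 1 by linarith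
    then have "2 * NH - 4 * E \<le> \<gamma> * H \<omega>" using e_pos by simp
    then show ?thesis using g0 by linarith
  qed
  then have "\<gamma> * (A2 \<omega> - H \<omega>) \<le> \<bar>M2 \<omega>\<bar> + (y \<omega> \<nu>)\<^sup>2 + 2 * L * h * A2 \<omega> + 4 * E + 2 * NH * \<Psi> \<omega>"
    using up unfolding right_diff_distrib by linarith
  then show ?thesis using nn by (auto simp: max_def)
qed

text \<open>The variance budget: the squared capped weights sum to at most H, and rescaling
  multiplies them by n h / (\<gamma> H^2).\<close>

definition r where "r \<omega> = NH / (\<gamma> * H \<omega>)"

lemma r_nonneg: "0 \<le> r \<omega>"
  using NH_pos gamma H_pos[of \<omega>] by (simp add: r_def)

text \<open>A precise preliminary estimate puts \<gamma> H within a factor 1 + e of its target from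
  below. Otherwise H \<ge> n h and \<gamma> \<ge> \<epsilon> give the crude bound 1 / \<epsilon>,
  paid for by \<Psi>.\<close>

lemma sqrt_r_le: "sqrt (r \<omega>) \<le> sqrt ((1 + e) / (2 * (1 - e))) + 1 / \<epsilon> * \<Psi> \<omega>"
proof -
  have r0: "0 \<le> r \<omega>" by (rule r_nonneg)
  have p0: "0 \<le> 1 / \<epsilon> * \<Psi> \<omega>" using eps Psi_nonneg[of \<omega>] by simp
  show ?thesis
  proof (cases "1 \<le> \<Psi> \<omega>")
    case True
    have "NH * 1 \<le> H \<omega> * (\<gamma> / \<epsilon>)" using H_ge[of \<omega>] gamma eps H_pos[of \<omega>] by (intro mult_mono) auto
    then have "NH \<le> 1 / \<epsilon> * (\<gamma> * H \<omega>)" by (simp add: mult_ac)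
    then have "r \<omega> \<le> 1 / \<epsilon>" unfolding r_def using gamma H_pos[of \<omega>] by (subst pos_divide_le_eq) auto
    also have "\<dots> \<le> (1 / \<epsilon>)\<^sup>2" using eps by (intro self_le_power) auto
    finally have "sqrt (r \<omega>) \<le> 1 / \<epsilon>" using eps by (intro real_le_lsqrt) auto
    also have "\<dots> \<le> 1 / \<epsilon> * \<Psi> \<omega>" using True eps by (simp add: divide_right_mono)
    finally show ?thesis using e_pos e_le by (simp add: add_increasing)
  next
    case False
    let ?g = "1 - (St \<omega>)\<^sup>2"
    have g: "\<bar>?g - \<gamma>\<bar> \<le> 2 * c * e" using prelim_good[of \<omega>] False good_gamma by auto
    have ge: "2 * c * e \<le> \<gamma> * e"
    proof -
      have "2 * c * e \<le> \<epsilon> * e" using eps e_pos by (simp add: c_def)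
      also have "\<dots> \<le> \<gamma> * e" using gamma e_pos by (intro mult_right_mono) auto
      finally show ?thesis .
    qed
    have gg: "?g \<le> \<gamma> * (1 + e)" using g ge by (simp add: distrib_left)
    have "NH * (2 * (1 - e)) = ?g * H \<omega>" using H_mult[of \<omega>] by (simp add: mult_ac)
    also have "\<dots> \<le> \<gamma> * (1 + e) * H \<omega>" using gg H_pos[of \<omega>] by (intro mult_right_mono) auto
    finally have "r \<omega> \<le> (1 + e) / (2 * (1 - e))"
      unfolding r_def using gamma H_pos[of \<omega>] e_le by (simp add: frac_le_eq pos_divide_le_eq pos_le_divide_eq mult_ac)
    then show ?thesis using p0 by (simp add: add_increasing2)
  qed
qed

end

text \<open>Replaces the passage from second to first moments by Cauchy-Schwarz; \<open>q\<close> is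
  taken of the order of the standard deviation.\<close>

lemma abs_le_sq_div: "0 < q \<Longrightarrow> \<bar>x::real\<bar> \<le> 1 / q * x\<^sup>2 + q"
proof -
  assume q: "0 < q"
  have "2 * \<bar>x\<bar> * q \<le> x\<^sup>2 + q\<^sup>2" using sum_squares_bound[of "\<bar>x\<bar>" q] by simp
  moreover have "0 \<le> \<bar>x\<bar> * q" using q by simp
  ultimately have "\<bar>x\<bar> * q \<le> x\<^sup>2 + q\<^sup>2" by linarith
  then show ?thesis using q by (simp add: field_simps power2_eq_square)
qed

section \<open>Rescaled weights, decomposition of the error and moments of its parts\<close>

context seq_model
begin

definition wt where "wt \<omega> j = capped_weight n h z0 \<nu> (H \<omega>) (y \<omega>) j"
definition a where "a j \<omega> = p / (sqrt \<gamma> * H \<omega>) * wt \<omega> j"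
definition B where "B \<omega> = (\<Sum>j=\<nu>+1..hi. (s j - S z0) * (y \<omega> (j - 1))\<^sup>2)"
definition Wsum where "Wsum = \<bar>\<Sum>j=\<nu>+1..hi. (s j - S z0)\<bar>"
definition Mw where "Mw \<omega> = (\<Sum>j=\<nu>+1..hi. (s j - S z0) * mdiff \<omega> j)"

lemma Asum_measurable [measurable]: "(\<lambda>\<omega>. Asum n h z0 (y \<omega>) k m) \<in> borel_measurable P"
  unfolding Asum_def by measurable

lemma H_measurable [measurable]: "(\<lambda>\<omega>. H \<omega>) \<in> borel_measurable P"
  unfolding threshold_def trunc_est_def prelim_est_def Let_def by measurable

lemma wt_measurable [measurable]: "(\<lambda>\<omega>. wt \<omega> j) \<in> borel_measurable P"
  unfolding wt_def capped_weight_def by measurable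

lemma a_measurable [measurable]: "a j \<in> borel_measurable P"
proof -
  have "(\<lambda>\<omega>. p / (sqrt \<gamma> * H \<omega>) * wt \<omega> j) \<in> borel_measurable P" by measurable
  then show ?thesis by (simp add: a_def[abs_def])
qed

lemma r_measurable [measurable]: "r \<in> borel_measurable P"
proof -
  have "(\<lambda>\<omega>. NH / (\<gamma> * H \<omega>)) \<in> borel_measurable P" by measurable
  then show ?thesis by (simp add: r_def[abs_def])
qed

lemma H_upd: "\<nu> + 1 \<le> k \<Longrightarrow> H (fun_upd \<omega> k t) = H \<omega>"
  by (rule threshold_cong) (simp add: \<nu>_def)

lemma past_r: "past (\<nu> + 1) r"
  unfolding past_def r_def using H_upd by auto

lemma past_a: "j \<in> {\<nu>+1..n} \<Longrightarrow> past j (a j)"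
  unfolding past_def
proof (intro allI impI)
  fix \<omega> k t assume j: "j \<in> {\<nu>+1..n}" and k: "j \<le> k"
  have "wt (fun_upd \<omega> k t) j = wt \<omega> j"
    unfolding wt_def using j k by (subst H_upd) (auto intro!: capped_weight_cong)
  then show "a j (fun_upd \<omega> k t) = a j \<omega>"
    using H_upd[of k \<omega> t] j k by (simp add: a_def)
qed

lemma sqrt_gamma_pos: "0 < sqrt \<gamma>" using gamma by simp

lemma a_sum_sq: "(\<Sum>j=\<nu>+1..n. (a j \<omega>)\<^sup>2) \<le> r \<omega>"
proof -
  have "(\<Sum>j=\<nu>+1..n. (wt \<omega> j)\<^sup>2) \<le> (\<Sum>j=\<nu>+1..n. wt \<omega> j * y \<omega> (j - 1))"
    unfolding wt_def by (rule sum_mono, rule capped_weight(4)) (use H_pos[of \<omega>] in auto)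
  also have "\<dots> \<le> H \<omega>"
    unfolding wt_def using window H_pos[of \<omega>] by (subst sum_capped_weight) auto
  finally have le: "(\<Sum>j=\<nu>+1..n. (wt \<omega> j)\<^sup>2) \<le> H \<omega>" .
  have "(\<Sum>j=\<nu>+1..n. (a j \<omega>)\<^sup>2) = NH / (\<gamma> * (H \<omega>)\<^sup>2) * (\<Sum>j=\<nu>+1..n. (wt \<omega> j)\<^sup>2)"
    unfolding a_def using gamma by (simp add: power_mult_distrib power_divide sum_distrib_left p_sq)
  also have "\<dots> \<le> NH / (\<gamma> * (H \<omega>)\<^sup>2) * H \<omega>"
    using le NH_pos gamma by (intro mult_left_mono) auto
  also have "\<dots> = r \<omega>" using H_pos[of \<omega>] by (simp add: r_def power2_eq_square)
  finally show ?thesis .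
qed

text \<open>The Lyapunov condition: at most 2 n h = 2 p^2 terms of order p^(-3) leave a total of
  order 1 / p.\<close>

lemma a_cube: "j \<in> {\<nu>+1..n} \<Longrightarrow> \<bar>a j \<omega>\<bar> ^ 3 \<le> 1 / (\<epsilon> ^ 3 * p ^ 3) * (kweight n h z0 j * \<bar>y \<omega> (j - 1)\<bar> ^ 3)"
proof -
  assume j: "j \<in> {\<nu>+1..n}"
  have w: "\<bar>wt \<omega> j\<bar> \<le> kweight n h z0 j * \<bar>y \<omega> (j - 1)\<bar>"
    unfolding wt_def using j H_pos[of \<omega>] by (intro capped_weight(5)) auto
  have "p / (sqrt \<gamma> * H \<omega>) \<le> p / (\<epsilon> * NH)"
  proof (intro divide_left_mono mult_mono mult_pos_pos)
    have "\<epsilon> \<le> sqrt \<epsilon>" using eps by (intro real_le_rsqrt) (auto simp: power2_eq_square mult_left_le)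
    also have "\<dots> \<le> sqrt \<gamma>" using gamma by simp
    finally show "\<epsilon> \<le> sqrt \<gamma>" .
  qed (use p_pos H_ge NH_pos H_pos sqrt_gamma_pos gamma eps in \<open>auto simp: less_imp_le\<close>)
  also have "p / (\<epsilon> * NH) = 1 / (\<epsilon> * p)" using p_pos by (simp add: p_sq(1)[symmetric])
  finally have q: "p / (sqrt \<gamma> * H \<omega>) \<le> 1 / (\<epsilon> * p)" .
  have "\<bar>a j \<omega>\<bar> = p / (sqrt \<gamma> * H \<omega>) * \<bar>wt \<omega> j\<bar>"
    unfolding a_def using p_pos sqrt_gamma_pos H_pos[of \<omega>] by (simp add: abs_mult)
  also have "\<dots> \<le> 1 / (\<epsilon> * p) * (kweight n h z0 j * \<bar>y \<omega> (j - 1)\<bar>)"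
    using q w p_pos eps by (intro mult_mono) auto
  finally have "\<bar>a j \<omega>\<bar> ^ 3 \<le> (1 / (\<epsilon> * p) * (kweight n h z0 j * \<bar>y \<omega> (j - 1)\<bar>)) ^ 3"
    by (intro power_mono) auto
  also have "\<dots> = 1 / (\<epsilon> ^ 3 * p ^ 3) * (kweight n h z0 j * \<bar>y \<omega> (j - 1)\<bar> ^ 3)"
    using kweight_cases[of n h z0 j] by (auto simp: power_mult_distrib power_divide)
  finally show ?thesis .
qed

lemma error_pathwise:
  "p / sqrt \<gamma> * \<bar>seq_kernel_est n h \<alpha> \<epsilon> z0 (y \<omega>) - S z0\<bar> \<le>
     \<bar>\<Sum>j=\<nu>+1..n. a j \<omega> * \<omega> j\<bar>
   + (1 / (\<epsilon> * p) * \<bar>B \<omega>\<bar>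
   + (L * h / (\<epsilon> * p) * max 0 (A2 \<omega> - H \<omega>)
   + p / \<epsilon> * (\<Psi> \<omega> + 18 / (\<epsilon> * E)\<^sup>2 * ((M2 \<omega>)\<^sup>2 + (y \<omega> hi) ^ 4))))"
proof -
  let ?X = "\<Sum>j=\<nu>+1..n. wt \<omega> j * \<omega> j"
  let ?T = "\<Psi> \<omega> + 18 / (\<epsilon> * E)\<^sup>2 * ((M2 \<omega>)\<^sup>2 + (y \<omega> hi) ^ 4)"
  have T0: "0 \<le> ?T" using Psi_nonneg[of \<omega>] by simp
  have q: "0 < p / sqrt \<gamma>" using p_pos sqrt_gamma_pos by simp
  have eg: "\<epsilon> \<le> sqrt \<gamma>"
  proof -
    have "\<epsilon> \<le> sqrt \<epsilon>" using eps by (intro real_le_rsqrt) (auto simp: power2_eq_square mult_left_le)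
    also have "\<dots> \<le> sqrt \<gamma>" using gamma by simp
    finally show ?thesis .
  qed
  have q1: "p / sqrt \<gamma> \<le> p / \<epsilon>" using eg eps p_pos sqrt_gamma_pos by (intro divide_left_mono mult_pos_pos) auto
  have qH: "p / sqrt \<gamma> / H \<omega> \<le> 1 / (\<epsilon> * p)"
  proof -
    have "p / sqrt \<gamma> / H \<omega> \<le> p / \<epsilon> / NH"
      using H_ge[of \<omega>] NH_pos p_pos eps by (intro frac_le q1) auto
    also have "\<dots> = 1 / (\<epsilon> * p)" using p_pos by (simp add: p_sq(1)[symmetric])
    finally show ?thesis .
  qed
  have Beq: "(\<Sum>j=\<nu>+1..n. kweight n h z0 j * (s j - S z0) * (y \<omega> (j - 1))\<^sup>2) = B \<omega>"
    using sum_window2[of "\<lambda>j. (s j - S z0) * (y \<omega> (j - 1))\<^sup>2"] by (simp add: B_def mult.assoc)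
  have main: "\<bar>seq_kernel_est n h \<alpha> \<epsilon> z0 (y \<omega>) - S z0\<bar> \<le> \<bar>?X\<bar> / H \<omega> + \<bar>B \<omega>\<bar> / H \<omega>
      + L * h * max 0 (A2 \<omega> - H \<omega>) / H \<omega> + (if A2 \<omega> < H \<omega> then \<bar>S z0\<bar> else 0)"
    unfolding Beq[symmetric] wt_def \<nu>_def
  proof (rule seq_kernel_est_error)
    show "0 < H \<omega>" by (rule H_pos)
    show "nu_index n h \<alpha> z0 \<le> n" using window by (simp add: \<nu>_def[symmetric])
    show "0 \<le> L * h" using L h by simp
    show "y \<omega> j = s j * y \<omega> (j - 1) + \<omega> j" if "j \<in> {nu_index n h \<alpha> z0 + 1..n}" for j
      using that by (intro y_rec) auto
    show "\<bar>s j - S z0\<bar> \<le> L * h" if "kweight n h z0 j \<noteq> 0" for j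
      using that by (intro s_close) (auto simp: kweight_eq)
  qed
  \<comment> \<open>On the event that the threshold is missed, the error |S(z0)| is at most 1, hence
    at most the majorant of the indicator.\<close>
  have ind: "(if A2 \<omega> < H \<omega> then \<bar>S z0\<bar> else 0) \<le> ?T"
    using hit_good[of \<omega>] S0 eps T0 by auto
  have "p / sqrt \<gamma> * \<bar>seq_kernel_est n h \<alpha> \<epsilon> z0 (y \<omega>) - S z0\<bar> \<le>
     p / sqrt \<gamma> * (\<bar>?X\<bar> / H \<omega> + \<bar>B \<omega>\<bar> / H \<omega>
      + L * h * max 0 (A2 \<omega> - H \<omega>) / H \<omega> + ?T)"
    using q main ind by (intro mult_left_mono) auto
  also have "\<dots> = p / sqrt \<gamma> * (\<bar>?X\<bar> / H \<omega>) + (p / sqrt \<gamma> / H \<omega> * \<bar>B \<omega>\<bar>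
     + (p / sqrt \<gamma> / H \<omega> * (L * h * max 0 (A2 \<omega> - H \<omega>)) + p / sqrt \<gamma> * ?T))"
    by (simp add: distrib_left)
  also have "\<dots> \<le> p / sqrt \<gamma> * (\<bar>?X\<bar> / H \<omega>) + (1 / (\<epsilon> * p) * \<bar>B \<omega>\<bar>
     + (1 / (\<epsilon> * p) * (L * h * max 0 (A2 \<omega> - H \<omega>)) + p / \<epsilon> * ?T))"
    using qH q1 T0 L h by (intro add_left_mono add_mono mult_right_mono) auto
  also have "p / sqrt \<gamma> * (\<bar>?X\<bar> / H \<omega>) = \<bar>\<Sum>j=\<nu>+1..n. a j \<omega> * \<omega> j\<bar>"
  proof -
    have "(\<Sum>j=\<nu>+1..n. a j \<omega> * \<omega> j) = p / (sqrt \<gamma> * H \<omega>) * ?X"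
      by (simp add: a_def sum_distrib_left mult.assoc)
    then show ?thesis using p_pos sqrt_gamma_pos H_pos[of \<omega>] by (simp add: abs_mult)
  qed
  finally show ?thesis by simp
qed

text \<open>\<open>weighted_square_sum\<close> with weights s_j - S(z0): these are at most L h in
  absolute value and change by at most L / n per step. The sum of the weights, \<open>Wsum\<close>,
  is the only term in which mere smoothness is not enough and the weak Hoelder condition
  enters.\<close>

lemma bias_le:
  "\<bar>B \<omega>\<bar> \<le> 1 / \<epsilon> * (Wsum + (\<bar>Mw \<omega>\<bar> + (L * h * (y \<omega> hi)\<^sup>2 + (L * h * (y \<omega> \<nu>)\<^sup>2
     + (L / real n * (\<Sum>j=\<nu>+1..<hi. (y \<omega> j)\<^sup>2) + 2 * (L * h)\<^sup>2 * A2 \<omega>)))))"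
proof -
  let ?w = "\<lambda>j. s j - S z0"
  have win: "\<nu> + 1 \<le> hi" "hi \<le> n" "1 \<le> \<nu> + 1" using window by auto
  have id: "(\<Sum>j=\<nu>+1..hi. ?w j * (1 - (s j)\<^sup>2) * (y \<omega> (j - 1))\<^sup>2)
     = (\<Sum>j=\<nu>+1..hi. ?w j) + Mw \<omega>
       - (?w hi * (y \<omega> hi)\<^sup>2 - ?w (\<nu> + 1) * (y \<omega> \<nu>)\<^sup>2 + (\<Sum>j=\<nu>+1..<hi. (?w j - ?w (j + 1)) * (y \<omega> j)\<^sup>2))"
    using weighted_square_sum[OF win(3,1,2), of ?w \<omega>] by (simp add: Mw_def)
  \<comment> \<open>Freezing s_j at z0 in the factor 1 - s_j^2 produces a product of two small
    differences, hence an error quadratic in L h.\<close>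
  have eq: "\<gamma> * B \<omega> = (\<Sum>j=\<nu>+1..hi. ?w j * (1 - (s j)\<^sup>2) * (y \<omega> (j - 1))\<^sup>2)
     + (\<Sum>j=\<nu>+1..hi. ?w j * ((s j)\<^sup>2 - (S z0)\<^sup>2) * (y \<omega> (j - 1))\<^sup>2)"
    unfolding B_def \<gamma>_def sum_distrib_left by (simp add: sum.distrib[symmetric] algebra_simps)
  have Lh: "0 \<le> L * h" using L h by simp
  have 1: "\<bar>\<Sum>j=\<nu>+1..hi. ?w j * ((s j)\<^sup>2 - (S z0)\<^sup>2) * (y \<omega> (j - 1))\<^sup>2\<bar> \<le> 2 * (L * h)\<^sup>2 * A2 \<omega>"
    unfolding A2_eq sum_distrib_left
  proof (rule order_trans[OF sum_abs sum_mono])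
    fix j assume "j \<in> {\<nu>+1..hi}"
    then have j: "j \<in> {lo..hi}" using window by auto
    have "\<bar>?w j\<bar> * \<bar>(s j)\<^sup>2 - (S z0)\<^sup>2\<bar> \<le> (L * h) * (2 * L * h)"
      using s_close[OF j] sq_close[OF j] Lh by (intro mult_mono) auto
    then have "\<bar>?w j\<bar> * \<bar>(s j)\<^sup>2 - (S z0)\<^sup>2\<bar> * (y \<omega> (j - 1))\<^sup>2 \<le> (L * h) * (2 * L * h) * (y \<omega> (j - 1))\<^sup>2"
      by (intro mult_right_mono) auto
    moreover have "\<bar>?w j * ((s j)\<^sup>2 - (S z0)\<^sup>2) * (y \<omega> (j - 1))\<^sup>2\<bar> = \<bar>?w j\<bar> * \<bar>(s j)\<^sup>2 - (S z0)\<^sup>2\<bar> * (y \<omega> (j - 1))\<^sup>2"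
      by (simp add: abs_mult)
    moreover have "(L * h) * (2 * L * h) = 2 * (L * h)\<^sup>2" by (simp add: power2_eq_square)
    ultimately show "\<bar>?w j * ((s j)\<^sup>2 - (S z0)\<^sup>2) * (y \<omega> (j - 1))\<^sup>2\<bar> \<le> 2 * (L * h)\<^sup>2 * (y \<omega> (j - 1))\<^sup>2"
      by simp
  qed
  have 2: "\<bar>\<Sum>j=\<nu>+1..<hi. (?w j - ?w (j + 1)) * (y \<omega> j)\<^sup>2\<bar> \<le> L / real n * (\<Sum>j=\<nu>+1..<hi. (y \<omega> j)\<^sup>2)"
    unfolding sum_distrib_left
  proof (rule order_trans[OF sum_abs sum_mono])
    fix j assume j: "j \<in> {\<nu>+1..<hi}"
    have u: "real j / real n \<in> {0..1}" "real (j + 1) / real n \<in> {0..1}" using j hi_le n_pos by (auto simp: field_simps)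
    have "\<bar>real j / real n - real (j + 1) / real n\<bar> = 1 / real n" using n_pos by (simp add: diff_divide_distrib[symmetric])
    then have "\<bar>?w j - ?w (j + 1)\<bar> \<le> L / real n"
      using lip[OF u] by (simp add: s_def)
    then show "\<bar>(?w j - ?w (j + 1)) * (y \<omega> j)\<^sup>2\<bar> \<le> L / real n * (y \<omega> j)\<^sup>2"
      using mult_right_mono[of _ _ "(y \<omega> j)\<^sup>2"] by (fastforce simp: abs_mult)
  qed
  have 3: "\<bar>?w hi * (y \<omega> hi)\<^sup>2\<bar> \<le> L * h * (y \<omega> hi)\<^sup>2" "\<bar>?w (\<nu> + 1) * (y \<omega> \<nu>)\<^sup>2\<bar> \<le> L * h * (y \<omega> \<nu>)\<^sup>2"
    using window by (auto simp: abs_mult intro!: mult_right_mono s_close)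
  have le: "\<bar>\<gamma> * B \<omega>\<bar> \<le> Wsum + (\<bar>Mw \<omega>\<bar> + (L * h * (y \<omega> hi)\<^sup>2 + (L * h * (y \<omega> \<nu>)\<^sup>2
     + (L / real n * (\<Sum>j=\<nu>+1..<hi. (y \<omega> j)\<^sup>2) + 2 * (L * h)\<^sup>2 * A2 \<omega>))))"
    unfolding eq id Wsum_def using 1 2 3 by linarith
  have "\<epsilon> * \<bar>B \<omega>\<bar> \<le> \<gamma> * \<bar>B \<omega>\<bar>" using gamma by (intro mult_right_mono) auto
  also have "\<dots> = \<bar>\<gamma> * B \<omega>\<bar>" using gamma by (simp add: abs_mult)
  also note le
  finally show ?thesis using eps by (simp add: pos_le_divide_eq mult.commute)
qed

definition K2 where "K2 = 8 * C4 + 2 * m4"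
definition K4 where "K4 = exp 8 * (16 * m4 * C4)"

lemma K_nonneg: "0 \<le> K2" "0 \<le> K4" "0 \<le> C4" "0 \<le> m4"
  using C4_ge1 one_le_m4 by (auto simp: K2_def K4_def)

lemma M_measurable [measurable]:
  "M1 \<in> borel_measurable P" "M2 \<in> borel_measurable P" "X1 \<in> borel_measurable P" "Mw \<in> borel_measurable P"
  unfolding M1_def[abs_def] M2_def[abs_def] X1_def[abs_def] Mw_def[abs_def] using window
  by (auto intro!: borel_measurable_sum borel_measurable_times mdiff_measurable measurable_coord)

lemma Psi_measurable [measurable]: "\<Psi> \<in> borel_measurable P"
proof -
  have "(\<lambda>\<omega>. 8 / E\<^sup>2 * ((M1 \<omega>)\<^sup>2 + (y \<omega> \<nu>) ^ 4) + 256 / (c * e * E) ^ 4 * (X1 \<omega>) ^ 4) \<in> borel_measurable P"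
    by measurable
  then show ?thesis by (simp add: \<Psi>_def[abs_def])
qed

lemma B_measurable [measurable]: "B \<in> borel_measurable P"
  unfolding B_def[abs_def] by measurable

lemma EB_M1: "EB (\<lambda>\<omega>. (M1 \<omega>)\<^sup>2) (4 * E * K2)"
proof -
  have "EB (\<lambda>\<omega>. (\<Sum>j=lo..\<nu>. 1 * mdiff \<omega> j)\<^sup>2) (real (\<nu> + 1 - lo) * (1\<^sup>2 * (8 * C4 + 2 * m4)))"
    using window by (intro EB_quadratic_martingale) auto
  then have "EB (\<lambda>\<omega>. (M1 \<omega>)\<^sup>2) (real (\<nu> + 1 - lo) * K2)" by (simp add: M1_def K2_def)
  then show ?thesis by (rule EB_mono) (use window K_nonneg in \<open>auto intro!: mult_right_mono\<close>)
qed

lemma EB_M2: "EB (\<lambda>\<omega>. (M2 \<omega>)\<^sup>2) (2 * NH * K2)"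
proof -
  have "EB (\<lambda>\<omega>. (\<Sum>j=\<nu>+1..hi. 1 * mdiff \<omega> j)\<^sup>2) (real (hi + 1 - (\<nu> + 1)) * (1\<^sup>2 * (8 * C4 + 2 * m4)))"
    using window by (intro EB_quadratic_martingale) auto
  then have "EB (\<lambda>\<omega>. (M2 \<omega>)\<^sup>2) (real (hi - \<nu>) * K2)" by (simp add: M2_def K2_def)
  then show ?thesis by (rule EB_mono) (use window K_nonneg in \<open>auto intro!: mult_right_mono\<close>)
qed

lemma EB_Mw: "EB (\<lambda>\<omega>. (Mw \<omega>)\<^sup>2) (2 * NH * ((L * h)\<^sup>2 * K2))"
proof -
  have "EB (\<lambda>\<omega>. (\<Sum>j=\<nu>+1..hi. (s j - S z0) * mdiff \<omega> j)\<^sup>2) (real (hi + 1 - (\<nu> + 1)) * ((L * h)\<^sup>2 * (8 * C4 + 2 * m4)))"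
    using window by (intro EB_quadratic_martingale s_close) auto
  then have "EB (\<lambda>\<omega>. (Mw \<omega>)\<^sup>2) (real (hi - \<nu>) * ((L * h)\<^sup>2 * K2))" by (simp add: Mw_def K2_def)
  then show ?thesis by (rule EB_mono) (use window K_nonneg in \<open>auto intro!: mult_right_mono\<close>)
qed

lemma EB_X1: "EB (\<lambda>\<omega>. (X1 \<omega>) ^ 4) (K4 * (4 * E)\<^sup>2)"
proof -
  have "EB (\<lambda>\<omega>. (\<Sum>j=lo..\<nu>. y \<omega> (j - 1) * \<omega> j) ^ 4) (exp 8 * (16 * m4 * C4) * (real (\<nu> + 1 - lo))\<^sup>2)"
    using window by (intro EB_linear_martingale) auto
  then have "EB (\<lambda>\<omega>. (X1 \<omega>) ^ 4) (K4 * (real (\<nu> + 1 - lo))\<^sup>2)" by (simp add: X1_def K4_def)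
  then show ?thesis
  proof (rule EB_mono)
    show "K4 * (real (\<nu> + 1 - lo))\<^sup>2 \<le> K4 * (4 * E)\<^sup>2"
      by (intro mult_left_mono power_mono window K_nonneg) simp
  qed auto
qed

lemma EB_abs_M2: "EB (\<lambda>\<omega>. \<bar>M2 \<omega>\<bar>) (2 * p * K2 + p)"
proof -
  have "EB (\<lambda>\<omega>. 1 / p * (M2 \<omega>)\<^sup>2 + p) (1 / p * (2 * NH * K2) + p)"
    using p_pos by (intro EB_add EB_cmult EB_M2 EB_const) auto
  then show ?thesis
    by (rule EB_mono) (use p_pos p_sq(1)[symmetric] abs_le_sq_div in \<open>auto\<close>)
qed

lemma EB_abs_Mw: "EB (\<lambda>\<omega>. \<bar>Mw \<omega>\<bar>) (2 * p * h * L\<^sup>2 * K2 + h * p)"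
proof -
  have hp: "0 < h * p" using p_pos h by simp
  have "EB (\<lambda>\<omega>. 1 / (h * p) * (Mw \<omega>)\<^sup>2 + h * p) (1 / (h * p) * (2 * NH * ((L * h)\<^sup>2 * K2)) + h * p)"
    using hp by (intro EB_add EB_cmult EB_Mw EB_const) auto
  then show ?thesis
  proof (rule EB_mono)
    have "1 / (h * p) * (2 * NH * ((L * h)\<^sup>2 * K2)) = 2 * p * h * L\<^sup>2 * K2"
      using p_pos h by (simp add: p_sq(1)[symmetric] power2_eq_square)
    then show "1 / (h * p) * (2 * NH * ((L * h)\<^sup>2 * K2)) + h * p \<le> 2 * p * h * L\<^sup>2 * K2 + h * p" by simp
  qed (use hp abs_le_sq_div in \<open>auto\<close>)
qed

definition \<psi> where "\<psi> = 8 / E\<^sup>2 * (4 * E * K2 + C4) + 256 / (c * e * E) ^ 4 * (K4 * (4 * E)\<^sup>2)"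

lemma EB_Psi: "EB \<Psi> \<psi>"
proof -
  have "EB (\<lambda>\<omega>. 8 / E\<^sup>2 * ((M1 \<omega>)\<^sup>2 + (y \<omega> \<nu>) ^ 4) + 256 / (c * e * E) ^ 4 * (X1 \<omega>) ^ 4) \<psi>"
    unfolding \<psi>_def using window by (intro EB_add EB_cmult EB_M1 EB_y4 EB_X1) auto
  then show ?thesis by (simp add: \<Psi>_def[abs_def])
qed

lemma EB_A2: "EB (\<lambda>\<omega>. A2 \<omega>) (2 * NH * C4)"
proof -
  have "EB (\<lambda>\<omega>. A2 \<omega>) (\<Sum>j=\<nu>+1..hi. C4)"
    unfolding A2_eq using window by (intro EB_sum EB_y2) auto
  then show ?thesis
    by (rule EB_mono) (use window K_nonneg in \<open>auto intro!: mult_right_mono\<close>)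
qed

lemma EB_sum_y: "EB (\<lambda>\<omega>. \<Sum>j=\<nu>+1..<hi. (y \<omega> j)\<^sup>2) (2 * NH * C4)"
proof -
  have "EB (\<lambda>\<omega>. \<Sum>j=\<nu>+1..<hi. (y \<omega> j)\<^sup>2) (\<Sum>j=\<nu>+1..<hi. C4)"
    using window by (intro EB_sum EB_y2) auto
  then show ?thesis
  proof (rule EB_mono)
    have "real (hi - Suc \<nu>) \<le> 2 * NH" using window(8) by linarith
    then show "(\<Sum>j=\<nu>+1..<hi. C4) \<le> 2 * NH * C4" using K_nonneg by (simp add: mult_right_mono)
  qed auto
qed

lemma EB_bias: "EB (\<lambda>\<omega>. \<bar>B \<omega>\<bar>) (1 / \<epsilon> * (Wsum + ((2 * p * h * L\<^sup>2 * K2 + h * p) + (L * h * C4 + (L * h * C4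
     + (L / real n * (2 * NH * C4) + 2 * (L * h)\<^sup>2 * (2 * NH * C4)))))))"
proof (rule EB_mono[OF _ _ bias_le order_refl])
  show "EB (\<lambda>\<omega>. 1 / \<epsilon> * (Wsum + (\<bar>Mw \<omega>\<bar> + (L * h * (y \<omega> hi)\<^sup>2 + (L * h * (y \<omega> \<nu>)\<^sup>2
     + (L / real n * (\<Sum>j=\<nu>+1..<hi. (y \<omega> j)\<^sup>2) + 2 * (L * h)\<^sup>2 * A2 \<omega>))))))
    (1 / \<epsilon> * (Wsum + ((2 * p * h * L\<^sup>2 * K2 + h * p) + (L * h * C4 + (L * h * C4
     + (L / real n * (2 * NH * C4) + 2 * (L * h)\<^sup>2 * (2 * NH * C4)))))))"
    using eps L h window
    by (intro EB_cmult EB_add EB_const EB_abs_Mw EB_y2 EB_sum_y EB_A2) (auto simp: Wsum_def)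
qed measurable

lemma EB_excess: "EB (\<lambda>\<omega>. max 0 (A2 \<omega> - H \<omega>)) (1 / \<epsilon> * ((2 * p * K2 + p) + (C4 + (2 * L * h * (2 * NH * C4) + (4 * E + 2 * NH * \<psi>)))))"
proof (rule EB_mono)
  show "EB (\<lambda>\<omega>. 1 / \<epsilon> * (\<bar>M2 \<omega>\<bar> + ((y \<omega> \<nu>)\<^sup>2 + (2 * L * h * A2 \<omega> + (4 * E + 2 * NH * \<Psi> \<omega>)))))
     (1 / \<epsilon> * ((2 * p * K2 + p) + (C4 + (2 * L * h * (2 * NH * C4) + (4 * E + 2 * NH * \<psi>)))))"
    using eps L h window E_ge NH_pos
    by (intro EB_cmult EB_add EB_const EB_abs_M2 EB_y2 EB_A2 EB_Psi) auto
  show "max 0 (A2 \<omega> - H \<omega>) \<le> 1 / \<epsilon> * (\<bar>M2 \<omega>\<bar> + ((y \<omega> \<nu>)\<^sup>2 + (2 * L * h * A2 \<omega> + (4 * E + 2 * NH * \<Psi> \<omega>))))" for \<omega>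
  proof -
    have "\<epsilon> * max 0 (A2 \<omega> - H \<omega>) \<le> \<gamma> * max 0 (A2 \<omega> - H \<omega>)" using gamma by (intro mult_right_mono) auto
    also note excess_le[of \<omega>]
    finally have "\<epsilon> * max 0 (A2 \<omega> - H \<omega>) \<le> \<bar>M2 \<omega>\<bar> + ((y \<omega> \<nu>)\<^sup>2 + (2 * L * h * A2 \<omega> + (4 * E + 2 * NH * \<Psi> \<omega>)))"
      by (simp add: add.assoc)
    moreover have "m \<le> 1 / \<epsilon> * G" if "\<epsilon> * m \<le> G" for m G
      using that eps by (simp add: field_simps)
    ultimately show ?thesis by blast
  qed
qed auto

definition m1 :: real where "m1 = (\<integral>z. \<bar>z\<bar> \<partial>std_normal)"

lemma m1_nonneg: "0 \<le> m1"
  by (simp add: m1_def)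

lemma EB_martingale:
  assumes d: "0 < d"
  shows "EB (\<lambda>\<omega>. \<bar>\<Sum>j=\<nu>+1..n. a j \<omega> * \<omega> j\<bar>)
     (m1 * (sqrt ((1 + e) / (2 * (1 - e))) + 1 / \<epsilon> * \<psi>) + d + (5 + m4) / (2 * d\<^sup>2) * (2 * C4 / (\<epsilon> ^ 3 * p)))"
proof -
  let ?b = "\<lambda>j. 1 / (\<epsilon> ^ 3 * p ^ 3) * (kweight n h z0 j * C4)"
  let ?\<rho> = "sqrt ((1 + e) / (2 * (1 - e)))"
  have \<rho>: "0 \<le> ?\<rho>" using e_pos e_le by simp
  have "EB (\<lambda>\<omega>. \<bar>\<Sum>j=\<nu>+1..n. a j \<omega> * \<omega> j\<bar>)
     (m1 * (?\<rho> + 1 / \<epsilon> * \<psi>) + d + (5 + m4) / (2 * d\<^sup>2) * (\<Sum>j=\<nu>+1..n. ?b j))"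
  proof (rule EB_martingale_abs[OF d, where r = r])
    show "\<nu> \<le> n" using window by simp
    show "past j (a j)" if "j \<in> {\<nu>+1..n}" for j using that by (rule past_a)
    show "past (\<nu> + 1) r" by (rule past_r)
    show "(\<Sum>j=\<nu>+1..n. (a j \<omega>)\<^sup>2) \<le> r \<omega>" for \<omega> by (rule a_sum_sq)
    have "EB (\<lambda>\<omega>. m1 * (?\<rho> + 1 / \<epsilon> * \<Psi> \<omega>) + d) (m1 * (?\<rho> + 1 / \<epsilon> * \<psi>) + d)"
      using \<rho> eps d m1_nonneg by (intro EB_add EB_cmult EB_const EB_Psi) auto
    then show "EB (\<lambda>\<omega>. heat d (r \<omega>) 0) (m1 * (?\<rho> + 1 / \<epsilon> * \<psi>) + d)"
    proof (rule EB_mono)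
      show "(\<lambda>\<omega>. heat d (r \<omega>) 0) \<in> borel_measurable P"
      proof -
        have "(\<lambda>\<omega>. (r \<omega>, 0)) \<in> measurable P (borel \<Otimes>\<^sub>M borel)" by simp
        from measurable_compose[OF this heat_measurable[of d]] show ?thesis by simp
      qed
      fix \<omega>
      have "heat d (r \<omega>) 0 \<le> sqrt (r \<omega>) * m1 + d"
        unfolding m1_def by (rule heat_zero_le[OF d r_nonneg])
      also have "\<dots> \<le> (?\<rho> + 1 / \<epsilon> * \<Psi> \<omega>) * m1 + d"
        using sqrt_r_le[of \<omega>] m1_nonneg by (intro add_right_mono mult_right_mono) auto
      finally show "heat d (r \<omega>) 0 \<le> m1 * (?\<rho> + 1 / \<epsilon> * \<Psi> \<omega>) + d" by (simp add: mult.commute)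
    qed simp
    show "EB (\<lambda>\<omega>. \<bar>a j \<omega>\<bar> ^ 3) (?b j)" if j: "j \<in> {\<nu>+1..n}" for j
    proof (rule EB_mono[OF _ _ a_cube[OF j] order_refl])
      show "EB (\<lambda>\<omega>. 1 / (\<epsilon> ^ 3 * p ^ 3) * (kweight n h z0 j * \<bar>y \<omega> (j - 1)\<bar> ^ 3)) (?b j)"
        using j eps p_pos by (intro EB_cmult EB_y3) auto
    qed measurable
  qed measurable
  then show ?thesis
  proof (rule EB_mono)
    have "(\<Sum>j=\<nu>+1..n. ?b j) = 1 / (\<epsilon> ^ 3 * p ^ 3) * (\<Sum>j=\<nu>+1..n. kweight n h z0 j * C4)"
      by (simp add: sum_distrib_left)
    also have "(\<Sum>j=\<nu>+1..n. kweight n h z0 j * C4) = real (hi - \<nu>) * C4"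
      using sum_window2[of "\<lambda>_. C4"] by simp
    also have "1 / (\<epsilon> ^ 3 * p ^ 3) * (real (hi - \<nu>) * C4) \<le> 1 / (\<epsilon> ^ 3 * p ^ 3) * (2 * NH * C4)"
      using window K_nonneg eps p_pos by (intro mult_left_mono mult_right_mono) auto
    also have "\<dots> = 2 * C4 / (\<epsilon> ^ 3 * p)" using p_pos eps by (simp add: p_sq(1)[symmetric] field_simps power3_eq_cube)
    finally have "(\<Sum>j=\<nu>+1..n. ?b j) \<le> 2 * C4 / (\<epsilon> ^ 3 * p)" .
    then show "m1 * (?\<rho> + 1 / \<epsilon> * \<psi>) + d + (5 + m4) / (2 * d\<^sup>2) * (\<Sum>j=\<nu>+1..n. ?b j)
      \<le> m1 * (?\<rho> + 1 / \<epsilon> * \<psi>) + d + (5 + m4) / (2 * d\<^sup>2) * (2 * C4 / (\<epsilon> ^ 3 * p))"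
      using K_nonneg by (intro add_left_mono mult_left_mono) auto
  qed (use measurable_coord in measurable)
qed

lemma risk_bound:
  assumes d: "0 < d"
  shows "(\<integral>\<^sup>+\<omega>. ennreal (p / sqrt \<gamma> * \<bar>seq_kernel_est n h \<alpha> \<epsilon> z0 (y \<omega>) - S z0\<bar>) \<partial>P) \<le> ennreal
     ((m1 * (sqrt ((1 + e) / (2 * (1 - e))) + 1 / \<epsilon> * \<psi>) + d + (5 + m4) / (2 * d\<^sup>2) * (2 * C4 / (\<epsilon> ^ 3 * p)))
    + (1 / (\<epsilon> * p) * (1 / \<epsilon> * (Wsum + ((2 * p * h * L\<^sup>2 * K2 + h * p) + (L * h * C4 + (L * h * C4
     + (L / real n * (2 * NH * C4) + 2 * (L * h)\<^sup>2 * (2 * NH * C4)))))))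
    + (L * h / (\<epsilon> * p) * (1 / \<epsilon> * ((2 * p * K2 + p) + (C4 + (2 * L * h * (2 * NH * C4) + (4 * E + 2 * NH * \<psi>)))))
    + p / \<epsilon> * (\<psi> + 18 / (\<epsilon> * E)\<^sup>2 * (2 * NH * K2 + C4)))))" (is "_ \<le> ennreal ?R")
proof -
  have "EB (\<lambda>\<omega>. \<bar>\<Sum>j=\<nu>+1..n. a j \<omega> * \<omega> j\<bar>
   + (1 / (\<epsilon> * p) * \<bar>B \<omega>\<bar>
   + (L * h / (\<epsilon> * p) * max 0 (A2 \<omega> - H \<omega>)
   + p / \<epsilon> * (\<Psi> \<omega> + 18 / (\<epsilon> * E)\<^sup>2 * ((M2 \<omega>)\<^sup>2 + (y \<omega> hi) ^ 4))))) ?R"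
    using window p_pos eps L h
    by (intro EB_add EB_cmult EB_martingale[OF d] EB_bias EB_excess EB_Psi EB_M2 EB_y4) auto
  then have "(\<integral>\<^sup>+\<omega>. ennreal (\<bar>\<Sum>j=\<nu>+1..n. a j \<omega> * \<omega> j\<bar>
   + (1 / (\<epsilon> * p) * \<bar>B \<omega>\<bar>
   + (L * h / (\<epsilon> * p) * max 0 (A2 \<omega> - H \<omega>)
   + p / \<epsilon> * (\<Psi> \<omega> + 18 / (\<epsilon> * E)\<^sup>2 * ((M2 \<omega>)\<^sup>2 + (y \<omega> hi) ^ 4))))) \<partial>P) \<le> ennreal ?R"
    by (simp add: EB_def)
  then show ?thesis
    by (rule order_trans[rotated]) (intro nn_integral_mono ennreal_leI error_pathwise)
qed

end

section \<open>The deterministic bias as a Riemann sum\<close>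

context seq_model
begin

text \<open>The mean value theorem for the antiderivative of \<open>S (z0 + u h) - S z0\<close> compares the sum with
  \<open>n h\<close> times \<open>Omega\<close>.\<close>

lemma Wsum_le: "Wsum \<le> NH * \<bar>Omega h z0 S\<bar> + L * h * (5 + E)"
proof -
  define g where "g = (\<lambda>u. S (z0 + u * h) - S z0)"
  define G where "G = (\<lambda>x. integral {-1..x} g)"
  have inw: "z0 + u * h \<in> {0..1}" if "u \<in> {-1..1}" for u
  proof -
    have "\<bar>u * h\<bar> \<le> 1 * h" unfolding abs_mult using that h by (intro mult_mono) auto
    then have "- h \<le> u * h" "u * h \<le> h" by linarith+
    then show ?thesis unfolding atLeastAtMost_iff using h by (intro conjI; linarith)
  qed
  have gl: "\<bar>g u - g v\<bar> \<le> L * h * \<bar>u - v\<bar>" if "u \<in> {-1..1}" "v \<in> {-1..1}" for u v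
  proof -
    have "\<bar>g u - g v\<bar> \<le> L * \<bar>(z0 + u * h) - (z0 + v * h)\<bar>"
      using lip[OF inw[OF that(1)] inw[OF that(2)]] by (simp add: g_def)
    also have "(z0 + u * h) - (z0 + v * h) = h * (u - v)" by (simp add: algebra_simps)
    finally show ?thesis using h by (simp add: abs_mult)
  qed
  have g0: "\<bar>g u\<bar> \<le> L * h" if "u \<in> {-1..1}" for u
  proof -
    have "\<bar>g u - g 0\<bar> \<le> L * h * \<bar>u - 0\<bar>" using that by (intro gl) auto
    also have "\<dots> \<le> L * h" using that L h by (intro mult_left_le) auto
    finally show ?thesis by (simp add: g_def)
  qed
  have cont: "continuous_on {-1..1} g"
  proof (rule continuous_onI)
    fix x r :: real assume x: "x \<in> {-1..1}" and r: "0 < r"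
    show "\<exists>d>0. \<forall>x'\<in>{-1..1}. dist x' x < d \<longrightarrow> dist (g x') (g x) \<le> r"
    proof (intro exI conjI ballI impI)
      show "0 < r / (L * h)" using r L h by simp
      fix x' assume "x' \<in> {-1..1}" "dist x' x < r / (L * h)"
      then have "\<bar>g x' - g x\<bar> \<le> L * h * \<bar>x' - x\<bar>" "L * h * \<bar>x' - x\<bar> \<le> r"
        using gl[of x' x] x L h by (auto simp: dist_real_def field_simps)
      then show "dist (g x') (g x) \<le> r" by (simp add: dist_real_def)
    qed
  qed
  have G': "(G has_real_derivative g u) (at u within {-1..1})" if "u \<in> {-1..1}" for u
    unfolding G_def by (rule integral_has_real_derivative[OF cont that])
  have mv: "\<exists>\<xi>\<in>{u..v}. G v - G u = (v - u) * g \<xi>" if "-1 \<le> u" "u < v" "v \<le> 1" for u v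
  proof -
    have "\<exists>\<xi>\<in>{u<..<v}. G v - G u = (\<lambda>t. t * g \<xi>) (v - u)"
    proof (rule mvt_simple[OF that(2)])
      fix x assume x: "u \<le> x" "x \<le> v"
      have "(G has_real_derivative g x) (at x within {u..v})"
        using that x by (intro DERIV_subset[OF G']) auto
      then show "(G has_derivative (\<lambda>t. t * g x)) (at x within {u..v})"
        by (simp add: has_field_derivative_def mult.commute[of _ "g x"])
    qed
    then show ?thesis by (auto intro: less_imp_le)
  qed
  have GL: "\<bar>G v - G u\<bar> \<le> L * h * (v - u)" if uv: "-1 \<le> u" "u \<le> v" "v \<le> 1" for u v
  proof (cases "u = v")
    case False
    then have lt: "u < v" using uv by simp
    from mv[OF uv(1) lt uv(3)] obtain \<xi> where \<xi>: "\<xi> \<in> {u..v}" "G v - G u = (v - u) * g \<xi>" ..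
    have "(v - u) * \<bar>g \<xi>\<bar> \<le> (v - u) * (L * h)" using uv \<xi> by (intro mult_left_mono g0) auto
    then show ?thesis using \<xi> uv by (simp add: abs_mult mult.commute)
  qed simp
  have Om: "Omega h z0 S = G 1 - G (-1)"
  proof -
    have "set_integrable lborel {-1..1} g" by (rule borel_integrable_atLeastAtMost'[OF cont])
    from set_borel_integral_eq_integral(2)[OF this] have "(LBINT u:{-1..1}. g u) = integral {-1..1} g" .
    then show ?thesis by (simp add: Omega_def G_def g_def)
  qed
  define u where "u = (\<lambda>j::nat. (real j / real n - z0) / h)"
  have u_step: "u j - u (j - 1) = 1 / NH" if "1 \<le> j" for j
    using that h n_pos by (simp add: u_def NH_def field_simps of_nat_diff)
  have uh: "z0 + u j * h = real j / real n" for j using h by (simp add: u_def)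
  have u_in: "u j \<in> {-1..1}" if "j \<in> {lo..hi}" for j
  proof -
    have "kweight n h z0 j = 1" using that by (simp add: kweight_eq)
    then show ?thesis by (auto simp: kweight_def u_def indicator_def split: if_splits)
  qed
  \<comment> \<open>The rescaled mesh is 1 / (n h), so the scaled increment is a value of
    \<open>g\<close> between two neighbouring nodes, and \<open>g\<close> varies by at most L h / (n
    h) there.\<close>
  have step: "\<bar>NH * (G (u j) - G (u (j - 1))) - (s j - S z0)\<bar> \<le> L / real n" if j: "j \<in> {\<nu>+1..hi}" for j
  proof -
    have in1: "u j \<in> {-1..1}" "u (j - 1) \<in> {-1..1}"
    proof -
      have "j \<in> {lo..hi}" "j - 1 \<in> {lo..hi}" using j window by auto
      then show "u j \<in> {-1..1}" "u (j - 1) \<in> {-1..1}" by (blast intro: u_in)+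
    qed
    have st: "u j - u (j - 1) = 1 / NH" using j by (intro u_step) auto
    then have lt: "u (j - 1) < u j" using NH_pos by (metis diff_gt_0_iff_gt divide_pos_pos zero_less_one)
    obtain \<xi> where \<xi>: "\<xi> \<in> {u (j - 1)..u j}" "G (u j) - G (u (j - 1)) = (u j - u (j - 1)) * g \<xi>"
      using mv[of "u (j - 1)" "u j"] lt in1 by auto
    have eq: "NH * (G (u j) - G (u (j - 1))) = g \<xi>" using \<xi> st NH_pos by simp
    have gj: "g (u j) = s j - S z0" by (simp add: g_def uh s_def)
    have "\<bar>g \<xi> - g (u j)\<bar> \<le> L * h * \<bar>\<xi> - u j\<bar>" using \<xi> in1 by (intro gl) auto
    also have "\<dots> \<le> L * h * (1 / NH)" using \<xi> st L h by (intro mult_left_mono) auto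
    also have "\<dots> = L / real n" using h by (simp add: NH_def)
    finally show ?thesis by (simp only: eq gj)
  qed
  have tele: "(\<Sum>j=\<nu>+1..m. G (u j) - G (u (j - 1))) = G (u m) - G (u \<nu>)" if "\<nu> \<le> m" for m
    using that by (induction m rule: dec_induct) auto
  have "\<bar>NH * (G (u hi) - G (u \<nu>)) - (\<Sum>j=\<nu>+1..hi. s j - S z0)\<bar>
      = \<bar>\<Sum>j=\<nu>+1..hi. NH * (G (u j) - G (u (j - 1))) - (s j - S z0)\<bar>"
    unfolding tele[OF less_imp_le[OF window(3)], symmetric] sum_distrib_left sum_subtractf[symmetric] ..
  also have "\<dots> \<le> (\<Sum>j=\<nu>+1..hi. L / real n)" by (intro order_trans[OF sum_abs sum_mono] step)
  also have "\<dots> = real (hi - \<nu>) * (L / real n)" by simp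
  also have "\<dots> \<le> 2 * NH * (L / real n)" using window L by (intro mult_right_mono) auto
  also have "\<dots> = 2 * (L * h)" using n_pos by (simp add: NH_def)
  finally have d1: "\<bar>NH * (G (u hi) - G (u \<nu>)) - (\<Sum>j=\<nu>+1..hi. s j - S z0)\<bar> \<le> 2 * (L * h)" .
  have uhi: "u hi \<in> {-1..1}" "u \<nu> \<in> {-1..1}" 
  proof -
    have "hi \<in> {lo..hi}" "\<nu> \<in> {lo..hi}" using window by auto
    then show "u hi \<in> {-1..1}" "u \<nu> \<in> {-1..1}" by (blast intro: u_in)+
  qed
  have n1: "NH * (1 - u hi) \<le> 1"
  proof -
    have "NH * (1 - u hi) = real n * z0 + real n * h - real hi"
      using h n_pos by (simp add: NH_def u_def field_simps)
    then show ?thesis using hi_bounds by linarith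
  qed
  \<comment> \<open>The part of the window spent on the preliminary estimate. It is missing from the
    Riemann sum and contributes the term L h E.\<close>
  have n2: "NH * (u \<nu> + 1) \<le> E + 2"
  proof -
    have "NH * (u \<nu> + 1) = real \<nu> - (real n * z0 - real n * h)"
      using h n_pos by (simp add: NH_def u_def field_simps)
    then show ?thesis using nu_bounds(2)[OF less_imp_le[OF e_pos], unfolded E_alt] by linarith
  qed
  have Lh: "0 \<le> L * h" using L h by simp
  have d2: "NH * \<bar>G 1 - G (u hi)\<bar> \<le> L * h"
  proof -
    have "NH * \<bar>G 1 - G (u hi)\<bar> \<le> NH * (L * h * (1 - u hi))" using uhi NH_pos by (intro mult_left_mono GL) auto
    also have "\<dots> = L * h * (NH * (1 - u hi))" by simp
    also have "\<dots> \<le> L * h * 1" using n1 Lh by (rule mult_left_mono)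
    finally show ?thesis by simp
  qed
  have d3: "NH * \<bar>G (u \<nu>) - G (-1)\<bar> \<le> L * h * (E + 2)"
  proof -
    have "NH * \<bar>G (u \<nu>) - G (-1)\<bar> \<le> NH * (L * h * (u \<nu> - (-1)))" using uhi NH_pos by (intro mult_left_mono GL) auto
    also have "\<dots> = L * h * (NH * (u \<nu> + 1))" by simp
    also have "\<dots> \<le> L * h * (E + 2)" using n2 Lh by (rule mult_left_mono)
    finally show ?thesis .
  qed
  have "NH * (G (u hi) - G (u \<nu>)) = NH * Omega h z0 S - NH * (G 1 - G (u hi)) - NH * (G (u \<nu>) - G (-1))"
    by (simp add: Om algebra_simps)
  moreover have "\<bar>NH * Omega h z0 S\<bar> = NH * \<bar>Omega h z0 S\<bar>" "\<bar>NH * (G 1 - G (u hi))\<bar> = NH * \<bar>G 1 - G (u hi)\<bar>"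
    "\<bar>NH * (G (u \<nu>) - G (-1))\<bar> = NH * \<bar>G (u \<nu>) - G (-1)\<bar>" using NH_pos by (auto simp: abs_mult)
  ultimately have "Wsum \<le> NH * \<bar>Omega h z0 S\<bar> + L * h + L * h * (E + 2) + 2 * (L * h)"
    unfolding Wsum_def using d1 d2 d3 by linarith
  then show ?thesis by (simp add: algebra_simps)
qed

end

section \<open>From the noise space to the law of the observations\<close>

lemma stability_set_lipschitz:
  assumes S: "S \<in> stability_set \<epsilon> L" and x: "x \<in> {0..1}" "x' \<in> {0..1}"
  shows "\<bar>S x - S x'\<bar> \<le> L * \<bar>x - x'\<bar>"
proof -
  obtain S' where S': "\<forall>x\<in>{0..1}. (S has_real_derivative S' x) (at x within {0..1}) \<and> \<bar>S' x\<bar> \<le> L"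
    using S by (auto simp: stability_set_def)
  have "norm (S x - S x') \<le> L * norm (x - x')"
    using S' x by (intro field_differentiable_bound[of "{0..1}" S S']) auto
  then show ?thesis by simp
qed

text \<open>Only simple functions below \<open>g\<close> are transported, which gives an inequality
  for arbitrary \<open>g\<close>. It can therefore be applied to the estimator directly, although
  its correction coefficient is a definite description.\<close>

lemma cmult_nn_integral_distr_le:
  assumes f [measurable]: "f \<in> measurable M N"
  shows "c * (\<integral>\<^sup>+y. g y \<partial>distr M N f) \<le> (\<integral>\<^sup>+x. c * g (f x) \<partial>M)"
proof -
  have "c * (\<integral>\<^sup>+y. g y \<partial>distr M N f) = (SUP u\<in>{u. simple_function (distr M N f) u \<and> u \<le> g}. c * integral\<^sup>S (distr M N f) u)"
    unfolding nn_integral_def by (rule SUP_mult_left_ennreal)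
  also have "\<dots> \<le> (\<integral>\<^sup>+x. c * g (f x) \<partial>M)"
  proof (rule SUP_least, safe)
    fix u assume u: "simple_function (distr M N f) u" "u \<le> g"
    have um [measurable]: "u \<in> borel_measurable N" using borel_measurable_simple_function[OF u(1)] by simp
    have "c * integral\<^sup>S (distr M N f) u = c * (\<integral>\<^sup>+y. u y \<partial>distr M N f)"
      by (simp add: nn_integral_eq_simple_integral[OF u(1)])
    also have "\<dots> = (\<integral>\<^sup>+x. c * u (f x) \<partial>M)"
      by (subst nn_integral_distr) (auto simp: nn_integral_cmult)
    also have "\<dots> \<le> (\<integral>\<^sup>+x. c * g (f x) \<partial>M)"
      using u(2) by (intro nn_integral_mono mult_left_mono) (auto simp: le_fun_def)
    finally show "c * integral\<^sup>S (distr M N f) u \<le> (\<integral>\<^sup>+x. c * g (f x) \<partial>M)" .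
  qed
  finally show ?thesis .
qed

lemma expectation_abs_half_normal:
  assumes "distributed M lborel \<eta> (normal_density 0 (sqrt (1 / 2)))"
  shows "(\<integral>\<omega>. \<bar>\<eta> \<omega>\<bar> \<partial>M) = sqrt (1 / 2) * (\<integral>z. \<bar>z\<bar> \<partial>std_normal)"
proof -
  have s: "0 < sqrt (1 / 2 :: real)" by simp
  have "(\<integral>\<omega>. \<bar>\<eta> \<omega>\<bar> \<partial>M) = (\<integral>x. normal_density 0 (sqrt (1 / 2)) x * \<bar>x\<bar> \<partial>lborel)"
    by (rule distributed_integral[OF assms, symmetric]) auto
  also have "\<dots> = sqrt (1 / 2) * sqrt (2 / pi)"
    using normal_moment_abs_odd[OF s, of 0 0] by (simp add: has_bochner_integral_iff)
  also have "sqrt (2 / pi) = (\<integral>x. std_normal_density x * \<bar>x\<bar> \<partial>lborel)"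
    using std_normal_moment_abs_odd[of 0] by (simp add: has_bochner_integral_iff)
  also have "\<dots> = (\<integral>z. \<bar>z\<bar> \<partial>std_normal)"
    by (subst integral_density) auto
  finally show ?thesis .
qed

section \<open>Asymptotics\<close>

text \<open>The arguments \<open>hpe\<close>, \<open>hhp\<close>, \<open>q\<close> and \<open>u\<close> stand for \<open>h p e\<close>, \<open>h\<^sup>2 p\<close>, \<open>1 / p\<close> and
  \<open>1 / (e\<^sup>2 p)\<close>, where \<open>p = sqrt (n h)\<close> and \<open>e\<close> is \<open>eps_tilde\<close>: the scales whose convergence to
  zero makes all remainder terms vanish.\<close>

definition bad_majorant :: "real \<Rightarrow> real \<Rightarrow> real \<Rightarrow> real \<Rightarrow> real \<Rightarrow> real \<Rightarrow> real \<Rightarrow> real" where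
  "bad_majorant C K2 K4 \<epsilon> q e u = 32 * K2 * (u * e) + 8 * C * (u\<^sup>2 * e\<^sup>2 * q) + 4096 * K4 / (\<epsilon> / 16) ^ 4 * u ^ 3"

definition risk_majorant :: "real \<Rightarrow> real \<Rightarrow> real \<Rightarrow> real \<Rightarrow> real \<Rightarrow> real \<Rightarrow> real \<Rightarrow> real \<Rightarrow> real \<Rightarrow>
    real \<Rightarrow> real \<Rightarrow> real \<Rightarrow> real \<Rightarrow> real \<Rightarrow> real \<Rightarrow> real" where
  "risk_majorant m C m4 K2 K4 \<epsilon> L d w h q e hpe hhp u =
     (m * (sqrt ((1 + e) / (2 * (1 - e))) + 1 / \<epsilon> * (q * bad_majorant C K2 K4 \<epsilon> q e u)) + d
       + (5 + m4) / (2 * d\<^sup>2) * (2 * C / \<epsilon> ^ 3 * q))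
   + (1 / \<epsilon>\<^sup>2 * (w + L * (5 * (h * q) + hpe) + (2 * h * L\<^sup>2 * K2 + h) + 4 * L * C * (h * q) + 4 * L\<^sup>2 * C * hhp)
   + (L / \<epsilon>\<^sup>2 * (2 * K2 * h + h + C * (h * q) + 4 * L * C * hhp + 4 * hpe + 2 * h * bad_majorant C K2 K4 \<epsilon> q e u)
   + 1 / \<epsilon> * (bad_majorant C K2 K4 \<epsilon> q e u + 18 / \<epsilon>\<^sup>2 * (2 * K2 * u + C * (u * q\<^sup>2)))))"

lemma tendsto_risk_majorant:
  assumes [tendsto_intros]: "w \<longlonglongrightarrow> 0" "h \<longlonglongrightarrow> 0" "q \<longlonglongrightarrow> 0" "e \<longlonglongrightarrow> 0" "hpe \<longlonglongrightarrow> 0" "hhp \<longlonglongrightarrow> 0" "u \<longlonglongrightarrow> 0"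
    and "0 < \<epsilon>" "0 < d"
  shows "(\<lambda>n. risk_majorant m C m4 K2 K4 \<epsilon> L d (w n) (h n) (q n) (e n) (hpe n) (hhp n) (u n)) \<longlonglongrightarrow> sqrt (1 / 2) * m + d"
proof -
  have b [tendsto_intros]: "(\<lambda>n. bad_majorant C K2 K4 \<epsilon> (q n) (e n) (u n)) \<longlonglongrightarrow> 0"
    unfolding bad_majorant_def by (rule tendsto_eq_intros assms(1-7) refl)+ simp
  have s [tendsto_intros]: "(\<lambda>n. sqrt ((1 + e n) / (2 * (1 - e n)))) \<longlonglongrightarrow> sqrt (1 / 2)"
  proof -
    have "(\<lambda>n. sqrt ((1 + e n) / (2 * (1 - e n)))) \<longlonglongrightarrow> sqrt ((1 + 0) / (2 * (1 - 0)))"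
      by (intro tendsto_intros) auto
    then show ?thesis by simp
  qed
  show ?thesis unfolding risk_majorant_def
    by (rule tendsto_eq_intros b s assms(1-7) refl)+ (simp add: mult.commute)
qed

context seq_model
begin

text \<open>After scaling by p, the contributions of M1, of y at \<nu> and of X1 become multiples of
  u e, u^2 e^2 q and u^3, which all tend to 0 with u.\<close>

lemma psi_eq:
  defines "q \<equiv> 1 / p" and "u \<equiv> 1 / (e\<^sup>2 * p)"
  shows "\<psi> = q * bad_majorant C4 K2 K4 \<epsilon> q e u" "p * \<psi> = bad_majorant C4 K2 K4 \<epsilon> q e u"
proof -
  have pos: "p \<noteq> 0" "e \<noteq> 0" "c \<noteq> 0" using p_pos e_pos eps by (auto simp: c_def)
  have E: "E = e * p\<^sup>2" by (simp add: E_def p_sq)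
  have "8 / E\<^sup>2 * (4 * E * K2 + C4) = q * (32 * K2 * (u * e) + 8 * C4 * (u\<^sup>2 * e\<^sup>2 * q))"
    unfolding E q_def u_def using pos by (simp add: field_simps power2_eq_square)
  moreover have "256 / (c * e * E) ^ 4 * (K4 * (4 * E)\<^sup>2) = q * (4096 * K4 / c ^ 4 * u ^ 3)"
    unfolding E q_def u_def using pos by (simp add: field_simps eval_nat_numeral)
  ultimately show 1: "\<psi> = q * bad_majorant C4 K2 K4 \<epsilon> q e u"
    unfolding \<psi>_def bad_majorant_def c_def[symmetric] by (simp add: distrib_left)
  then show "p * \<psi> = bad_majorant C4 K2 K4 \<epsilon> q e u" using pos by (simp add: q_def)
qed

lemma risk_bound_majorant:
  assumes d: "0 < d" and Om: "\<bar>Omega h z0 S\<bar> \<le> w / p"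
  shows "(\<integral>\<^sup>+\<omega>. ennreal (p / sqrt \<gamma> * \<bar>seq_kernel_est n h \<alpha> \<epsilon> z0 (y \<omega>) - S z0\<bar>) \<partial>P) \<le> ennreal
     (risk_majorant m1 C4 m4 K2 K4 \<epsilon> L d w h (1 / p) e (h * p * e) (h\<^sup>2 * p) (1 / (e\<^sup>2 * p)))"
proof -
  define q where "q = 1 / p"
  define u where "u = 1 / (e\<^sup>2 * p)"
  define b where "b = bad_majorant C4 K2 K4 \<epsilon> q e u"
  have pos: "p \<noteq> 0" "e \<noteq> 0" "\<epsilon> \<noteq> 0" using p_pos e_pos eps by auto
  have E: "E = e * p\<^sup>2" by (simp add: E_def p_sq)
  have NH: "NH = p\<^sup>2" by (simp add: p_sq)
  have ps: "\<psi> = q * b" unfolding b_def q_def u_def by (rule psi_eq)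
  have pps: "p * \<psi> = b" unfolding b_def q_def u_def by (rule psi_eq)
  have W: "Wsum \<le> p * w + L * h * (5 + E)"
  proof -
    have "NH * \<bar>Omega h z0 S\<bar> \<le> NH * (w / p)" using Om NH_pos by (intro mult_left_mono) auto
    also have "\<dots> = p * w" using pos by (simp add: NH power2_eq_square)
    finally show ?thesis using Wsum_le by linarith
  qed
  have t1: "(5 + m4) / (2 * d\<^sup>2) * (2 * C4 / (\<epsilon> ^ 3 * p)) = (5 + m4) / (2 * d\<^sup>2) * (2 * C4 / \<epsilon> ^ 3 * q)"
    by (simp add: q_def)
  have "1 / (\<epsilon> * p) * (1 / \<epsilon> * (Wsum + ((2 * p * h * L\<^sup>2 * K2 + h * p) + (L * h * C4 + (L * h * C4
     + (L / real n * (2 * NH * C4) + 2 * (L * h)\<^sup>2 * (2 * NH * C4)))))))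
     \<le> 1 / (\<epsilon> * p) * (1 / \<epsilon> * ((p * w + L * h * (5 + E)) + ((2 * p * h * L\<^sup>2 * K2 + h * p) + (L * h * C4 + (L * h * C4
     + (L / real n * (2 * NH * C4) + 2 * (L * h)\<^sup>2 * (2 * NH * C4)))))))"
    using W p_pos eps by (intro mult_left_mono add_right_mono) auto
  also have "\<dots> = 1 / (\<epsilon> * p) * (1 / \<epsilon> * ((p * w + L * h * (5 + E)) + ((2 * p * h * L\<^sup>2 * K2 + h * p) + (L * h * C4 + (L * h * C4
     + (2 * L * h * C4 + 2 * (L * h)\<^sup>2 * (2 * NH * C4)))))))"
    using n_pos by (simp add: NH_def)
  also have "\<dots> = 1 / \<epsilon>\<^sup>2 * (w + L * (5 * (h * q) + h * p * e) + (2 * h * L\<^sup>2 * K2 + h) + 4 * L * C4 * (h * q) + 4 * L\<^sup>2 * C4 * (h\<^sup>2 * p))"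
    unfolding q_def E NH using pos by (simp add: field_simps power2_eq_square)
  finally have t2: "1 / (\<epsilon> * p) * (1 / \<epsilon> * (Wsum + ((2 * p * h * L\<^sup>2 * K2 + h * p) + (L * h * C4 + (L * h * C4
     + (L / real n * (2 * NH * C4) + 2 * (L * h)\<^sup>2 * (2 * NH * C4)))))))
    \<le> 1 / \<epsilon>\<^sup>2 * (w + L * (5 * (h * q) + h * p * e) + (2 * h * L\<^sup>2 * K2 + h) + 4 * L * C4 * (h * q) + 4 * L\<^sup>2 * C4 * (h\<^sup>2 * p))" .
  have t3: "L * h / (\<epsilon> * p) * (1 / \<epsilon> * ((2 * p * K2 + p) + (C4 + (2 * L * h * (2 * NH * C4) + (4 * E + 2 * NH * \<psi>)))))
    = L / \<epsilon>\<^sup>2 * (2 * K2 * h + h + C4 * (h * q) + 4 * L * C4 * (h\<^sup>2 * p) + 4 * (h * p * e) + 2 * h * b)"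
    unfolding pps[symmetric] q_def E NH using pos by (simp add: field_simps power2_eq_square)
  have t4: "p / \<epsilon> * (\<psi> + 18 / (\<epsilon> * E)\<^sup>2 * (2 * NH * K2 + C4)) = 1 / \<epsilon> * (b + 18 / \<epsilon>\<^sup>2 * (2 * K2 * u + C4 * (u * q\<^sup>2)))"
    unfolding pps[symmetric] q_def u_def E NH using pos by (simp add: field_simps power2_eq_square)
  show ?thesis
    apply (rule order_trans[OF risk_bound[OF d]])
    apply (rule ennreal_leI)
    unfolding risk_majorant_def q_def[symmetric] u_def[symmetric] b_def[symmetric] t1 t3 t4 ps[symmetric]
    using t2 by (intro add_mono order_refl) auto
qed

end

lemma obs_risk_le:
  fixes n h z0 S \<epsilon> L f \<sigma> \<alpha> d w y0
  assumes n: "1 \<le> n" and h: "0 < h" "h < z0" "z0 + h < 1"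
    and S: "S \<in> stability_set \<epsilon> L" and f: "f \<in> noise_densities \<sigma>" and \<sigma>: "1 \<le> \<sigma>"
    and eps: "0 < \<epsilon>" "\<epsilon> < 1" and L: "0 < L"
  defines "e \<equiv> eps_tilde n h \<alpha>" and "p \<equiv> sqrt (real n * h)"
    and "C \<equiv> 1 + y0 ^ 4 + 3 * \<sigma>\<^sup>2 / \<epsilon> ^ 4"
  assumes e: "0 < e" "e \<le> 1 / 2" "L * h \<le> \<epsilon> * e / 32" "40 \<le> \<epsilon> * (e * (real n * h))"
    and d: "0 < d" and Om: "\<bar>Omega h z0 S\<bar> \<le> w / p"
  shows "ennreal (p / sqrt (1 - (S z0)\<^sup>2)) * (\<integral>\<^sup>+y. ennreal \<bar>seq_kernel_est n h \<alpha> \<epsilon> z0 y - S z0\<bar> \<partial>obs_law n y0 S f)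
    \<le> ennreal (risk_majorant (\<integral>z. \<bar>z\<bar> \<partial>std_normal) C (3 * \<sigma>\<^sup>2) (8 * C + 2 * (3 * \<sigma>\<^sup>2)) (exp 8 * (16 * (3 * \<sigma>\<^sup>2) * C))
       \<epsilon> L d w h (1 / p) e (h * p * e) (h\<^sup>2 * p) (1 / (e\<^sup>2 * p)))"
proof -
  let ?D = "density lborel (\<lambda>x. ennreal (f x))"
  have bd: "\<bar>S x\<bar> \<le> 1 - \<epsilon>" if "x \<in> {0..1}" for x using S that by (auto simp: stability_set_def)
  interpret cn: centered_noise ?D "3 * \<sigma>\<^sup>2" by (rule centered_noise_density[OF f \<sigma>])
  interpret kw: kernel_window n h \<alpha> z0 using h n by unfold_locales
  interpret ar: ar_noise ?D "3 * \<sigma>\<^sup>2" n y0 S \<epsilon>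
    by unfold_locales (use eps bd in \<open>auto simp: field_simps\<close>)
  interpret sm: seq_model ?D "3 * \<sigma>\<^sup>2" n y0 S \<epsilon> h \<alpha> z0 L
  proof
    show "\<bar>S x - S x'\<bar> \<le> L * \<bar>x - x'\<bar>" if "x \<in> {0..1}" "x' \<in> {0..1}" for x x'
      using stability_set_lipschitz[OF S that] .
    show "\<bar>S z0\<bar> \<le> 1 - \<epsilon>" using h by (intro bd) auto
  qed (use L e in \<open>auto simp: kw.e_def e_def\<close>)
  have p: "sm.p = p" by (simp add: sm.p_def sm.NH_def p_def)
  have pe: "kw.e = e" by (simp add: kw.e_def e_def)
  have meas: "(\<lambda>\<xi>. restrict (ar_path n y0 S \<xi>) {0..n}) \<in> measurable ar.P (\<Pi>\<^sub>M k\<in>{0..n}. borel)"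
  proof -
    have "(\<lambda>\<xi>. \<lambda>j\<in>{0..n}. ar.y \<xi> j) \<in> measurable ar.P (\<Pi>\<^sub>M k\<in>{0..n}. borel)"
      by (intro measurable_restrict) simp
    then show ?thesis by (simp add: ar.y_def[abs_def] cong: restrict_cong)
  qed
  have law: "obs_law n y0 S f = distr ar.P (\<Pi>\<^sub>M k\<in>{0..n}. borel) ar.y"
    unfolding obs_law_def ar.P_def ar.y_def[abs_def] ..
  have "ennreal (p / sqrt (1 - (S z0)\<^sup>2)) * (\<integral>\<^sup>+y. ennreal \<bar>seq_kernel_est n h \<alpha> \<epsilon> z0 y - S z0\<bar> \<partial>obs_law n y0 S f)
      \<le> (\<integral>\<^sup>+\<omega>. ennreal (p / sqrt (1 - (S z0)\<^sup>2)) * ennreal \<bar>seq_kernel_est n h \<alpha> \<epsilon> z0 (ar.y \<omega>) - S z0\<bar> \<partial>ar.P)"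
    unfolding law by (rule cmult_nn_integral_distr_le) (use meas in \<open>simp add: ar.y_def[abs_def]\<close>)
  also have "\<dots> = (\<integral>\<^sup>+\<omega>. ennreal (p / sqrt (1 - (S z0)\<^sup>2) * \<bar>seq_kernel_est n h \<alpha> \<epsilon> z0 (ar.y \<omega>) - S z0\<bar>) \<partial>ar.P)"
    by (rule nn_integral_cong, subst ennreal_mult'') simp_all
  also have "\<dots> \<le> ennreal (risk_majorant sm.m1 ar.C4 (3 * \<sigma>\<^sup>2) sm.K2 sm.K4 \<epsilon> L d w h (1 / p) e (h * p * e) (h\<^sup>2 * p) (1 / (e\<^sup>2 * p)))"
    using sm.risk_bound_majorant[OF d, of w] Om unfolding p pe sm.\<gamma>_def by simp
  finally show ?thesis
    unfolding sm.m1_def ar.C4_def sm.K2_def sm.K4_def C_def .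
qed

text \<open>Everything follows from 1 - b = 2 b \<beta>: the bandwidth balances the stochastic scale
  1 / sqrt(n h) against h^\<beta>, so both equal the inverse of the rate.\<close>

lemma scales_eq_powr:
  fixes \<alpha> \<beta> b :: real
  assumes \<alpha>: "0 < \<alpha>" and \<beta>: "\<beta> = 1 + \<alpha>" and n: "3 \<le> n"
  defines "b \<equiv> 1 / (2 * \<beta> + 1)"
  shows "bandwidth \<beta> n = real n powr (- b)"
    and "sqrt (real n * bandwidth \<beta> n) = real n powr (b * \<beta>)"
    and "eps_tilde n (bandwidth \<beta> n) \<alpha> = real n powr (- (b * \<alpha>)) / ln (real n)"
    and "bandwidth \<beta> n powr \<beta> = 1 / sqrt (real n * bandwidth \<beta> n)"
    and "real n powr (\<beta> / (2 * \<beta> + 1)) = sqrt (real n * bandwidth \<beta> n)"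
proof -
  show 1: "bandwidth \<beta> n = real n powr (- b)"
    by (simp add: bandwidth_def b_def)
  have "real n * bandwidth \<beta> n = real n powr (1 - b)"
    using n unfolding 1 by (simp add: powr_diff powr_minus divide_inverse)
  also have "1 - b = 2 * (b * \<beta>)" unfolding b_def \<beta> using \<alpha> by (simp add: field_simps)
  also have "real n powr (2 * (b * \<beta>)) = (real n powr (b * \<beta>))\<^sup>2"
    by (simp only: mult_2 powr_add power2_eq_square)
  finally show 2: "sqrt (real n * bandwidth \<beta> n) = real n powr (b * \<beta>)" by simp
  show "eps_tilde n (bandwidth \<beta> n) \<alpha> = real n powr (- (b * \<alpha>)) / ln (real n)"
    unfolding eps_tilde_def 1 powr_powr by simp
  show "bandwidth \<beta> n powr \<beta> = 1 / sqrt (real n * bandwidth \<beta> n)"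
    unfolding 2 unfolding 1 powr_powr by (simp add: powr_minus_divide)
  show "real n powr (\<beta> / (2 * \<beta> + 1)) = sqrt (real n * bandwidth \<beta> n)"
    unfolding 2 by (simp add: b_def)
qed

text \<open>Since \<beta> = 1 + \<alpha>, the powers of n in h p e cancel and 1 / ln n remains. In
  h^2 p, 1 / (e^2 p) and h / e the power is n^(-b (1 - \<alpha>)), times logarithms in the last two;
  here \<alpha> < 1 is essential.\<close>

lemma scale_limits:
  fixes \<alpha> \<beta> :: real and h p e :: "nat \<Rightarrow> real"
  assumes \<alpha>: "0 < \<alpha>" "\<alpha> < 1" and \<beta>: "\<beta> = 1 + \<alpha>"
  defines "h \<equiv> \<lambda>n. bandwidth \<beta> n" and "p \<equiv> \<lambda>n. sqrt (real n * bandwidth \<beta> n)"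
    and "e \<equiv> \<lambda>n. eps_tilde n (bandwidth \<beta> n) \<alpha>"
  shows "h \<longlonglongrightarrow> 0" "(\<lambda>n. 1 / p n) \<longlonglongrightarrow> 0" "e \<longlonglongrightarrow> 0" "(\<lambda>n. h n * p n * e n) \<longlonglongrightarrow> 0"
    "(\<lambda>n. (h n)\<^sup>2 * p n) \<longlonglongrightarrow> 0" "(\<lambda>n. 1 / ((e n)\<^sup>2 * p n)) \<longlonglongrightarrow> 0" "(\<lambda>n. h n / e n) \<longlonglongrightarrow> 0"
    "(\<lambda>n. 1 / (e n * (real n * h n))) \<longlonglongrightarrow> 0"
    and "\<And>n. 3 \<le> n \<Longrightarrow> 0 < e n \<and> 0 < h n"
proof -
  define b where "b = 1 / (2 * \<beta> + 1)"
  have b: "0 < b" using \<alpha> unfolding b_def \<beta> by simp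
  have b_pos: "0 < b" "0 < b * (1 - \<alpha>)" "0 < b * \<alpha>" "0 < b * \<beta>"
    using \<alpha> b unfolding \<beta> by auto
  have hh_eq: "h n = real n powr (- b)" if "3 \<le> n" for n
    using scales_eq_powr(1)[OF \<alpha>(1) \<beta> that] by (simp add: h_def b_def)
  have pp_eq: "p n = real n powr (b * \<beta>)" if "3 \<le> n" for n
    using scales_eq_powr(2)[OF \<alpha>(1) \<beta> that] by (simp add: p_def b_def)
  have ee_eq: "e n = real n powr (- (b * \<alpha>)) / ln (real n)" if "3 \<le> n" for n
    using scales_eq_powr(3)[OF \<alpha>(1) \<beta> that] by (simp add: e_def b_def)
  have lim: "X \<longlonglongrightarrow> 0" if "Y \<longlonglongrightarrow> 0" "\<And>n. 3 \<le> n \<Longrightarrow> Y n = X n" for X Y :: "nat \<Rightarrow> real"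
    using that(1) by (rule Lim_transform_eventually) (use that(2) in \<open>auto intro: eventually_sequentiallyI\<close>)
  have l0: "(\<lambda>n. real n powr (- a)) \<longlonglongrightarrow> 0" if "a > 0" for a using that by real_asymp
  have l1: "(\<lambda>n. ln (real n) * real n powr (- a)) \<longlonglongrightarrow> 0" if "a > 0" for a using that by real_asymp
  have l2: "(\<lambda>n. ln (real n) ^ 2 * real n powr (- a)) \<longlonglongrightarrow> 0" if "a > 0" for a using that by real_asymp
  have l3: "(\<lambda>n. 1 / ln (real n)) \<longlonglongrightarrow> 0" by real_asymp
  have e1: "b * \<beta> = b + b * \<alpha>" by (simp add: \<beta> distrib_left)
  show hl: "h \<longlonglongrightarrow> 0" by (rule lim[OF l0[OF b_pos(1)]]) (simp add: hh_eq)
  show ql: "(\<lambda>n. 1 / p n) \<longlonglongrightarrow> 0"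
    by (rule lim[OF l0[OF b_pos(4)]]) (simp add: pp_eq powr_minus divide_inverse)
  have "(\<lambda>n. real n powr (- (b * \<alpha>)) * (1 / ln (real n))) \<longlonglongrightarrow> 0 * 0"
    by (intro tendsto_mult l0 l3 b_pos)
  then have "(\<lambda>n. real n powr (- (b * \<alpha>)) * (1 / ln (real n))) \<longlonglongrightarrow> 0" by simp
  then show el: "e \<longlonglongrightarrow> 0"
    by (rule lim) (simp add: ee_eq)
  show "(\<lambda>n. h n * p n * e n) \<longlonglongrightarrow> 0"
  proof (rule lim[OF l3])
    fix n :: nat assume n: "3 \<le> n"
    have "real n powr (- b) * real n powr (b * \<beta>) * real n powr (- (b * \<alpha>)) = real n powr 0"
      unfolding powr_add[symmetric] e1 by simp
    then show "1 / ln (real n) = h n * p n * e n" using n by (simp add: hh_eq pp_eq ee_eq)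
  qed
  show "(\<lambda>n. (h n)\<^sup>2 * p n) \<longlonglongrightarrow> 0"
  proof (rule lim[OF l0[OF b_pos(2)]])
    fix n :: nat assume n: "3 \<le> n"
    have "(real n powr (- b))\<^sup>2 * real n powr (b * \<beta>) = real n powr (- (b * (1 - \<alpha>)))"
      unfolding power2_eq_square powr_add[symmetric] e1 by (simp add: algebra_simps)
    then show "real n powr (- (b * (1 - \<alpha>))) = (h n)\<^sup>2 * p n" using n by (simp add: hh_eq pp_eq)
  qed
  show ul: "(\<lambda>n. 1 / ((e n)\<^sup>2 * p n)) \<longlonglongrightarrow> 0"
  proof (rule lim[OF l2[OF b_pos(2)]])
    fix n :: nat assume n: "3 \<le> n"
    have "(real n powr (- (b * \<alpha>)))\<^sup>2 * real n powr (b * \<beta>) * real n powr (- (b * (1 - \<alpha>))) = real n powr 0"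
      unfolding power2_eq_square powr_add[symmetric] e1 by (simp add: algebra_simps)
    then have *: "(real n powr (- (b * \<alpha>)))\<^sup>2 * real n powr (b * \<beta>) * real n powr (- (b * (1 - \<alpha>))) = 1" using n by simp
    have "1 / ((e n)\<^sup>2 * p n) = (ln (real n))\<^sup>2 / ((real n powr (- (b * \<alpha>)))\<^sup>2 * real n powr (b * \<beta>))"
      using n by (simp add: pp_eq ee_eq power_divide)
    also have "1 / ((real n powr (- (b * \<alpha>)))\<^sup>2 * real n powr (b * \<beta>)) = real n powr (- (b * (1 - \<alpha>)))"
      using * n by (simp add: divide_eq_eq mult.commute)
    then have "(ln (real n))\<^sup>2 / ((real n powr (- (b * \<alpha>)))\<^sup>2 * real n powr (b * \<beta>)) = (ln (real n))\<^sup>2 * real n powr (- (b * (1 - \<alpha>)))"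
      by (metis times_divide_eq_right mult.right_neutral)
    finally show "(ln (real n))\<^sup>2 * real n powr (- (b * (1 - \<alpha>))) = 1 / ((e n)\<^sup>2 * p n)" by simp
  qed
  show "(\<lambda>n. h n / e n) \<longlonglongrightarrow> 0"
  proof (rule lim[OF l1[OF b_pos(2)]])
    fix n :: nat assume n: "3 \<le> n"
    have "real n powr (- (b * (1 - \<alpha>))) = real n powr (- b) / real n powr (- (b * \<alpha>))"
      unfolding powr_diff[symmetric] by (simp add: algebra_simps)
    then show "ln (real n) * real n powr (- (b * (1 - \<alpha>))) = h n / e n" using n by (simp add: hh_eq ee_eq)
  qed
  have pos: "0 < e n \<and> 0 < h n" if "3 \<le> n" for n
    using that by (simp add: ee_eq hh_eq)
  then show "\<And>n. 3 \<le> n \<Longrightarrow> 0 < e n \<and> 0 < h n" .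
  have "(\<lambda>n. 1 / ((e n)\<^sup>2 * p n) * e n * (1 / p n)) \<longlonglongrightarrow> 0 * 0 * 0"
    by (intro tendsto_mult ul el ql)
  then have "(\<lambda>n. 1 / ((e n)\<^sup>2 * p n) * e n * (1 / p n)) \<longlonglongrightarrow> 0" by simp
  then show "(\<lambda>n. 1 / (e n * (real n * h n))) \<longlonglongrightarrow> 0"
  proof (rule lim)
    fix n :: nat assume n: "3 \<le> n"
    have pn: "p n * p n = real n * h n" using pos[OF n] by (simp add: p_def h_def)
    have "1 / ((e n)\<^sup>2 * p n) * e n * (1 / p n) = 1 / (e n * (p n * p n))"
      using pos[OF n] by (simp add: power2_eq_square)
    then show "1 / ((e n)\<^sup>2 * p n) * e n * (1 / p n) = 1 / (e n * (real n * h n))" by (simp add: pn)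
  qed
qed

theorem theorem3p2:
  fixes z0 \<epsilon> L \<sigma> \<alpha> \<beta> y0 :: real
    and \<epsilon>s :: "nat \<Rightarrow> real"
    and M :: "'a measure" and \<eta> :: "'a \<Rightarrow> real"
  assumes "0 < z0" and "z0 < 1"
    and "0 < \<epsilon>" and "\<epsilon> < 1"
    and "0 < L" and "1 \<le> \<sigma>"
    and "0 < \<alpha>" and "\<alpha> < 1" and "\<beta> = 1 + \<alpha>"
    and "\<And>n. 1 \<le> n \<Longrightarrow> 0 < \<epsilon>s n" and "\<epsilon>s \<longlonglongrightarrow> 0"
    and "prob_space M" and "distributed M lborel \<eta> (normal_density 0 (sqrt (1 / 2)))"
  shows "limsup (\<lambda>n. SUP S\<in>weak_stable_holder n z0 \<beta> \<epsilon> L (\<epsilon>s n).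
            ennreal ((1 - (S z0)\<^sup>2) powr (- 1 / 2)) * ennreal (real n powr (\<beta> / (2 * \<beta> + 1))) *
            robust_risk n y0 \<sigma> z0 (seq_kernel_est n (bandwidth \<beta> n) \<alpha> \<epsilon> z0) S)
         \<le> ennreal (\<integral>\<omega>. \<bar>\<eta> \<omega>\<bar> \<partial>M)"
proof (rule ennreal_le_epsilon)
  fix \<delta> :: real assume \<delta>: "0 < \<delta>"
  \<comment> \<open>Half of \<delta> pays for the smoothing of the absolute value; the other half
    leaves room for convergence of the remainder.\<close>
  define d where "d = \<delta> / 2"
  have d: "0 < d" using \<delta> by (simp add: d_def)
  define C where "C = 1 + y0 ^ 4 + 3 * \<sigma>\<^sup>2 / \<epsilon> ^ 4"
  define m where "m = (\<integral>z. \<bar>z\<bar> \<partial>std_normal)"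
  define h where "h = (\<lambda>n. bandwidth \<beta> n)"
  define p where "p = (\<lambda>n. sqrt (real n * bandwidth \<beta> n))"
  define e where "e = (\<lambda>n. eps_tilde n (bandwidth \<beta> n) \<alpha>)"
  note lims = scale_limits[OF assms(7-9)]
  \<comment> \<open>R depends on neither S nor the noise density, so both suprema can be taken
    before the limit. The weak Hoelder condition enters as its argument
    \<open>\<epsilon>s n\<close>, because h^\<beta> = 1 / p.\<close>
  define R where "R = (\<lambda>n. risk_majorant m C (3 * \<sigma>\<^sup>2) (8 * C + 2 * (3 * \<sigma>\<^sup>2)) (exp 8 * (16 * (3 * \<sigma>\<^sup>2) * C))
       \<epsilon> L d (\<epsilon>s n) (h n) (1 / p n) (e n) (h n * p n * e n) ((h n)\<^sup>2 * p n) (1 / ((e n)\<^sup>2 * p n)))"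
  let ?l = "\<integral>\<omega>. \<bar>\<eta> \<omega>\<bar> \<partial>M"
  have l: "?l = sqrt (1 / 2) * m" unfolding m_def by (rule expectation_abs_half_normal) fact
  have "R \<longlonglongrightarrow> sqrt (1 / 2) * m + d"
    unfolding R_def h_def p_def e_def by (intro tendsto_risk_majorant assms(11) lims(1-6) assms(3) d)
  then have ev1: "eventually (\<lambda>n. R n < ?l + \<delta>) sequentially"
    by (rule order_tendstoD(2)) (use \<delta> in \<open>simp add: l d_def\<close>)
  have ev2: "eventually (\<lambda>n. h n < min z0 (1 - z0)) sequentially"
    unfolding h_def e_def by (rule order_tendstoD(2)[OF lims(1)]) (use assms(1,2) in simp)
  have ev3: "eventually (\<lambda>n. e n < 1 / 2) sequentially"
    unfolding h_def e_def by (rule order_tendstoD(2)[OF lims(3)]) simp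
  have ev4: "eventually (\<lambda>n. h n / e n < \<epsilon> / (32 * L)) sequentially"
    unfolding h_def e_def by (rule order_tendstoD(2)[OF lims(7)]) (use assms(3,5) in simp)
  have ev5: "eventually (\<lambda>n. 1 / (e n * (real n * h n)) < \<epsilon> / 40) sequentially"
    unfolding h_def e_def by (rule order_tendstoD(2)[OF lims(8)]) (use assms(3) in simp)
  have "eventually (\<lambda>n. (SUP S\<in>weak_stable_holder n z0 \<beta> \<epsilon> L (\<epsilon>s n).
            ennreal ((1 - (S z0)\<^sup>2) powr (- 1 / 2)) * ennreal (real n powr (\<beta> / (2 * \<beta> + 1))) *
            robust_risk n y0 \<sigma> z0 (seq_kernel_est n (bandwidth \<beta> n) \<alpha> \<epsilon> z0) S) \<le> ennreal (?l + \<delta>)) sequentially"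
    using ev1 ev2 ev3 ev4 ev5 eventually_ge_at_top[of 3]
  proof eventually_elim
    case (elim n)
    have n3: "3 \<le> n" by fact
    have eh: "0 < e n" "0 < h n" using lims(9)[OF n3] by (auto simp: h_def e_def)
    have c1: "L * h n \<le> \<epsilon> * e n / 32" using elim(4) eh assms(5) by (simp add: field_simps)
    have c2: "40 \<le> \<epsilon> * (e n * (real n * h n))" using elim(5) eh n3 by (simp add: field_simps)
    show ?case
    proof (rule SUP_least)
      fix S assume S: "S \<in> weak_stable_holder n z0 \<beta> \<epsilon> L (\<epsilon>s n)"
      then have Ss: "S \<in> stability_set \<epsilon> L" by (simp add: weak_stable_holder_def)
      have Om: "\<bar>Omega (h n) z0 S\<bar> \<le> \<epsilon>s n / p n"
        using S scales_eq_powr(4)[OF assms(7,9) n3] by (simp add: weak_stable_holder_def h_def p_def)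
      have "\<bar>S z0\<bar> \<le> 1 - \<epsilon>" using Ss assms(1,2) by (auto simp: stability_set_def)
      then have "\<bar>S z0\<bar> < 1" using assms(3) by linarith
      then have g: "0 < 1 - (S z0)\<^sup>2" by (simp add: abs_square_less_1)
      have c: "ennreal ((1 - (S z0)\<^sup>2) powr (- 1 / 2)) * ennreal (real n powr (\<beta> / (2 * \<beta> + 1)))
         = ennreal (p n / sqrt (1 - (S z0)\<^sup>2))"
      proof -
        have "(1 - (S z0)\<^sup>2) powr (- 1 / 2) = 1 / sqrt (1 - (S z0)\<^sup>2)"
          using g by (simp add: powr_minus_divide powr_half_sqrt)
        then show ?thesis using scales_eq_powr(5)[OF assms(7,9) n3] g eh(2)[unfolded h_def]
          by (subst ennreal_mult[symmetric]) (auto simp: p_def)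
      qed
      have "ennreal (p n / sqrt (1 - (S z0)\<^sup>2)) * robust_risk n y0 \<sigma> z0 (seq_kernel_est n (bandwidth \<beta> n) \<alpha> \<epsilon> z0) S \<le> ennreal (R n)"
        unfolding robust_risk_def SUP_mult_left_ennreal
      proof (rule SUP_least)
        fix f assume f: "f \<in> noise_densities \<sigma>"
        show "ennreal (p n / sqrt (1 - (S z0)\<^sup>2)) *
            (\<integral>\<^sup>+y. ennreal \<bar>seq_kernel_est n (bandwidth \<beta> n) \<alpha> \<epsilon> z0 y - S z0\<bar> \<partial>obs_law n y0 S f) \<le> ennreal (R n)"
          using obs_risk_le[of n "h n" z0 S \<epsilon> L f \<sigma> \<alpha> d "\<epsilon>s n" y0] n3 eh elim Ss f assms(3-6) c1 c2 d Om
          unfolding R_def C_def m_def by (simp add: h_def p_def e_def)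
      qed
      also have "\<dots> \<le> ennreal (?l + \<delta>)" using elim(1) by (intro ennreal_leI) simp
      finally show "ennreal ((1 - (S z0)\<^sup>2) powr (- 1 / 2)) * ennreal (real n powr (\<beta> / (2 * \<beta> + 1))) *
            robust_risk n y0 \<sigma> z0 (seq_kernel_est n (bandwidth \<beta> n) \<alpha> \<epsilon> z0) S \<le> ennreal (?l + \<delta>)"
        unfolding c .
    qed
  qed
  then have "limsup (\<lambda>n. SUP S\<in>weak_stable_holder n z0 \<beta> \<epsilon> L (\<epsilon>s n).
            ennreal ((1 - (S z0)\<^sup>2) powr (- 1 / 2)) * ennreal (real n powr (\<beta> / (2 * \<beta> + 1))) *
            robust_risk n y0 \<sigma> z0 (seq_kernel_est n (bandwidth \<beta> n) \<alpha> \<epsilon> z0) S) \<le> ennreal (?l + \<delta>)"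
    by (rule Limsup_bounded)
  also have "ennreal (?l + \<delta>) = ennreal ?l + ennreal \<delta>" using \<delta> by (intro ennreal_plus) auto
  finally show "limsup (\<lambda>n. SUP S\<in>weak_stable_holder n z0 \<beta> \<epsilon> L (\<epsilon>s n).
            ennreal ((1 - (S z0)\<^sup>2) powr (- 1 / 2)) * ennreal (real n powr (\<beta> / (2 * \<beta> + 1))) *
            robust_risk n y0 \<sigma> z0 (seq_kernel_est n (bandwidth \<beta> n) \<alpha> \<epsilon> z0) S) \<le> ennreal ?l + ennreal \<delta>" .
qed

end
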